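(* Let $G$ be a non-elementary hyperbolic group ($\delta$-hyperbolic with respect to a finite generating set $S$) and let $\mathcal H$ be a $K$-quasiconvex subgroup of $G$. Consider an element $x\in G$ of infinite order such that $E(x)\cap\mathcal H=\{e\}$. Then there exists a number $r_0$ (depending on $\mathcal H$ and $x$ only) such that: (i) $(x^s,h)<\frac{r_0}{2}$ for any $h\in\mathcal H$ and $s\in\mathbb Z$; and (ii) for any $r\ge r_0$ there exists $t'>0$ such that for every $t\ge t'$ and $g=x^t$ the subgroup $\mathcal H_1=\langle g,\mathcal H\rangle$ is $(4\delta+4r+\max\{K,|g|/2\})$-quasiconvex, of infinite index in $G$, and canonically isomorphic to $\langle g\rangle *\mathcal H$. Moreover, for this $r$, for $g_i\in\langle g\rangle\setminus\{e\}$ and $h_i\in\mathcal H$ ($1\le i\le n$, $n\ge 1$), the following inequalities hold: $r\ge 48\delta$, $$|g_i|>15r\ (1\le i\le n),\qquad |h_1g_1|\ge|h_1|+|g_1|-2r,$$ $$|g_{i-1}h_ig_i|\ge|g_{i-1}|+|h_i|+|g_i|-2r\ (1<i\le n),$$ $$|h_1g_1\cdots h_ng_n|\ge|h_1g_1\cdots h_{n-1}g_{n-1}|+|h_n|+|g_n|-5r.$$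
   Context: $|g|$ is the word length of $g$ with respect to $S$, and $d(g,h)=|g^{-1}h|$ on $G$, extended to the Cayley graph $Cay(G)$ regarded as a geodesic space. The Gromov product is $(x,y)_z=\frac12(d(x,z)+d(y,z)-d(x,y))$, and $(g,h)=(g,h)_e$, where $e$ is the identity. A space is $\delta$-hyperbolic ($\delta$ a non-negative integer) if $(x,y)_z\ge\min\{(x,t)_z,(y,t)_z\}-\delta$ for all points $x,y,z,t$; $G$ is $\delta$-hyperbolic if $Cay(G)$ is. A group is elementary if it contains a cyclic subgroup of finite index; $E(x)$ is the unique maximal elementary subgroup of $G$ containing the infinite-order element $x$. A subgroup $A$ of $G$ is $K$-quasiconvex if every geodesic in $Cay(G)$ joining two elements of $A$ lies in the closed $K$-neighborhood of $A$. "Canonically isomorphic" means that the natural homomorphism $\langle g\rangle*\mathcal H\to\langle g,\mathcal H\rangle$ induced by the inclusions is an isomorphism.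
   Formalization: In the displayed inequalities the elements h_i with 1 < i ≤ n are required to be nontrivial (h_1 stays arbitrary); with h_i = e allowed the inequalities fail, e.g. n = 2, h_1 = h_2 = e, g_2 = g_1^{-1}. *)

theory Defs
  imports Complex_Main "HOL-Algebra.Algebra"
begin

section \<open>Word metric and Cayley graph\<close>

definition word_length :: "('a, 'b) monoid_scheme \<Rightarrow> 'a set \<Rightarrow> 'a \<Rightarrow> real" where
  "word_length G S g = real (LEAST n. \<exists>w. length w = n \<and>
     set w \<subseteq> S \<union> m_inv G ` S \<and> foldr (\<otimes>\<^bsub>G\<^esub>) w \<one>\<^bsub>G\<^esub> = g)"

definition word_dist :: "('a, 'b) monoid_scheme \<Rightarrow> 'a set \<Rightarrow> 'a \<Rightarrow> 'a \<Rightarrow> real" where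
  "word_dist G S g h = word_length G S (inv\<^bsub>G\<^esub> g \<otimes>\<^bsub>G\<^esub> h)"

definition cayley_adj :: "('a, 'b) monoid_scheme \<Rightarrow> 'a set \<Rightarrow> 'a \<Rightarrow> 'a \<Rightarrow> bool" where
  "cayley_adj G S a b \<longleftrightarrow> a \<in> carrier G \<and> b \<in> carrier G \<and> a \<noteq> b \<and>
     inv\<^bsub>G\<^esub> a \<otimes>\<^bsub>G\<^esub> b \<in> S \<union> m_inv G ` S"

text \<open>The Cayley graph is taken as a simple undirected graph (\<open>g\<close> and \<open>gs\<close> are joined by one
  edge, which is also the edge from \<open>gs\<close> to \<open>gss\<inverse>\<close>; no loops).  A point of its geometric
  realization is given by its barycentric coordinates: a function on the vertices with
  nonnegative values summing to 1, supported on a single vertex or on the two ends of an edge.\<close>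

definition supp :: "('a \<Rightarrow> real) \<Rightarrow> 'a set" where
  "supp p = {v. p v \<noteq> 0}"

definition cayley_points :: "('a, 'b) monoid_scheme \<Rightarrow> 'a set \<Rightarrow> ('a \<Rightarrow> real) set" where
  "cayley_points G S = {p. (\<forall>v. 0 \<le> p v) \<and>
     (\<exists>a\<in>carrier G. \<exists>b\<in>carrier G. (a = b \<or> cayley_adj G S a b) \<and>
        supp p \<subseteq> {a, b} \<and> sum p {a, b} = 1)}"

definition cayley_vertex :: "'a \<Rightarrow> 'a \<Rightarrow> real" where
  "cayley_vertex a = (\<lambda>v. if v = a then 1 else 0)"

text \<open>The path metric in which every edge is isometric to \<open>[0,1]\<close>.  Two points of one closed
  edge \<open>ab\<close> are at distance \<open>\<bar>p a - q a\<bar> = (\<bar>p a - q a\<bar> + \<bar>p b - q b\<bar>)/2\<close>.  Otherwise a shortest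
  path leaves the edge of \<open>p\<close> through an end \<open>a\<close>, at distance \<open>1 - p a\<close> from \<open>p\<close>, and enters the
  edge of \<open>q\<close> through an end \<open>b\<close>, at distance \<open>1 - q b\<close> from \<open>q\<close>.\<close>

definition cayley_dist ::
  "('a, 'b) monoid_scheme \<Rightarrow> 'a set \<Rightarrow> ('a \<Rightarrow> real) \<Rightarrow> ('a \<Rightarrow> real) \<Rightarrow> real" where
  "cayley_dist G S p q =
     (if \<exists>a b. (a = b \<or> cayley_adj G S a b) \<and> supp p \<union> supp q \<subseteq> {a, b}
      then (\<Sum>v\<in>supp p \<union> supp q. \<bar>p v - q v\<bar>) / 2
      else Min {(1 - p a) + word_dist G S a b + (1 - q b) | a b. a \<in> supp p \<and> b \<in> supp q})"

section \<open>Hyperbolicity and quasiconvexity\<close>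

definition gromov_product :: "('p \<Rightarrow> 'p \<Rightarrow> real) \<Rightarrow> 'p \<Rightarrow> 'p \<Rightarrow> 'p \<Rightarrow> real" where
  "gromov_product d z x y = (d x z + d y z - d x y) / 2"

definition hyperbolic_space :: "'p set \<Rightarrow> ('p \<Rightarrow> 'p \<Rightarrow> real) \<Rightarrow> nat \<Rightarrow> bool" where
  "hyperbolic_space M d \<delta> \<longleftrightarrow> (\<forall>x\<in>M. \<forall>y\<in>M. \<forall>z\<in>M. \<forall>t\<in>M.
     gromov_product d z x y \<ge>
       min (gromov_product d z x t) (gromov_product d z y t) - real \<delta>)"

definition hyperbolic_group :: "('a, 'b) monoid_scheme \<Rightarrow> 'a set \<Rightarrow> nat \<Rightarrow> bool" where
  "hyperbolic_group G S \<delta> \<longleftrightarrow> hyperbolic_space (cayley_points G S) (cayley_dist G S) \<delta>"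

definition geodesic_path ::
  "'p set \<Rightarrow> ('p \<Rightarrow> 'p \<Rightarrow> real) \<Rightarrow> real \<Rightarrow> (real \<Rightarrow> 'p) \<Rightarrow> bool" where
  "geodesic_path M d L \<gamma> \<longleftrightarrow> 0 \<le> L \<and> \<gamma> ` {0..L} \<subseteq> M \<and>
     (\<forall>s\<in>{0..L}. \<forall>t\<in>{0..L}. d (\<gamma> s) (\<gamma> t) = \<bar>s - t\<bar>)"

text \<open>Distances from a fixed point of the Cayley graph to the vertices form a discrete set, so
  the distance to \<open>A\<close> is attained and its closed \<open>K\<close>-neighborhood is the union of the closed
  \<open>K\<close>-balls around the elements of \<open>A\<close>.\<close>

definition quasiconvex :: "('a, 'b) monoid_scheme \<Rightarrow> 'a set \<Rightarrow> real \<Rightarrow> 'a set \<Rightarrow> bool" where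
  "quasiconvex G S K A \<longleftrightarrow> (\<forall>a\<in>A. \<forall>b\<in>A. \<forall>L \<gamma>.
     geodesic_path (cayley_points G S) (cayley_dist G S) L \<gamma> \<and>
     \<gamma> 0 = cayley_vertex a \<and> \<gamma> L = cayley_vertex b \<longrightarrow>
     (\<forall>u\<in>{0..L}. \<exists>c\<in>A. cayley_dist G S (\<gamma> u) (cayley_vertex c) \<le> K))"

section \<open>Elementary subgroups\<close>

definition elementary_group :: "('a, 'b) monoid_scheme \<Rightarrow> bool" where
  "elementary_group G \<longleftrightarrow> (\<exists>C. subgroup C G \<and> cyclic_group (G\<lparr>carrier := C\<rparr>) \<and>
     finite (rcosets\<^bsub>G\<^esub> C))"

definition elementary_subgroup :: "'a set \<Rightarrow> ('a, 'b) monoid_scheme \<Rightarrow> bool" where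
  "elementary_subgroup E G \<longleftrightarrow> subgroup E G \<and> elementary_group (G\<lparr>carrier := E\<rparr>)"

definition max_elementary :: "('a, 'b) monoid_scheme \<Rightarrow> 'a \<Rightarrow> 'a set" where
  "max_elementary G x = (THE E. elementary_subgroup E G \<and> x \<in> E \<and>
     (\<forall>E'. elementary_subgroup E' G \<and> E \<subseteq> E' \<longrightarrow> E' = E))"

section \<open>Free products\<close>

text \<open>The free product of \<open>A\<close> and \<open>B\<close>: words in the disjoint union of the two carriers, modulo
  the congruence generated by multiplication in the factors and deletion of their identities.\<close>

inductive_set free_product_rel ::
  "('a, 'c) monoid_scheme \<Rightarrow> ('b, 'd) monoid_scheme \<Rightarrow> (('a + 'b) list \<times> ('a + 'b) list) set"
  for A :: "('a, 'c) monoid_scheme" and B :: "('b, 'd) monoid_scheme"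
  where
    mult_left: "\<lbrakk>u \<in> lists (carrier A <+> carrier B); v \<in> lists (carrier A <+> carrier B);
        a \<in> carrier A; a' \<in> carrier A\<rbrakk> \<Longrightarrow>
      (u @ [Inl a, Inl a'] @ v, u @ [Inl (a \<otimes>\<^bsub>A\<^esub> a')] @ v) \<in> free_product_rel A B"
  | mult_right: "\<lbrakk>u \<in> lists (carrier A <+> carrier B); v \<in> lists (carrier A <+> carrier B);
        b \<in> carrier B; b' \<in> carrier B\<rbrakk> \<Longrightarrow>
      (u @ [Inr b, Inr b'] @ v, u @ [Inr (b \<otimes>\<^bsub>B\<^esub> b')] @ v) \<in> free_product_rel A B"
  | one_left: "\<lbrakk>u \<in> lists (carrier A <+> carrier B); v \<in> lists (carrier A <+> carrier B)\<rbrakk> \<Longrightarrow>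
      (u @ [Inl \<one>\<^bsub>A\<^esub>] @ v, u @ v) \<in> free_product_rel A B"
  | one_right: "\<lbrakk>u \<in> lists (carrier A <+> carrier B); v \<in> lists (carrier A <+> carrier B)\<rbrakk> \<Longrightarrow>
      (u @ [Inr \<one>\<^bsub>B\<^esub>] @ v, u @ v) \<in> free_product_rel A B"
  | refl: "u \<in> lists (carrier A <+> carrier B) \<Longrightarrow> (u, u) \<in> free_product_rel A B"
  | sym: "(u, v) \<in> free_product_rel A B \<Longrightarrow> (v, u) \<in> free_product_rel A B"
  | trans: "\<lbrakk>(u, v) \<in> free_product_rel A B; (v, w) \<in> free_product_rel A B\<rbrakk> \<Longrightarrow>
      (u, w) \<in> free_product_rel A B"

definition free_product ::
  "('a, 'c) monoid_scheme \<Rightarrow> ('b, 'd) monoid_scheme \<Rightarrow> ('a + 'b) list set monoid" where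
  "free_product A B =
     \<lparr>carrier = lists (carrier A <+> carrier B) // free_product_rel A B,
      monoid.mult = (\<lambda>U V. \<Union>u\<in>U. \<Union>v\<in>V. free_product_rel A B `` {u @ v}),
      one = free_product_rel A B `` {[]}\<rparr>"

definition eval_word ::
  "('c, 'd) monoid_scheme \<Rightarrow> ('a \<Rightarrow> 'c) \<Rightarrow> ('b \<Rightarrow> 'c) \<Rightarrow> ('a + 'b) list \<Rightarrow> 'c" where
  "eval_word C f k w = foldr (\<lambda>l c. case_sum f k l \<otimes>\<^bsub>C\<^esub> c) w \<one>\<^bsub>C\<^esub>"

text \<open>The homomorphism from the free product to \<open>C\<close> induced by \<open>f\<close> and \<open>k\<close>; \<open>eval_word\<close> is
  constant on each class when \<open>f\<close> and \<open>k\<close> are homomorphisms.\<close>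

definition free_product_map ::
  "('c, 'd) monoid_scheme \<Rightarrow> ('a \<Rightarrow> 'c) \<Rightarrow> ('b \<Rightarrow> 'c) \<Rightarrow> ('a + 'b) list set \<Rightarrow> 'c" where
  "free_product_map C f k U = the_elem (eval_word C f k ` U)"

text \<open>For subgroups \<open>A, B \<subseteq> C\<close> of \<open>G\<close>: the homomorphism from the free product of \<open>A\<close> and
  \<open>B\<close> to \<open>C\<close> induced by the inclusions is an isomorphism.\<close>

definition canonically_free_product ::
  "('a, 'b) monoid_scheme \<Rightarrow> 'a set \<Rightarrow> 'a set \<Rightarrow> 'a set \<Rightarrow> bool" where
  "canonically_free_product G A B C \<longleftrightarrow>
     free_product_map (G\<lparr>carrier := C\<rparr>) (\<lambda>a. a) (\<lambda>b. b) \<in>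
       iso (free_product (G\<lparr>carrier := A\<rparr>) (G\<lparr>carrier := B\<rparr>)) (G\<lparr>carrier := C\<rparr>)"

section \<open>Alternating products\<close>

text \<open>\<open>alternating_product G h g n\<close> is the product $h_1 g_1 \cdots h_n g_n$.\<close>

primrec alternating_product ::
  "('a, 'b) monoid_scheme \<Rightarrow> (nat \<Rightarrow> 'a) \<Rightarrow> (nat \<Rightarrow> 'a) \<Rightarrow> nat \<Rightarrow> 'a" where
  "alternating_product G h g 0 = \<one>\<^bsub>G\<^esub>"
| "alternating_product G h g (Suc n) =
     alternating_product G h g n \<otimes>\<^bsub>G\<^esub> h (Suc n) \<otimes>\<^bsub>G\<^esub> g (Suc n)"

end

theory Submission
  imports Defs
begin

text \<open>Hyperbolicity enters only through the four-point condition on vertices. An element \<open>x\<close> of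
  infinite order has a conjugate of a power whose square is much longer than itself, since otherwise
  some point would be displaced by a bounded amount by arbitrarily many powers of \<open>x\<close>; hence the
  powers of \<open>x\<close> lie uniformly close to geodesics, and \<open>E(x)\<close> is the commensurator of \<open>\<langle>x\<rangle>\<close>. If a
  geodesic from \<open>\<one>\<close> to a power of \<open>x\<close> fellow-travelled \<open>\<H>\<close>, or a translate \<open>h\<langle>x\<rangle>\<close> with \<open>h \<in> \<H>\<close>,
  for too long, then the pigeonhole principle in a ball would give a nontrivial element of
  \<open>E(x) \<inter> \<H>\<close>. So Gromov products at the corners of the broken geodesic
  \<open>h\<^sub>1g\<^sub>1\<dots>h\<^sub>ng\<^sub>n\<close> are bounded, and its edges are long: local geodesicity gives the inequalities,
  freeness and quasiconvexity. For infinite index, if \<open>h \<noteq> \<one>\<close> and \<open>s\<close> is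
  large but at most \<open>t/3\<close>, then no nontrivial power of \<open>hx\<^sup>-\<^sup>s\<close> lies in \<open>\<langle>x\<^sup>t, \<H>\<rangle>\<close>.\<close>

section \<open>Four-point hyperbolicity\<close>

text \<open>A bound \<open>gp z a b \<le> \<epsilon>\<close> serves throughout as a substitute for
  lying near a geodesic from \<open>a\<close> to \<open>b\<close>; geodesic paths occur only where
  \<open>quasiconvex\<close> is applied or established. The main obstacle is uniformity over the
  infinite set \<open>H\<close>: the overlap bound for \<open>\<langle>x\<rangle>\<close> and a
  translate \<open>h\<langle>x\<rangle>\<close> depends on \<open>h\<close>. It is applied only to
  short \<open>h\<close>, of which there are finitely many; for long \<open>h\<close> a geodesic
  from \<open>\<one>\<close> to \<open>h x^b\<close> follows the one to \<open>h\<close> for so long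
  that the overlap of the axis with \<open>H\<close> itself decides. The term \<open>|g|/2\<close>
  in the quasiconvexity constant arises because the lengths of consecutive powers of
  \<open>g\<close> grow by at most \<open>|g|\<close>, so that every level along the axis is within
  half of this of the level of some power. Non-elementarity enters only for trivial
  \<open>H\<close>, where the generated subgroup is cyclic.\<close>

locale hyp_metric =
  fixes M :: "'p set" and d :: "'p \<Rightarrow> 'p \<Rightarrow> real" and \<delta> :: real
  assumes delta_nonneg: "0 \<le> \<delta>"
    and dist_self: "x \<in> M \<Longrightarrow> d x x = 0"
    and dist_sym: "\<lbrakk>x \<in> M; y \<in> M\<rbrakk> \<Longrightarrow> d x y = d y x"
    and dist_tri: "\<lbrakk>x \<in> M; y \<in> M; z \<in> M\<rbrakk> \<Longrightarrow> d x z \<le> d x y + d y z"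
    and hyp: "\<lbrakk>x \<in> M; y \<in> M; z \<in> M; t \<in> M\<rbrakk> \<Longrightarrow> gromov_product d z x y \<ge>
       min (gromov_product d z x t) (gromov_product d z y t) - \<delta>"
begin

abbreviation gp where "gp \<equiv> gromov_product d"

lemma gp_double: "2 * gp z x y = d x z + d y z - d x y"
  by (simp add: gromov_product_def)

text \<open>The distances to the base point cancel, which leaves a symmetric condition: of the three
  sums belonging to the pairings of four points, the two largest differ by at most
  \<open>2 * \<delta>\<close>.\<close>

lemma four_point:
  assumes "x \<in> M" "y \<in> M" "z \<in> M" "t \<in> M"
  shows "d x y + d z t \<le> max (d x z + d y t) (d x t + d y z) + 2 * \<delta>"
  using hyp[OF assms] dist_sym[OF assms(1,4)] dist_sym[OF assms(2,4)] dist_sym[OF assms(3,4)]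
  unfolding gromov_product_def by (auto simp: min_def max_def field_simps split: if_splits)

lemma gp_sym: "gp z x y = gp z y x" if "x \<in> M" "y \<in> M"
  using dist_sym[OF that] by (simp add: gromov_product_def)

lemma gp_nonneg: "0 \<le> gp z x y" if "x \<in> M" "y \<in> M" "z \<in> M"
  using dist_tri[of x z y] dist_sym[of y z] that by (simp add: gromov_product_def)

text \<open>Turns a small product at one end of a long edge into a large product at the other end,
  which is the form that \<open>hyp\<close> can exploit.\<close>

lemma gp_swap: "gp z x y = d z x - gp x z y" if "x \<in> M" "y \<in> M" "z \<in> M"
  using that dist_sym[of x y] dist_sym[of x z] dist_sym[of z y]
  by (simp add: gromov_product_def field_simps)

lemma gp_le: "gp z x y \<le> d z x" if "x \<in> M" "y \<in> M" "z \<in> M"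
  using gp_swap[OF that] gp_nonneg[of z y x] that by simp

lemma gp_base: "gp z x y \<le> gp w x y + d z w" if "x \<in> M" "y \<in> M" "z \<in> M" "w \<in> M"
  using that dist_tri[of x w z] dist_tri[of y w z] dist_sym[of z w]
  by (simp add: gromov_product_def field_simps)

lemma gp_arg: "gp z x y \<le> gp z x' y + d x x'" if "x \<in> M" "y \<in> M" "z \<in> M" "x' \<in> M"
  using that dist_tri[of x x' z] dist_tri[of x' x y] dist_sym[of x x']
  by (simp add: gromov_product_def field_simps)

text \<open>Both crossed sums in the four-point inequality exceed \<open>d a b\<close> by at most
  the difference of levels plus \<open>2 * \<epsilon>\<close>. Points near one geodesic are thus
  located, up to a constant, by their distance from \<open>a\<close>.\<close>

lemma near_points_close:
  assumes M: "a \<in> M" "b \<in> M" "u \<in> M" "v \<in> M" and u: "gp u a b \<le> \<epsilon>" and v: "gp v a b \<le> \<epsilon>"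
  shows "d u v \<le> \<bar>d a u - d a v\<bar> + 2 * \<epsilon> + 2 * \<delta>"
proof -
  have "d a b + d u v \<le> max (d a u + d b v) (d a v + d b u) + 2 * \<delta>"
    by (rule four_point) (use M in auto)
  moreover have "d a u + d b u \<le> d a b + 2 * \<epsilon>" "d a v + d b v \<le> d a b + 2 * \<epsilon>"
    using u v by (auto simp: gromov_product_def field_simps)
  ultimately show ?thesis by (auto simp: max_def split: if_splits)
qed

text \<open>With the levels in the order \<open>u\<close>, \<open>z\<close>, \<open>v\<close> the
  level differences telescope, and each use of \<open>near_points_close\<close> adds
  \<open>2 * \<epsilon> + 2 * \<delta>\<close>, halved in the product.\<close>

lemma gp_between:
  assumes M: "a \<in> M" "b \<in> M" "u \<in> M" "v \<in> M" "z \<in> M"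
    and g: "gp u a b \<le> \<epsilon>" "gp v a b \<le> \<epsilon>" "gp z a b \<le> \<epsilon>"
    and le: "d a u \<le> d a z" "d a z \<le> d a v"
  shows "gp z u v \<le> 2 * \<epsilon> + 2 * \<delta>"
proof -
  have "d u z \<le> d a z - d a u + 2 * \<epsilon> + 2 * \<delta>" "d v z \<le> d a v - d a z + 2 * \<epsilon> + 2 * \<delta>"
    using near_points_close[of a b u z \<epsilon>] near_points_close[of a b v z \<epsilon>] M g le by auto
  moreover have "d a v \<le> d a u + d u v" using M by (intro dist_tri) auto
  ultimately show ?thesis by (simp add: gromov_product_def)
qed

text \<open>By \<open>gp_swap\<close> a long edge turns the bound at \<open>v j\<close> into a large
  product of \<open>v 0\<close> and \<open>v j\<close> at \<open>v (j + 1)\<close>. Seen from there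
  both points look alike, so the corner bound passes from \<open>v j\<close> to \<open>v 0\<close>
  at the cost of a single \<open>\<delta>\<close> that does not accumulate. The first and the last
  edge may be short, so a path may end in a trivial factor.\<close>

lemma chain_forward:
  fixes v :: "nat \<Rightarrow> 'p"
  assumes M: "\<And>j. j \<le> m \<Longrightarrow> v j \<in> M"
    and g: "\<And>j. \<lbrakk>0 < j; j < m\<rbrakk> \<Longrightarrow> gp (v j) (v (j - 1)) (v (j + 1)) \<le> c"
    and L: "\<And>j. \<lbrakk>1 < j; j < m\<rbrakk> \<Longrightarrow> d (v (j - 1)) (v j) > 2 * c + 2 * \<delta>"
    and j: "0 < j" "j < m"
  shows "gp (v j) (v 0) (v (j + 1)) \<le> c + \<delta>"
  using j
proof (induction j)
  case (Suc j)
  show ?case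
  proof (cases "j = 0")
    case True
    then show ?thesis using g[of 1] Suc.prems delta_nonneg by auto
  next
    case False
    have IH: "gp (v j) (v 0) (v (Suc j)) \<le> c + \<delta>" using Suc False by auto
    have "gp (v (Suc j)) (v 0) (v j) = d (v j) (v (Suc j)) - gp (v j) (v 0) (v (Suc j))"
      using gp_swap[of "v j" "v 0" "v (Suc j)"] gp_sym[of "v 0" "v j" "v (Suc j)"]
        gp_sym[of "v 0" "v (Suc j)" "v j"] dist_sym[of "v j" "v (Suc j)"] M Suc.prems by auto
    moreover have "d (v j) (v (Suc j)) > 2 * c + 2 * \<delta>" using L[of "Suc j"] Suc.prems False by auto
    ultimately have far: "gp (v (Suc j)) (v 0) (v j) > c + \<delta>" using IH by linarith
    have "gp (v (Suc j)) (v j) (v (Suc j + 1)) \<le> c" using g[of "Suc j"] Suc.prems by auto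
    moreover have "gp (v (Suc j)) (v j) (v (Suc j + 1)) \<ge>
      min (gp (v (Suc j)) (v j) (v 0)) (gp (v (Suc j)) (v (Suc j + 1)) (v 0)) - \<delta>"
      by (rule hyp) (use M Suc.prems in auto)
    ultimately show ?thesis
      using far gp_sym[of "v 0" "v j" "v (Suc j)"] gp_sym[of "v 0" "v (Suc j+1)" "v (Suc j)"] M Suc.prems
      by (auto simp: min_def split: if_splits)
  qed
qed simp

text \<open>The forward estimate holds for the path and for its reversal \<open>w\<close>. At
  \<open>v j\<close> the points \<open>v 0\<close> and \<open>v (j - 1)\<close> look alike, and the
  reversed estimate bounds the product of \<open>v m\<close> and \<open>v (j - 1)\<close>; one more
  \<open>hyp\<close> joins the two.\<close>

lemma chain:
  fixes v :: "nat \<Rightarrow> 'p"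
  assumes M: "\<And>j. j \<le> m \<Longrightarrow> v j \<in> M"
    and g: "\<And>j. \<lbrakk>0 < j; j < m\<rbrakk> \<Longrightarrow> gp (v j) (v (j - 1)) (v (j + 1)) \<le> c"
    and L: "\<And>j. \<lbrakk>1 < j; j < m\<rbrakk> \<Longrightarrow> d (v (j - 1)) (v j) > 2 * c + 3 * \<delta>"
    and j: "0 < j" "j < m"
  shows "gp (v j) (v 0) (v m) \<le> c + 2 * \<delta>"
proof -
  have fwd: "gp (v i) (v 0) (v (i + 1)) \<le> c + \<delta>" if "0 < i" "i < m" for i
    by (rule chain_forward[of m]) (use M g L that delta_nonneg in fastforce)+
  define w where "w i = v (m - i)" for i
  have "gp (w (m - j)) (w 0) (w (m - j + 1)) \<le> c + \<delta>"
  proof (rule chain_forward[of m])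
    show "w i \<in> M" if "i \<le> m" for i using M that by (simp add: w_def)
    show "gp (w i) (w (i - 1)) (w (i + 1)) \<le> c" if "0 < i" "i < m" for i
    proof -
      have "m - (i - 1) = m - i + 1" "m - (i + 1) = m - i - 1" using that by auto
      then show ?thesis using g[of "m - i"] gp_sym[of "v (m - i - 1)" "v (m - i + 1)" "v (m - i)"] M that
        by (simp add: w_def)
    qed
    show "d (w (i - 1)) (w i) > 2 * c + 2 * \<delta>" if "1 < i" "i < m" for i
    proof -
      have "m - (i - 1) = m - i + 1" "m - i + 1 < m" using that by auto
      then show ?thesis using L[of "m - i + 1"] dist_sym[of "v (m - i)" "v (m - i + 1)"] M that delta_nonneg
        by (simp add: w_def)
    qed
  qed (use j in auto)
  moreover have "m - (m - j) = j" "m - (m - j + 1) = j - 1" using j by auto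
  ultimately have bwd: "gp (v j) (v m) (v (j - 1)) \<le> c + \<delta>" by (simp add: w_def)
  show ?thesis
  proof (cases "j = 1")
    case True
    then show ?thesis using bwd gp_sym[of "v m" "v 0" "v j"] M j delta_nonneg by auto
  next
    case False
    have "gp (v j) (v 0) (v (j - 1)) = d (v (j - 1)) (v j) - gp (v (j - 1)) (v 0) (v j)"
      using gp_swap[of "v (j - 1)" "v 0" "v j"] gp_sym[of "v 0" "v (j - 1)" "v j"]
        gp_sym[of "v 0" "v j" "v (j - 1)"] dist_sym[of "v (j - 1)" "v j"] M j by auto
    moreover have "gp (v (j - 1)) (v 0) (v j) \<le> c + \<delta>" using fwd[of "j - 1"] j False by auto
    moreover have "d (v (j - 1)) (v j) > 2 * c + 3 * \<delta>" using L[of j] j False by auto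
    ultimately have far: "gp (v j) (v 0) (v (j - 1)) > c + 2 * \<delta>" by linarith
    have "gp (v j) (v m) (v (j - 1)) \<ge>
      min (gp (v j) (v m) (v 0)) (gp (v j) (v (j - 1)) (v 0)) - \<delta>"
      by (rule hyp) (use M j in auto)
    then show ?thesis
      using far bwd gp_sym[of "v 0" "v m" "v j"] gp_sym[of "v 0" "v (j - 1)" "v j"] M j
      by (auto simp: min_def split: if_splits)
  qed
qed

text \<open>A discrete intermediate value principle without monotonicity. The alternative
  \<open>f j = s\<close> covers \<open>n = 0\<close>, where there is no step to cross.\<close>

lemma real_step_crossing:
  fixes f :: "nat \<Rightarrow> real"
  assumes "f 0 \<le> s" "s \<le> f n"
  shows "\<exists>j\<le>n. (j < n \<and> f j \<le> s \<and> s \<le> f (Suc j)) \<or> f j = s"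
  using assms
proof (induction n)
  case 0
  then show ?case by auto
next
  case (Suc n)
  show ?case
  proof (cases "s \<le> f n")
    case True
    then show ?thesis using Suc by (meson le_Suc_eq less_Suc_eq)
  next
    case False
    then show ?thesis using Suc.prems by (intro exI[of _ n]) auto
  qed
qed

end

section \<open>The word metric\<close>

locale fg_group = group +
  fixes S
  assumes S_fin: "finite S" and S_sub: "S \<subseteq> carrier G" and S_gen: "generate G S = carrier G"
begin

abbreviation wl where "wl \<equiv> word_length G S"
abbreviation wd where "wd \<equiv> word_dist G S"
abbreviation letters where "letters \<equiv> S \<union> m_inv G ` S"
abbreviation wprod where "wprod w \<equiv> foldr (\<otimes>) w \<one>"

lemma letters_carrier: "letters \<subseteq> carrier G"
  using S_sub by auto

lemma letters_inv: "s \<in> letters \<Longrightarrow> inv s \<in> letters"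
  using S_sub by auto

lemma wprod_closed [simp, intro]: "set w \<subseteq> carrier G \<Longrightarrow> wprod w \<in> carrier G"
  by (induction w) auto

lemma wprod_append: "\<lbrakk>set u \<subseteq> carrier G; set v \<subseteq> carrier G\<rbrakk> \<Longrightarrow> wprod (u @ v) = wprod u \<otimes> wprod v"
  by (induction u) (auto simp: m_assoc)

lemma wprod_inv: "set w \<subseteq> carrier G \<Longrightarrow> wprod (rev (map (m_inv G) w)) = inv (wprod w)"
proof (induction w)
  case (Cons a w)
  have "wprod (rev (map (m_inv G) w) @ [inv a]) = wprod (rev (map (m_inv G) w)) \<otimes> wprod [inv a]"
    by (rule wprod_append) (use Cons.prems in auto)
  then show ?case using Cons by (simp add: inv_mult_group)
qed simp

definition spells where
  "spells g n \<longleftrightarrow> (\<exists>w. length w = n \<and> set w \<subseteq> letters \<and> wprod w = g)"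

lemma spells_ex: "g \<in> carrier G \<Longrightarrow> \<exists>n. spells g n"
proof -
  assume "g \<in> carrier G"
  then have "g \<in> generate G S" using S_gen by simp
  then have "\<exists>w. set w \<subseteq> letters \<and> wprod w = g"
  proof induction
    case one
    then show ?case by (intro exI[of _ "[]"]) auto
  next
    case (incl h)
    then show ?case using S_sub by (intro exI[of _ "[h]"]) auto
  next
    case (inv h)
    then show ?case using S_sub by (intro exI[of _ "[inv h]"]) auto
  next
    case (eng g h)
    then obtain u v where "set u \<subseteq> letters" "wprod u = g" "set v \<subseteq> letters" "wprod v = h" by auto
    then show ?case using wprod_append[of u v] letters_carrier by (intro exI[of _ "u @ v"]) auto
  qed
  then show ?thesis by (auto simp: spells_def)
qed

lemma wl_eq: "wl g = real (LEAST n. spells g n)"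
  by (simp add: word_length_def spells_def)

lemma wl_spells: "g \<in> carrier G \<Longrightarrow> \<exists>n. wl g = real n \<and> spells g n"
  using spells_ex[of g] LeastI_ex[of "spells g"] by (auto simp: wl_eq)

lemma wl_le: "spells g n \<Longrightarrow> wl g \<le> real n"
  by (simp add: wl_eq Least_le)

lemma wl_nonneg [simp]: "0 \<le> wl g"
  by (simp add: wl_eq)

lemma wl_one [simp]: "wl \<one> = 0"
proof -
  have "spells \<one> 0" by (simp add: spells_def)
  from wl_le[OF this] show ?thesis by (simp add: order_antisym)
qed

lemma wl_mult: assumes "g \<in> carrier G" "h \<in> carrier G" shows "wl (g \<otimes> h) \<le> wl g + wl h"
proof -
  obtain n m where n: "wl g = real n" "spells g n" "wl h = real m" "spells h m"
    using wl_spells assms by blast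
  then obtain u v where uv: "length u = n" "set u \<subseteq> letters" "wprod u = g" "length v = m"
    "set v \<subseteq> letters" "wprod v = h" by (auto simp: spells_def)
  have "spells (g \<otimes> h) (n + m)"
    unfolding spells_def using wprod_append[of u v] uv letters_carrier by (intro exI[of _ "u @ v"]) auto
  from wl_le[OF this] show ?thesis using n by simp
qed

lemma wl_inv_le: assumes "g \<in> carrier G" shows "wl (inv g) \<le> wl g"
proof -
  obtain n where n: "wl g = real n" "spells g n"
    using wl_spells assms by blast
  then obtain u where u: "length u = n" "set u \<subseteq> letters" "wprod u = g" by (auto simp: spells_def)
  have "set (rev (map (m_inv G) u)) \<subseteq> letters" using u(2) letters_inv by (simp only: set_rev set_map) blast
  moreover have "wprod (rev (map (m_inv G) u)) = inv g" using wprod_inv[of u] u letters_carrier by auto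
  ultimately have "spells (inv g) n" using u(1) unfolding spells_def
    by (intro exI[of _ "rev (map (m_inv G) u)"]) auto
  from wl_le[OF this] show ?thesis using n by simp
qed

lemma wl_inv [simp]: "g \<in> carrier G \<Longrightarrow> wl (inv g) = wl g"
  using wl_inv_le[of g] wl_inv_le[of "inv g"] by auto

lemma wd_self [simp]: "a \<in> carrier G \<Longrightarrow> wd a a = 0"
  by (simp add: word_dist_def)

lemma wd_sym: "\<lbrakk>a \<in> carrier G; b \<in> carrier G\<rbrakk> \<Longrightarrow> wd a b = wd b a"
  using wl_inv[of "inv a \<otimes> b"] by (simp add: word_dist_def inv_mult_group)

lemma wd_tri: assumes "a \<in> carrier G" "b \<in> carrier G" "c \<in> carrier G"
  shows "wd a c \<le> wd a b + wd b c"
proof -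
  have "b \<otimes> (inv b \<otimes> c) = c" using assms by (simp add: m_assoc[symmetric])
  then have "inv a \<otimes> c = (inv a \<otimes> b) \<otimes> (inv b \<otimes> c)"
    using assms by (simp add: m_assoc)
  then show ?thesis using wl_mult[of "inv a \<otimes> b" "inv b \<otimes> c"] assms by (simp add: word_dist_def)
qed

lemma wd_left [simp]:
  assumes "g \<in> carrier G" "a \<in> carrier G" "b \<in> carrier G"
  shows "wd (g \<otimes> a) (g \<otimes> b) = wd a b"
proof -
  have "inv (g \<otimes> a) \<otimes> (g \<otimes> b) = inv a \<otimes> b"
    using assms by (simp add: inv_mult_group m_assoc) (simp add: m_assoc[symmetric])
  then show ?thesis by (simp add: word_dist_def)
qed

lemma wd_mult_right [simp]: "\<lbrakk>g \<in> carrier G; a \<in> carrier G\<rbrakk> \<Longrightarrow> wd g (g \<otimes> a) = wl a"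
  by (simp add: word_dist_def m_assoc[symmetric])

lemma wd_one_left [simp]: "a \<in> carrier G \<Longrightarrow> wd \<one> a = wl a"
  by (simp add: word_dist_def)

lemma wd_one_right [simp]: "a \<in> carrier G \<Longrightarrow> wd a \<one> = wl a"
  by (simp add: word_dist_def)

lemma wd_nonneg [simp]: "0 \<le> wd a b"
  by (simp add: word_dist_def)

section \<open>Finite balls and discrete geodesics\<close>

lemma finite_ball: "finite {g \<in> carrier G. wl g \<le> R}"
proof -
  have "{g \<in> carrier G. wl g \<le> R} \<subseteq> wprod ` {w. set w \<subseteq> letters \<and> length w \<le> nat \<lfloor>R\<rfloor>}"
  proof
    fix g assume g: "g \<in> {g \<in> carrier G. wl g \<le> R}"
    then obtain n where n: "wl g = real n" "spells g n" using wl_spells by blast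
    then have "n \<le> nat \<lfloor>R\<rfloor>" using g by (simp add: le_nat_floor)
    then show "g \<in> wprod ` {w. set w \<subseteq> letters \<and> length w \<le> nat \<lfloor>R\<rfloor>}"
      using n by (auto simp: spells_def)
  qed
  moreover have "finite {w. set w \<subseteq> letters \<and> length w \<le> nat \<lfloor>R\<rfloor>}"
    by (rule finite_lists_length_le) (use S_fin in auto)
  ultimately show ?thesis using finite_surj by blast
qed

lemma wl_nat: "g \<in> carrier G \<Longrightarrow> \<exists>n. wl g = real n"
  using wl_spells by blast

lemma wd_nat: "\<lbrakk>a \<in> carrier G; b \<in> carrier G\<rbrakk> \<Longrightarrow> \<exists>n. wd a b = real n"
  using wl_nat by (simp add: word_dist_def)

lemma wl_zero: assumes "g \<in> carrier G" "wl g = 0" shows "g = \<one>"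
  using wl_spells[OF assms(1)] assms(2) by (auto simp: spells_def)

lemma wd_zero: assumes "a \<in> carrier G" "b \<in> carrier G" "wd a b = 0" shows "a = b"
  using wl_zero[of "inv a \<otimes> b"] assms inv_solve_left[of b a \<one>]
  by (simp add: word_dist_def) (metis inv_equality inv_inv inv_closed)

lemma adj_wd: "cayley_adj G S a b \<longleftrightarrow> a \<in> carrier G \<and> b \<in> carrier G \<and> wd a b = 1"
proof
  assume a: "cayley_adj G S a b"
  then have "spells (inv a \<otimes> b) 1"
    unfolding spells_def cayley_adj_def using letters_carrier by (intro exI[of _ "[inv a \<otimes> b]"]) auto
  then have "wd a b \<le> 1" using wl_le by (fastforce simp: word_dist_def)
  moreover have ab: "a \<in> carrier G" "b \<in> carrier G" "a \<noteq> b" using a by (auto simp: cayley_adj_def)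
  moreover obtain n where "wd a b = real n" using wd_nat ab by blast
  moreover have "wd a b \<noteq> 0" using wd_zero ab by blast
  ultimately show "a \<in> carrier G \<and> b \<in> carrier G \<and> wd a b = 1" by auto
next
  assume a: "a \<in> carrier G \<and> b \<in> carrier G \<and> wd a b = 1"
  then obtain w where "length w = 1" "set w \<subseteq> letters" "wprod w = inv a \<otimes> b"
    using wl_spells[of "inv a \<otimes> b"] by (auto simp: word_dist_def spells_def)
  then obtain s where "w = [s]" by (auto simp: length_Suc_conv)
  then have "s \<in> letters" "s \<otimes> \<one> = inv a \<otimes> b" using \<open>set w \<subseteq> letters\<close> \<open>wprod w = _\<close> by auto
  then have "inv a \<otimes> b \<in> letters" using letters_carrier by (metis r_one subsetD)
  then show "cayley_adj G S a b" using a by (auto simp: cayley_adj_def)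
qed

text \<open>The vertices are the prefixes of a shortest word. Subwords bound the distances from
  above, and equality is forced because the whole path has length exactly \<open>n\<close>.\<close>

lemma discrete_geodesic:
  assumes a: "a \<in> carrier G" "b \<in> carrier G" and n: "wd a b = real n"
  obtains v where "v 0 = a" "v n = b" "\<And>i. i \<le> n \<Longrightarrow> v i \<in> carrier G"
    "\<And>i j. \<lbrakk>i \<le> n; j \<le> n\<rbrakk> \<Longrightarrow> wd (v i) (v j) = \<bar>real i - real j\<bar>"
proof -
  obtain w where w: "length w = n" "set w \<subseteq> letters" "wprod w = inv a \<otimes> b"
    using wl_spells[of "inv a \<otimes> b"] a n by (auto simp: word_dist_def spells_def)
  have wc: "set w \<subseteq> carrier G" using w letters_carrier by auto
  have tc: "set (take i w) \<subseteq> carrier G" "set (drop i w) \<subseteq> carrier G" for i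
    using wc set_take_subset[of i w] set_drop_subset[of i w] by auto
  define v where "v i = a \<otimes> wprod (take i w)" for i
  have vc: "v i \<in> carrier G" for i using a tc by (simp add: v_def)
  have v0: "v 0 = a" using a by (simp add: v_def)
  have vn: "v n = b" using a w by (simp add: v_def m_assoc[symmetric])
  have le: "wd (v i) (v j) \<le> real j - real i" if "i \<le> j" "j \<le> n" for i j
  proof -
    define u where "u = drop i (take j w)"
    have u: "take j w = take i w @ u" using that unfolding u_def
      by (metis append_take_drop_id min.absorb1 take_take)
    have us: "set u \<subseteq> letters" using w set_take_subset set_drop_subset unfolding u_def by (metis (no_types, lifting) subset_trans)
    then have uc: "set u \<subseteq> carrier G" using letters_carrier by auto
    have "v j = v i \<otimes> wprod u" using wprod_append[of "take i w" u] tc uc a by (simp add: v_def u m_assoc)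
    then have "wd (v i) (v j) = wl (wprod u)" using vc uc by simp
    also have "\<dots> \<le> real (length u)" by (rule wl_le) (use us in \<open>auto simp: spells_def\<close>)
    also have "length u = j - i" using that w by (simp add: u_def)
    finally show ?thesis using that by simp
  qed
  have eq: "wd (v i) (v j) = real j - real i" if "i \<le> j" "j \<le> n" for i j
  proof -
    have "real n \<le> wd (v 0) (v i) + wd (v i) (v j) + wd (v j) (v n)"
      using n v0 vn wd_tri[of "v 0" "v i" "v n"] wd_tri[of "v i" "v j" "v n"] vc by force
    then show ?thesis using le[of 0 i] le[of i j] le[of j n] that by auto
  qed
  show ?thesis
  proof (rule that[of v])
    show "wd (v i) (v j) = \<bar>real i - real j\<bar>" if "i \<le> n" "j \<le> n" for i j
      using eq[of i j] eq[of j i] wd_sym[of "v i" "v j"] vc that by (cases "i \<le> j") auto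
  qed (use vc v0 vn in auto)
qed

lemma geodesic_point:
  assumes "a \<in> carrier G" "b \<in> carrier G" "0 \<le> s" "s \<le> wd a b"
  obtains z where "z \<in> carrier G" "wd a z + wd z b = wd a b" "\<bar>wd a z - s\<bar> \<le> 1"
proof -
  obtain n where n: "wd a b = real n" using wd_nat assms by blast
  obtain v where v: "v 0 = a" "v n = b" "\<And>i. i \<le> n \<Longrightarrow> v i \<in> carrier G"
    "\<And>i j. \<lbrakk>i \<le> n; j \<le> n\<rbrakk> \<Longrightarrow> wd (v i) (v j) = \<bar>real i - real j\<bar>"
    using discrete_geodesic[OF assms(1,2) n] by blast
  define k where "k = nat \<lfloor>s\<rfloor>"
  have k: "k \<le> n" "\<bar>real k - s\<bar> \<le> 1" unfolding k_def using assms n by linarith+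
  have "wd a (v k) = real k" "wd (v k) b = real (n - k)"
    using v(4)[of 0 k] v(4)[of k n] v(1,2) k by auto
  then show ?thesis using that[of "v k"] v(3) n k by simp
qed

section \<open>The geometric realization of the Cayley graph\<close>

lemma supp_vertex [simp]: "supp (cayley_vertex a) = {a}"
  by (auto simp: supp_def cayley_vertex_def)

lemma vertex_point: "a \<in> carrier G \<Longrightarrow> cayley_vertex a \<in> cayley_points G S"
  by (auto simp: cayley_points_def cayley_vertex_def supp_def)

lemma cayley_dist_vertices:
  assumes "a \<in> carrier G" "b \<in> carrier G"
  shows "cayley_dist G S (cayley_vertex a) (cayley_vertex b) = wd a b"
proof (cases "a = b \<or> cayley_adj G S a b")
  case True
  then have c: "\<exists>a' b'. (a' = b' \<or> cayley_adj G S a' b') \<and>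
      supp (cayley_vertex a) \<union> supp (cayley_vertex b) \<subseteq> {a', b'}" by auto
  from True show ?thesis
  proof
    assume "a = b" then show ?thesis unfolding cayley_dist_def using c assms by simp
  next
    assume ab: "cayley_adj G S a b"
    then have "a \<noteq> b" "wd a b = 1" using adj_wd[of a b] by (auto simp: cayley_adj_def)
    then show ?thesis unfolding cayley_dist_def if_P[OF c] supp_vertex by (simp add: cayley_vertex_def)
  qed
next
  case False
  have "\<not> cayley_adj G S b a" using False assms wd_sym[of a b] by (auto simp: adj_wd)
  then have c: "\<not> (\<exists>a' b'. (a' = b' \<or> cayley_adj G S a' b') \<and>
      supp (cayley_vertex a) \<union> supp (cayley_vertex b) \<subseteq> {a', b'})" using False by auto
  have "{1 - cayley_vertex a a' + wd a' b' + (1 - cayley_vertex b b') |a' b'.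
      a' \<in> {a} \<and> b' \<in> {b}} = {wd a b}" by (auto simp: cayley_vertex_def)
  then show ?thesis unfolding cayley_dist_def if_not_P[OF c] unfolding supp_vertex by simp
qed

text \<open>\<open>c\<close> is any vertex in the support of \<open>p\<close>, hence at distance at
  most 1 from \<open>p\<close>. Both orders of the arguments are treated because the symmetry of
  \<open>cayley_dist\<close> is not visible in its definition.\<close>

lemma point_near_vertex:
  assumes p: "p \<in> cayley_points G S"
  obtains c where "c \<in> carrier G"
    "\<And>v. v \<in> carrier G \<Longrightarrow> \<bar>cayley_dist G S p (cayley_vertex v) - wd c v\<bar> \<le> 1"
    "\<And>v. v \<in> carrier G \<Longrightarrow> \<bar>cayley_dist G S (cayley_vertex v) p - wd c v\<bar> \<le> 1"
proof -
  obtain a b where ab: "a \<in> carrier G" "b \<in> carrier G" "a = b \<or> cayley_adj G S a b"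
    "supp p \<subseteq> {a, b}" "sum p {a, b} = 1" and p0: "\<And>v. 0 \<le> p v"
    using p by (auto simp: cayley_points_def)
  have "supp p \<noteq> {}"
  proof
    assume "supp p = {}"
    then have "p v = 0" for v by (auto simp: supp_def)
    then show False using ab(5) by simp
  qed
  then obtain c where c: "c \<in> supp p" by blast
  have cc: "c \<in> carrier G" using c ab by auto
  have fin: "finite (supp p)" using ab(4) finite_subset by blast
  have "sum p (supp p) = sum p {a, b}"
    by (rule sum.mono_neutral_left) (use ab(4) in \<open>auto simp: supp_def\<close>)
  then have sp: "sum p (supp p) = 1" using ab(5) by simp
  have le1: "p v \<le> 1" for v
  proof (cases "v \<in> supp p")
    case True
    have "p v \<le> sum p (supp p)" by (rule member_le_sum) (use fin p0 True in auto)
    then show ?thesis using sp by simp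
  qed (auto simp: supp_def)
  have pq: "wd u w \<le> 1" if "u \<in> {a', b'}" "w \<in> {a', b'}" "a' = b' \<or> cayley_adj G S a' b'" "a' \<in> carrier G"
    for u w a' b'
  proof -
    have "b' \<in> carrier G" "wd a' b' \<le> 1" using that(3,4) adj_wd[of a' b'] by auto
    then show ?thesis using that(1,2,4) wd_sym[of b' a'] by auto
  qed
  have supp_close: "wd u w \<le> 1" if "u \<in> supp p" "w \<in> supp p" for u w
    using pq[of u a b w] that ab by blast
  have main: "\<bar>cayley_dist G S p (cayley_vertex v) - wd c v\<bar> \<le> 1" (is ?t1)
       "\<bar>cayley_dist G S (cayley_vertex v) p - wd c v\<bar> \<le> 1" (is ?t2) if v: "v \<in> carrier G" for v
  proof -
    have "?t1 \<and> ?t2"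
    proof (cases "\<exists>a' b'. (a' = b' \<or> cayley_adj G S a' b') \<and> supp p \<union> supp (cayley_vertex v) \<subseteq> {a', b'}")
      case True
      then obtain a' b' where ab': "a' = b' \<or> cayley_adj G S a' b'" "supp p \<union> {v} \<subseteq> {a', b'}" by auto
      have "a' \<in> carrier G" using ab' cc c by (auto simp: adj_wd)
      then have "wd c v \<le> 1" using pq[of c a' b' v] ab' c by auto
      have swap: "\<exists>a' b'. (a' = b' \<or> cayley_adj G S a' b') \<and> supp (cayley_vertex v) \<union> supp p \<subseteq> {a', b'}"
        using True by (simp add: Un_commute)
      have fs: "finite (supp p \<union> {v})" using fin by simp
      have "sum p (supp p) = sum p (supp p \<union> {v})"
        by (rule sum.mono_neutral_left[OF fs]) (auto simp: supp_def)
      then have s1: "(\<Sum>u\<in>supp p \<union> {v}. p u) = 1" using sp by simp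
      have s2: "(\<Sum>u\<in>supp p \<union> {v}. cayley_vertex v u) = 1"
        using fs by (simp add: cayley_vertex_def)
      have "(\<Sum>u\<in>supp p \<union> {v}. \<bar>p u - cayley_vertex v u\<bar>) \<le> (\<Sum>u\<in>supp p \<union> {v}. p u + cayley_vertex v u)"
        by (rule sum_mono) (use p0 in \<open>auto simp: cayley_vertex_def abs_le_iff\<close>)
      then have "(\<Sum>u\<in>supp p \<union> {v}. \<bar>p u - cayley_vertex v u\<bar>) \<le> 2" using s1 s2 by (simp add: sum.distrib)
      moreover have "0 \<le> (\<Sum>u\<in>supp p \<union> {v}. \<bar>p u - cayley_vertex v u\<bar>)" by (rule sum_nonneg) simp
      moreover have "(\<Sum>u\<in>supp p \<union> {v}. \<bar>p u - cayley_vertex v u\<bar>) = (\<Sum>u\<in>supp p \<union> {v}. \<bar>cayley_vertex v u - p u\<bar>)"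
        by (simp add: abs_minus_commute)
      moreover have "cayley_dist G S p (cayley_vertex v) = (\<Sum>u\<in>supp p \<union> {v}. \<bar>p u - cayley_vertex v u\<bar>) / 2"
        unfolding cayley_dist_def if_P[OF True] unfolding supp_vertex ..
      moreover have "cayley_dist G S (cayley_vertex v) p = (\<Sum>u\<in>supp p \<union> {v}. \<bar>cayley_vertex v u - p u\<bar>) / 2"
        unfolding cayley_dist_def if_P[OF swap] unfolding supp_vertex by (simp only: Un_commute)
      ultimately show ?thesis using \<open>wd c v \<le> 1\<close> wd_nonneg[of c v] by (simp only: abs_le_iff) linarith
    next
      case False
      have swap: "\<not> (\<exists>a' b'. (a' = b' \<or> cayley_adj G S a' b') \<and> supp (cayley_vertex v) \<union> supp p \<subseteq> {a', b'})"
        using False by (simp add: Un_commute)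
      have vv: "cayley_vertex v v = 1" by (simp add: cayley_vertex_def)
      have e1: "{1 - p a + wd a b + (1 - cayley_vertex v b) |a b. a \<in> supp p \<and> b \<in> supp (cayley_vertex v)}
          = (\<lambda>u. 1 - p u + wd u v) ` supp p" by (auto simp: vv image_iff)
      have e2: "{1 - cayley_vertex v a + wd a b + (1 - p b) |a b. a \<in> supp (cayley_vertex v) \<and> b \<in> supp p}
          = (\<lambda>u. wd v u + (1 - p u)) ` supp p" by (auto simp: vv image_iff)
      have e3: "(\<lambda>u. wd v u + (1 - p u)) ` supp p = (\<lambda>u. 1 - p u + wd u v) ` supp p"
      proof (rule image_cong)
        show "wd v u + (1 - p u) = 1 - p u + wd u v" if "u \<in> supp p" for u
          using that ab v wd_sym[of u v] by auto
      qed simp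
      define F where "F = (\<lambda>u. 1 - p u + wd u v) ` supp p"
      have F: "finite F" "F \<noteq> {}" using fin c by (auto simp: F_def)
      have "Min F \<in> F" using F by simp
      then obtain u where u: "u \<in> supp p" "Min F = 1 - p u + wd u v" by (auto simp: F_def)
      have uc: "u \<in> carrier G" using u ab by auto
      have "Min F \<le> 1 - p c + wd c v" using F c by (intro Min_le) (auto simp: F_def)
      then have up: "Min F \<le> 1 + wd c v" using p0[of c] by linarith
      \<comment> \<open>The minimiser \<open>u\<close> may be the other end of the edge of
        \<open>p\<close>, which is at distance at most 1 from \<open>c\<close>.\<close>
      have low: "Min F \<ge> wd c v - 1"
        using wd_tri[OF cc uc v] supp_close[of c u] c u le1[of u] by linarith
      have "cayley_dist G S p (cayley_vertex v) = Min F"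
        unfolding cayley_dist_def if_not_P[OF False] unfolding e1 F_def ..
      moreover have "cayley_dist G S (cayley_vertex v) p = Min F"
        unfolding cayley_dist_def if_not_P[OF swap] unfolding e2 e3 F_def ..
      ultimately show ?thesis using up low by (simp only: abs_le_iff) linarith
    qed
    then show ?t1 ?t2 by auto
  qed
  show ?thesis using that[OF cc main] by blast
qed

end

section \<open>Edge paths as geodesics of the realization, and quasiconvexity on vertices\<close>

context fg_group
begin

lemma cayley_dist_sym:
  assumes "supp p \<subseteq> carrier G" "supp q \<subseteq> carrier G"
  shows "cayley_dist G S p q = cayley_dist G S q p"
proof -
  have "{(1 - p a) + wd a b + (1 - q b) | a b. a \<in> supp p \<and> b \<in> supp q}
    = {(1 - q b) + wd b a + (1 - p a) | b a. b \<in> supp q \<and> a \<in> supp p}" (is "?A = ?B")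
  proof -
    have *: "(1 - p a) + wd a b + (1 - q b) = (1 - q b) + wd b a + (1 - p a)"
      if "a \<in> supp p" "b \<in> supp q" for a b
      using wd_sym[of a b] that assms by auto
    show ?thesis
    proof (rule Set.set_eqI)
      fix y
      show "y \<in> ?A \<longleftrightarrow> y \<in> ?B"
      proof
        assume "y \<in> ?A"
        then obtain a b where "a \<in> supp p" "b \<in> supp q" "y = (1 - p a) + wd a b + (1 - q b)"
          unfolding mem_Collect_eq by (elim exE conjE) (rule that)
        moreover from this have "y = (1 - q b) + wd b a + (1 - p a)" using *[of a b] by simp
        ultimately show "y \<in> ?B" unfolding mem_Collect_eq by (intro exI conjI)
      next
        assume "y \<in> ?B"
        then obtain a b where "a \<in> supp p" "b \<in> supp q" "y = (1 - q b) + wd b a + (1 - p a)"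
          unfolding mem_Collect_eq by (elim exE conjE) (rule that)
        moreover from this have "y = (1 - p a) + wd a b + (1 - q b)" using *[of a b] by simp
        ultimately show "y \<in> ?A" unfolding mem_Collect_eq by (intro exI conjI)
      qed
    qed
  qed
  moreover have "supp q \<union> supp p = supp p \<union> supp q" by blast
  moreover have "\<bar>q v - p v\<bar> = \<bar>p v - q v\<bar>" for v by simp
  ultimately show ?thesis unfolding cayley_dist_def by (simp only:)
qed

context
  fixes n :: nat and v :: "nat \<Rightarrow> 'a"
  assumes v_carrier: "i \<le> n \<Longrightarrow> v i \<in> carrier G"
    and v_dist: "\<lbrakk>i \<le> n; j \<le> n\<rbrakk> \<Longrightarrow> wd (v i) (v j) = \<bar>real i - real j\<bar>"
begin

text \<open>\<open>hat s\<close> is the point at distance \<open>s\<close> from \<open>v 0\<close> on the edge path through \<open>v 0, \<dots>, v n\<close>.\<close>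

definition hat :: "real \<Rightarrow> 'a \<Rightarrow> real" where
  "hat s w = (if w \<in> v ` {..n} then max 0 (1 - \<bar>s - wd (v 0) w\<bar>) else 0)"

lemma v_inj: "\<lbrakk>i \<le> n; j \<le> n\<rbrakk> \<Longrightarrow> v i = v j \<longleftrightarrow> i = j"
  using v_dist[of i j] v_carrier[of i] by auto

lemma hat_at: "i \<le> n \<Longrightarrow> hat s (v i) = max 0 (1 - \<bar>s - real i\<bar>)"
  using v_dist[of 0 i] by (auto simp: hat_def)

lemma supp_hat: "supp (hat s) = v ` {i. i \<le> n \<and> \<bar>s - real i\<bar> < 1}"
proof (rule Set.set_eqI)
  fix w
  show "w \<in> supp (hat s) \<longleftrightarrow> w \<in> v ` {i. i \<le> n \<and> \<bar>s - real i\<bar> < 1}"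
  proof (cases "w \<in> v ` {..n}")
    case True
    then obtain i where i: "i \<le> n" "w = v i" by auto
    then show ?thesis using hat_at[of i s] v_inj by (auto simp: supp_def)
  next
    case False
    then show ?thesis by (auto simp: supp_def hat_def)
  qed
qed

lemma supp_hat_carrier: "supp (hat s) \<subseteq> carrier G"
  using v_carrier by (auto simp: supp_hat)

lemma supp_hat_finite: "finite (supp (hat s))"
  by (simp add: supp_hat)

lemma hat_nat: "i \<le> n \<Longrightarrow> hat (real i) = cayley_vertex (v i)"
proof (rule ext)
  fix w assume i: "i \<le> n"
  show "hat (real i) w = cayley_vertex (v i) w"
  proof (cases "w \<in> v ` {..n}")
    case True
    then obtain j where j: "j \<le> n" "w = v j" by auto
    then show ?thesis using hat_at[of j "real i"] v_inj i by (auto simp: cayley_vertex_def)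
  next
    case False
    then show ?thesis using i by (auto simp: cayley_vertex_def hat_def)
  qed
qed

lemma supp_hat_between:
  assumes "real k \<le> s" "s \<le> real k + 1" "k < n"
  shows "supp (hat s) \<subseteq> {v k, v (Suc k)}"
proof
  fix w assume "w \<in> supp (hat s)"
  then obtain i where i: "i \<le> n" "\<bar>s - real i\<bar> < 1" "w = v i" by (auto simp: supp_hat)
  have "real i < real (k + 2)" "real k < real (i + 1)" using i(2) assms by auto
  then have "i = k \<or> i = Suc k" by linarith
  then show "w \<in> {v k, v (Suc k)}" using i by auto
qed

lemma hat_point: assumes "0 \<le> s" "s \<le> real n" shows "hat s \<in> cayley_points G S"
proof (cases "s = real n")
  case True
  then show ?thesis using hat_nat[of n] vertex_point v_carrier by simp
next
  case False
  define k where "k = nat \<lfloor>s\<rfloor>"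
  have k: "real k \<le> s" "s \<le> real k + 1" "k < n" unfolding k_def using assms False by linarith+
  have "cayley_adj G S (v k) (v (Suc k))"
    using k v_carrier v_dist[of k "Suc k"] by (auto simp: adj_wd)
  moreover have "sum (hat s) {v k, v (Suc k)} = 1"
    using k hat_at[of k s] hat_at[of "Suc k" s] v_inj[of k "Suc k"] by auto
  moreover have "0 \<le> hat s w" for w by (simp add: hat_def)
  ultimately show ?thesis
    unfolding cayley_points_def using supp_hat_between[OF k] v_carrier[of k] v_carrier[of "Suc k"] k(3)
    by (intro CollectI conjI allI bexI[of _ "v k"] bexI[of _ "v (Suc k)"]) auto
qed

text \<open>If both points lie on one edge, the outer vertices \<open>v k\<close> and
  \<open>v g\<close> are among its ends, which puts \<open>s\<close> and \<open>t\<close> into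
  \<open>[k, k + 1]\<close>, where the sum is explicit. Otherwise the minimum is attained at the
  inner vertices \<open>v f\<close> and \<open>v e\<close>, the ends facing the other point.\<close>

lemma hat_dist_le:
  assumes st: "0 \<le> s" "s \<le> t" "t \<le> real n"
  shows "cayley_dist G S (hat s) (hat t) = t - s"
proof -
  define k where "k = nat \<lfloor>s\<rfloor>"
  define f where "f = nat \<lceil>s\<rceil>"
  define e where "e = nat \<lfloor>t\<rfloor>"
  define g where "g = nat \<lceil>t\<rceil>"
  have k: "real k \<le> s" "s < real k + 1" "k \<le> n" unfolding k_def using st by linarith+
  have f: "s \<le> real f" "real f < s + 1" "f \<le> n" unfolding f_def using st by linarith+
  have e: "real e \<le> t" "t < real e + 1" "e \<le> n" unfolding e_def using st by linarith+
  have g: "t \<le> real g" "real g < t + 1" "g \<le> n" unfolding g_def using st by linarith+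
  let ?c = "\<exists>a b. (a = b \<or> cayley_adj G S a b) \<and> supp (hat s) \<union> supp (hat t) \<subseteq> {a, b}"
  show ?thesis
  proof (cases ?c)
    case True
    then obtain a b where ab: "a = b \<or> cayley_adj G S a b" "supp (hat s) \<union> supp (hat t) \<subseteq> {a, b}" by auto
    have in_supp: "v k \<in> supp (hat s)" "v g \<in> supp (hat t)" using k g by (auto simp: supp_hat)
    have "a = b \<or> (wd a b = 1 \<and> wd b a = 1)" using ab(1) wd_sym[of a b] by (auto simp: adj_wd)
    then have "wd (v k) (v g) \<le> 1" using ab(2) in_supp v_carrier k(3) g(3)
      by (smt (verit, best) Un_iff insert_iff singletonD subsetD wd_self)
    then have kg: "real g \<le> real k + 1" using v_dist[of k g] k g by auto
    have "(\<Sum>w\<in>supp (hat s) \<union> supp (hat t). \<bar>hat s w - hat t w\<bar>) = 2 * (t - s)"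
    proof (cases "k = n")
      case True
      then have "s = t" using st k by auto
      then show ?thesis by simp
    next
      case False
      then have kn: "k < n" using k by simp
      have "supp (hat s) \<subseteq> {v k, v (Suc k)}" "supp (hat t) \<subseteq> {v k, v (Suc k)}"
        using supp_hat_between kn k g kg st by auto
      then have "(\<Sum>w\<in>supp (hat s) \<union> supp (hat t). \<bar>hat s w - hat t w\<bar>)
          = (\<Sum>w\<in>{v k, v (Suc k)}. \<bar>hat s w - hat t w\<bar>)"
        by (intro sum.mono_neutral_left) (auto simp: supp_def)
      also have "\<dots> = 2 * (t - s)"
        using kn v_inj[of k "Suc k"] k g kg st hat_at[of k s] hat_at[of k t] hat_at[of "Suc k" s] hat_at[of "Suc k" t]
        by auto
      finally show ?thesis .
    qed
    then show ?thesis unfolding cayley_dist_def if_P[OF True] by simp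
  next
    case False
    \<comment> \<open>If \<open>e < f\<close>, then no integer separates the two parameters, and the
      points would share the edge from \<open>v k\<close> to \<open>v (Suc k)\<close>.\<close>
    have fe: "f \<le> e"
    proof (rule ccontr)
      assume "\<not> f \<le> e"
      then have "e < f" by simp
      moreover have "real f < real (k + 2)" "real k < real (e + 1)" using k f e st by simp_all
      ultimately have "f = Suc k" "e = k" by linarith+
      then have "k < n" "t \<le> real k + 1" "s \<le> real k + 1" "real k \<le> t" using k f e st by auto
      then have "supp (hat s) \<union> supp (hat t) \<subseteq> {v k, v (Suc k)}" "cayley_adj G S (v k) (v (Suc k))"
        using supp_hat_between[of k s] supp_hat_between[of k t] k v_carrier v_dist[of k "Suc k"]
        by (auto simp: adj_wd)
      then show False using False by blast
    qed
    let ?A = "{(1 - hat s a) + wd a b + (1 - hat t b) | a b. a \<in> supp (hat s) \<and> b \<in> supp (hat t)}"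
    have "Min ?A = t - s"
    proof (rule Min_eqI)
      show "finite ?A" by (rule finite_image_set2) (simp_all add: supp_hat_finite)
    next
      fix y assume "y \<in> ?A"
      then obtain a b where ab: "a \<in> supp (hat s)" "b \<in> supp (hat t)"
        "y = (1 - hat s a) + wd a b + (1 - hat t b)"
        unfolding mem_Collect_eq by (elim exE conjE) (rule that)
      obtain i where i: "i \<le> n" "\<bar>s - real i\<bar> < 1" "a = v i" using ab(1) unfolding supp_hat by blast
      obtain j where j: "j \<le> n" "\<bar>t - real j\<bar> < 1" "b = v j" using ab(2) unfolding supp_hat by blast
      have "y = \<bar>s - real i\<bar> + \<bar>real i - real j\<bar> + \<bar>t - real j\<bar>"
        using hat_at[of i s] hat_at[of j t] v_dist[of i j] i j ab(3) by auto
      then show "t - s \<le> y"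
        using abs_ge_minus_self[of "s - real i"] abs_ge_minus_self[of "real i - real j"] abs_ge_self[of "t - real j"]
        by linarith
    next
      have "t - s = (1 - hat s (v f)) + wd (v f) (v e) + (1 - hat t (v e))"
        using hat_at[OF f(3), of s] hat_at[OF e(3), of t] v_dist[OF f(3) e(3)] fe f(1,2) e(1,2)
        by (simp add: abs_if)
      moreover have "v f \<in> supp (hat s)" "v e \<in> supp (hat t)" using f e by (auto simp: supp_hat)
      ultimately show "t - s \<in> ?A" unfolding mem_Collect_eq by (intro exI conjI)
    qed
    then show ?thesis unfolding cayley_dist_def if_not_P[OF False] .
  qed
qed

lemma hat_geodesic: "geodesic_path (cayley_points G S) (cayley_dist G S) (real n) hat"
  unfolding geodesic_path_def
proof (intro conjI ballI)
  show "hat ` {0..real n} \<subseteq> cayley_points G S" using hat_point by auto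
  fix s t assume "s \<in> {0..real n}" "t \<in> {0..real n}"
  then show "cayley_dist G S (hat s) (hat t) = \<bar>s - t\<bar>"
    using hat_dist_le[of s t] hat_dist_le[of t s] cayley_dist_sym[OF supp_hat_carrier supp_hat_carrier, of s t]
    by (cases "s \<le> t") auto
qed simp

end

text \<open>The definition speaks only of geodesics in the realization, so the hypothesis yields
  nothing about vertices until \<open>hat\<close> has turned the discrete geodesic into such a
  path.\<close>

lemma quasiconvex_vertices:
  assumes Q: "quasiconvex G S K A" "A \<subseteq> carrier G" and ab: "a \<in> A" "b \<in> A"
    and n: "wd a b = real n" and v0: "v 0 = a" "v n = b"
    and v: "\<And>i. i \<le> n \<Longrightarrow> v i \<in> carrier G"
      "\<And>i j. \<lbrakk>i \<le> n; j \<le> n\<rbrakk> \<Longrightarrow> wd (v i) (v j) = \<bar>real i - real j\<bar>"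
    and i: "i \<le> n"
  shows "\<exists>c\<in>A. wd (v i) c \<le> K"
proof -
  have geo: "geodesic_path (cayley_points G S) (cayley_dist G S) (real n) (hat n v)"
    by (rule hat_geodesic) (use v in auto)
  have nat: "hat n v (real j) = cayley_vertex (v j)" if "j \<le> n" for j
    by (rule hat_nat[OF _ _ that]) (use v in auto)
  have "hat n v 0 = cayley_vertex a" "hat n v (real n) = cayley_vertex b"
    using nat[of 0] nat[of n] v0 by auto
  then have "\<forall>u\<in>{0..real n}. \<exists>c\<in>A. cayley_dist G S (hat n v u) (cayley_vertex c) \<le> K"
    using Q(1) ab geo unfolding quasiconvex_def by blast
  then obtain c where c: "c \<in> A" "cayley_dist G S (hat n v (real i)) (cayley_vertex c) \<le> K"
    using i by force
  then show ?thesis using nat[OF i] cayley_dist_vertices[OF v(1)[OF i], of c] Q(2) by (intro bexI[of _ c]) auto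
qed

text \<open>A point of a geodesic is within 1 of some vertex \<open>z\<close>. This costs 1 in the
  distance to each end, hence \<open>gp z a b \<le> 1\<close>, and 1 again on the way back, hence
  \<open>K - 1\<close>.\<close>

lemma quasiconvexI:
  assumes A: "A \<subseteq> carrier G"
    and near: "\<And>a b z. \<lbrakk>a \<in> A; b \<in> A; z \<in> carrier G; gromov_product wd z a b \<le> 1\<rbrakk>
      \<Longrightarrow> \<exists>c\<in>A. wd z c \<le> K - 1"
  shows "quasiconvex G S K A"
  unfolding quasiconvex_def
proof (intro ballI allI impI)
  fix a b L \<gamma> u
  assume ab: "a \<in> A" "b \<in> A" and u: "u \<in> {0..L}"
    and g: "geodesic_path (cayley_points G S) (cayley_dist G S) L \<gamma> \<and>
       \<gamma> 0 = cayley_vertex a \<and> \<gamma> L = cayley_vertex b"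
  have ac: "a \<in> carrier G" "b \<in> carrier G" using ab A by auto
  have p: "\<gamma> u \<in> cayley_points G S" using g u by (auto simp: geodesic_path_def)
  have d: "cayley_dist G S (\<gamma> s) (\<gamma> t) = \<bar>s - t\<bar>" if "s \<in> {0..L}" "t \<in> {0..L}" for s t
    using g that by (auto simp: geodesic_path_def)
  have L0: "0 \<le> L" using g by (auto simp: geodesic_path_def)
  obtain z where z: "z \<in> carrier G"
    "\<And>v. v \<in> carrier G \<Longrightarrow> \<bar>cayley_dist G S (\<gamma> u) (cayley_vertex v) - wd z v\<bar> \<le> 1"
    "\<And>v. v \<in> carrier G \<Longrightarrow> \<bar>cayley_dist G S (cayley_vertex v) (\<gamma> u) - wd z v\<bar> \<le> 1"
    using point_near_vertex[OF p] by metis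
  have "cayley_dist G S (cayley_vertex a) (\<gamma> u) = u" "cayley_dist G S (\<gamma> u) (cayley_vertex b) = L - u"
    "cayley_dist G S (cayley_vertex a) (cayley_vertex b) = L"
    using d[of 0 u] d[of u L] d[of 0 L] g u L0 by auto
  then have "wd z a \<le> u + 1" "wd z b \<le> L - u + 1" "wd a b = L"
    using z(3)[OF ac(1)] z(2)[OF ac(2)] cayley_dist_vertices[OF ac] by linarith+
  then have "gromov_product wd z a b \<le> 1"
    using wd_sym[OF z(1) ac(1)] wd_sym[OF z(1) ac(2)] by (simp add: gromov_product_def)
  then obtain c where "c \<in> A" "wd z c \<le> K - 1" using near ab z(1) by blast
  moreover have "c \<in> carrier G" using A \<open>c \<in> A\<close> by auto
  ultimately show "\<exists>c\<in>A. cayley_dist G S (\<gamma> u) (cayley_vertex c) \<le> K"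
    using z(2)[of c] by (intro bexI[of _ c]) linarith+
qed

end

locale hyp_group = fg_group +
  fixes \<delta> :: nat
  assumes hyp_group: "hyperbolic_group G S \<delta>"

sublocale hyp_group \<subseteq> hyp_metric "carrier G" wd "real \<delta>"
proof
  fix x y z t assume c: "x \<in> carrier G" "y \<in> carrier G" "z \<in> carrier G" "t \<in> carrier G"
  let ?g = "gromov_product (cayley_dist G S)"
  have "?g (cayley_vertex z) (cayley_vertex x) (cayley_vertex y) \<ge>
    min (?g (cayley_vertex z) (cayley_vertex x) (cayley_vertex t))
      (?g (cayley_vertex z) (cayley_vertex y) (cayley_vertex t)) - real \<delta>"
    using hyp_group vertex_point c unfolding hyperbolic_group_def hyperbolic_space_def by blast
  then show "gromov_product wd z x y \<ge> min (gromov_product wd z x t) (gromov_product wd z y t) - real \<delta>"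
    using c by (simp add: gromov_product_def cayley_dist_vertices)
qed (use wd_sym wd_tri in auto)

context hyp_group
begin

text \<open>Extends quasiconvexity from points of a geodesic to points merely near one:
  \<open>2 * \<epsilon>\<close> pays for the mismatch of levels, and
  \<open>2 * \<epsilon> + 2 * \<delta>\<close> comes from \<open>near_points_close\<close>.\<close>

lemma quasiconvex_near:
  assumes Q: "quasiconvex G S K A" "A \<subseteq> carrier G" and ab: "a \<in> A" "b \<in> A"
    and z: "z \<in> carrier G" "gp z a b \<le> \<epsilon>"
  shows "\<exists>c\<in>A. wd z c \<le> K + 1 + 4 * \<epsilon> + 2 * real \<delta>"
proof -
  have ac: "a \<in> carrier G" "b \<in> carrier G" using Q ab by auto
  obtain n where n: "wd a b = real n" using wd_nat ac by blast
  obtain v where v: "v 0 = a" "v n = b" "\<And>i. i \<le> n \<Longrightarrow> v i \<in> carrier G"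
    "\<And>i j. \<lbrakk>i \<le> n; j \<le> n\<rbrakk> \<Longrightarrow> wd (v i) (v j) = \<bar>real i - real j\<bar>"
    using discrete_geodesic[OF ac n] by blast
  obtain m where m: "wd a z = real m" using wd_nat ac z by blast
  \<comment> \<open>The level of \<open>z\<close> may exceed the length of the geodesic, by at most
    \<open>2 * \<epsilon>\<close>, so it is cut off at the end.\<close>
  define i where "i = min m n"
  have i: "i \<le> n" by (simp add: i_def)
  have e0: "0 \<le> \<epsilon>" using gp_nonneg[OF ac z(1)] z(2) by simp
  have dv: "wd a (v i) = real i" "wd (v i) b = real n - real i" using v(4)[of 0 i] v(4)[of i n] v(1,2) i by auto
  have "gp (v i) a b \<le> \<epsilon>"
    using dv n e0 wd_sym[OF ac(2) v(3)[OF i]] by (simp add: gromov_product_def)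
  then have "wd z (v i) \<le> \<bar>wd a z - wd a (v i)\<bar> + 2 * \<epsilon> + 2 * real \<delta>"
    by (rule near_points_close[OF ac z(1) v(3)[OF i] z(2)])
  moreover have "real m \<le> real n + 2 * \<epsilon>"
    using z(2) m n wd_nonneg[of b z] gp_double[of z a b] by linarith
  then have "\<bar>real m - real i\<bar> \<le> 2 * \<epsilon>" using e0 by (auto simp: i_def min_def)
  ultimately have zv: "wd z (v i) \<le> 4 * \<epsilon> + 2 * real \<delta>" using m dv by linarith
  obtain c where c: "c \<in> A" "wd (v i) c \<le> K"
    using quasiconvex_vertices[OF Q ab n v(1,2)] v(3,4) i by blast
  then have "wd z c \<le> wd z (v i) + wd (v i) c" using z v(3)[OF i] Q c by (intro wd_tri) auto
  then show ?thesis using zv c by (intro bexI[of _ c]) auto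
qed

end

section \<open>Elements of infinite order\<close>

lemma (in group) conj_int_pow:
  assumes "q \<in> carrier G" "a \<in> carrier G"
  shows "(inv q \<otimes> a \<otimes> q) [^] (n::int) = inv q \<otimes> a [^] n \<otimes> q"
proof -
  have nat: "(inv q \<otimes> a \<otimes> q) [^] (j::nat) = inv q \<otimes> a [^] j \<otimes> q" for j
  proof (induction j)
    case (Suc j)
    have "inv q \<otimes> a [^] j \<otimes> q \<otimes> (inv q \<otimes> a \<otimes> q) = inv q \<otimes> a [^] j \<otimes> (q \<otimes> inv q) \<otimes> a \<otimes> q"
      using assms by (simp add: m_assoc) (simp add: m_assoc[symmetric])
    then show ?case using Suc assms by (simp add: m_assoc)
  qed (use assms in simp)
  show ?thesis
  proof (cases n rule: int_cases2)
    case (nonneg m)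
    then show ?thesis using nat[of m] by (simp add: int_pow_int)
  next
    case (nonpos m)
    then show ?thesis using nat[of m] assms
      by (simp add: int_pow_neg_int inv_mult_group m_assoc)
  qed
qed

context hyp_group
begin

lemma gp_left [simp]:
  assumes "g \<in> carrier G" "z \<in> carrier G" "a \<in> carrier G" "b \<in> carrier G"
  shows "gp (g \<otimes> z) (g \<otimes> a) (g \<otimes> b) = gp z a b"
  using assms by (simp add: gromov_product_def)

text \<open>The powers of \<open>y\<close> form a chain of long edges with small Gromov products at the corners.\<close>

lemma doubling_imp_quasi_axis:
  assumes y: "y \<in> carrier G" and big: "wl (y [^] (2::nat)) > wl y + 4 * real \<delta>"
    and j: "j \<le> m"
  shows "gp (y [^] (j::nat)) \<one> (y [^] (m::nat)) \<le> wl y + 2 * real \<delta>"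
proof (cases "0 < j \<and> j < m")
  case True
  \<comment> \<open>The Gromov product of \<open>y^(i-1)\<close> and \<open>y^(i+1)\<close> at
    \<open>y^i\<close>, the same at every corner. Hypothesis \<open>big\<close> makes the edge
    length \<open>wl y\<close> exceed \<open>2 * \<kappa> + 3 * \<delta>\<close>, as
    \<open>chain\<close> requires.\<close>
  define \<kappa> where "\<kappa> = wl y - wl (y [^] (2::nat)) / 2"
  have k2: "2 * \<kappa> = 2 * wl y - wl (y [^] (2::nat))" by (simp add: \<kappa>_def)
  have "gp (y [^] j) (y [^] (0::nat)) (y [^] m) \<le> \<kappa> + 2 * real \<delta>"
  proof (rule chain[of m])
    show "gp (y [^] i) (y [^] (i - 1)) (y [^] (i + 1)) \<le> \<kappa>" if "0 < i" "i < m" for i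
    proof -
      have e: "y [^] i = y [^] (i - 1) \<otimes> y" "y [^] (i + 1) = y [^] (i - 1) \<otimes> (y [^] (2::nat))"
        using y that nat_pow_mult[of y "i - 1" 1] nat_pow_mult[of y "i - 1" 2] by auto
      have "wd (y [^] (i - 1)) (y [^] i) = wl y" "wd (y [^] (i - 1)) (y [^] (i + 1)) = wl (y [^] (2::nat))"
        unfolding e using y wd_mult_right[of "y [^] (i - 1)"] by blast+
      moreover have "wd (y [^] (i + 1)) (y [^] i) = wl y"
        using wd_sym[of "y [^] (i + 1)" "y [^] i"] y wd_mult_right[of "y [^] i" y] by simp
      ultimately show ?thesis using k2 gp_double[of "y [^] i" "y [^] (i - 1)" "y [^] (i + 1)"] by linarith
    qed
    show "wd (y [^] (i - 1)) (y [^] i) > 2 * \<kappa> + 3 * real \<delta>" if "1 < i" "i < m" for i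
    proof -
      have e: "y [^] i = y [^] (i - 1) \<otimes> y"
        using y that nat_pow_mult[of y "i - 1" 1] by auto
      have "wd (y [^] (i - 1)) (y [^] i) = wl y" using y by (simp add: e)
      then show ?thesis using k2 big delta_nonneg by linarith
    qed
  qed (use y True in auto)
  then have "gp (y [^] j) \<one> (y [^] m) \<le> \<kappa> + 2 * real \<delta>" by simp
  then show ?thesis using k2 wl_nonneg[of "y [^] (2::nat)"] by linarith
next
  case False
  then have "j = 0 \<or> j = m" using j by auto
  then show ?thesis using y by (auto simp: gromov_product_def)
qed

end

locale loxodromic = hyp_group +
  fixes x
  assumes x_carrier [simp]: "x \<in> carrier G" and x_ord: "group.ord G x = 0"
begin

abbreviation pw :: "int \<Rightarrow> 'a" where "pw i \<equiv> x [^] i"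

lemma pw_add: "pw (i + j) = pw i \<otimes> pw j"
  by (simp add: int_pow_mult)

lemma pw_inj: "pw i = pw j \<longleftrightarrow> i = j"
  using int_pow_eq[OF x_carrier, of i j] x_ord by auto

lemma inj_pw: "inj pw"
  by (simp add: inj_def pw_inj)

lemma pw_minus: "pw (- i) = inv (pw i)"
  by (simp add: int_pow_neg)

lemma wd_pw: "wd (pw i) (pw j) = wl (pw (j - i))"
  by (simp add: word_dist_def pw_minus[symmetric] pw_add[symmetric])

lemma wl_pw_minus [simp]: "wl (pw (- i)) = wl (pw i)"
  by (simp add: pw_minus)

lemma wl_pw_nat: "wl (pw (int n)) \<le> real n * wl x"
proof (induction n)
  case (Suc n)
  have "wl (pw (int (Suc n))) \<le> wl (pw (int n)) + wl x"
    using wl_mult[of "pw (int n)" x] pw_add[of "int n" 1] by (simp add: add.commute)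
  then show ?case using Suc by (simp add: algebra_simps)
qed simp

lemma finite_pw_ball: "finite {i. wl (pw i) \<le> R}"
proof -
  have "{i. wl (pw i) \<le> R} = pw -` {g \<in> carrier G. wl g \<le> R}" by auto
  then show ?thesis using finite_vimageI[OF finite_ball inj_pw] by simp
qed

text \<open>Balls are finite and the powers of \<open>x\<close> are distinct, so a ball contains
  only finitely many of them.\<close>

lemma pw_tends: "\<exists>n>0. \<forall>i. \<bar>i\<bar> \<ge> int n \<longrightarrow> wl (pw i) > R"
proof -
  obtain b where b: "\<And>i. wl (pw i) \<le> R \<Longrightarrow> \<bar>i\<bar> \<le> b"
  proof -
    have "finite (abs ` {i. wl (pw i) \<le> R})" using finite_pw_ball by blast
    then obtain b where "\<forall>a\<in>abs ` {i. wl (pw i) \<le> R}. a \<le> b" using finite_nat_iff_bounded_le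
      by (metis Max_ge)
    then show ?thesis using that by auto
  qed
  show ?thesis
  proof (intro exI[of _ "nat \<bar>b\<bar> + 1"] conjI allI impI)
    fix i assume "\<bar>i\<bar> \<ge> int (nat \<bar>b\<bar> + 1)"
    then have "\<not> \<bar>i\<bar> \<le> b" by linarith
    then show "wl (pw i) > R" using b[of i] by force
  qed simp
qed

text \<open>Otherwise the midpoint of a long geodesic from \<open>\<one>\<close> to a power of \<open>x\<close> is displaced by a
  bounded amount by many powers of \<open>x\<close> at once, against the finiteness of balls: the
  displacement is, up to sign and a bounded error, additive in the exponent.\<close>

lemma ex_doubling:
  "\<exists>q\<in>carrier G. \<exists>i::nat. wd q (pw (2 * int i) \<otimes> q) > wd q (pw (int i) \<otimes> q) + c"
proof (rule ccontr)
  assume "\<not> ?thesis"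
  then have no: "wd q (pw (2 * int i) \<otimes> q) \<le> wd q (pw (int i) \<otimes> q) + c" if "q \<in> carrier G" for q i
    using that by (meson not_le)
  define D where "D = real \<delta>"
  have D0: "0 \<le> D" by (simp add: D_def)
  \<comment> \<open>Displacement doubles up to \<open>2 * D\<close>, while by assumption it grows by
    at most \<open>6 * D + c\<close>. This forces \<open>\<bar>s i\<bar> \<le> 8 * D + c\<close>,
    and \<open>close\<close> adds another \<open>6 * D\<close>.\<close>
  define R where "R = 14 * D + c"
  define B where "B = card {g \<in> carrier G. wl g \<le> R}"
  \<comment> \<open>Exponents up to \<open>2 * B\<close> are covered because the estimate for
    \<open>i \<le> B\<close> also involves \<open>2 * i\<close>.\<close>
  define F where "F = 2 * real B * wl x"
  have F0: "0 \<le> F" by (simp add: F_def)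
  have F: "wl (pw (int i)) \<le> F" if "i \<le> 2 * B" for i
  proof -
    have "real i * wl x \<le> F" unfolding F_def using that by (intro mult_right_mono) auto
    then show ?thesis using wl_pw_nat[of i] by linarith
  qed
  obtain n where n: "wl (pw n) > 8 * F + 20 * D + 20" using pw_tends[of "8 * F + 20 * D + 20"] by (meson abs_ge_self abs_of_nat order_refl)
  obtain q where q: "q \<in> carrier G" "wd \<one> q + wd q (pw n) = wd \<one> (pw n)" "\<bar>wd \<one> q - wl (pw n) / 2\<bar> \<le> 1"
    using geodesic_point[of \<one> "pw n" "wl (pw n) / 2"] by auto
  define k where "k = wd \<one> q"
  have kbig: "k \<ge> 4 * F + 10 * D + 9" "wd q (pw n) \<ge> 4 * F + 10 * D + 9"
    using q n unfolding k_def by (auto simp: abs_le_iff field_simps)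
  define Y where "Y i = pw (int i) \<otimes> q" for i
  have Yc [simp]: "Y i \<in> carrier G" for i using q by (simp add: Y_def)
  have tri: "wd a c \<le> wd a b + wd b c" if "a \<in> carrier G" "b \<in> carrier G" "c \<in> carrier G" for a b c
    using that by (rule wd_tri)
  \<comment> \<open>Translation by \<open>x^i\<close> moves the ends of the geodesic by at most
    \<open>F\<close>. As \<open>Y i\<close> is much further than this from both ends, it remains
    near the original geodesic.\<close>
  have near: "gp (Y i) \<one> (pw n) \<le> 2 * D" if "i \<le> 2 * B" for i
  proof -
    let ?a = "pw (int i)" and ?b = "pw (int i + n)"
    have d1: "wd ?a (Y i) = k" using q wd_left[of ?a \<one> q] by (simp add: Y_def k_def)
    have d2: "wd ?b (Y i) = wd q (pw n)"
      using q wd_left[of ?a "pw n" q] wd_sym[of "pw n" q] by (simp add: Y_def pw_add)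
    have d3: "wd \<one> ?a \<le> F" using F[OF that] by simp
    have d4: "wd ?b (pw n) \<le> F" using F[OF that] wd_pw[of "int i + n" n] by simp
    have d5: "wd ?a ?b = wl (pw n)" by (simp add: pw_add)
    have g0: "gp (Y i) ?a ?b = 0"
      using d1 d2 d5 q(2) by (simp add: gromov_product_def k_def)
    have g1: "gp (Y i) ?a \<one> > 2 * D"
      using d1 d3 gp_double[of "Y i" ?a \<one>] tri[of ?a \<one> "Y i"] wd_sym[of ?a \<one>] kbig D0 F0 by simp
    have g2: "gp (Y i) ?b (pw n) > 2 * D"
      using d2 d4 gp_double[of "Y i" ?b "pw n"] tri[of ?b "pw n" "Y i"] kbig D0 F0 by simp
    have h1: "gp (Y i) ?a ?b \<ge> min (gp (Y i) ?a \<one>) (gp (Y i) ?b \<one>) - D"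
      unfolding D_def by (rule hyp) (use q in auto)
    have h2: "gp (Y i) \<one> ?b \<ge> min (gp (Y i) \<one> (pw n)) (gp (Y i) ?b (pw n)) - D"
      unfolding D_def by (rule hyp) (use q in auto)
    have s: "gp (Y i) ?b \<one> = gp (Y i) \<one> ?b" by (rule gp_sym) auto
    show ?thesis using g0 g1 g2 h1 h2 s D0 by (auto simp: min_def split: if_splits)
  qed
  \<comment> \<open>The signed displacement of \<open>q\<close> along the geodesic;
    \<open>close\<close> and \<open>far\<close> compare its absolute value with the true
    displacement.\<close>
  define s where "s i = wd \<one> (Y i) - k" for i
  have q0: "gp q \<one> (pw n) \<le> 2 * D"
    using q(2) wd_sym[of q "pw n"] q(1) D0 by (simp add: gromov_product_def)
  have close: "wd q (Y i) \<le> \<bar>s i\<bar> + 6 * D" if "i \<le> 2 * B" for i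
    using near_points_close[of \<one> "pw n" q "Y i" "2 * D"] near[OF that] q0 q(1)
    by (simp add: s_def k_def D_def abs_minus_commute)
  have far: "\<bar>s i\<bar> \<le> wd q (Y i)" for i
    using tri[of \<one> q "Y i"] tri[of \<one> "Y i" q] wd_sym[of q "Y i"] q(1)
    by (auto simp: s_def k_def abs_le_iff)
  have sF: "\<bar>s i\<bar> \<le> F" if "i \<le> 2 * B" for i
  proof -
    have "wd (Y i) (pw (int i)) = k" using q wd_left[of "pw (int i)" \<one> q] wd_sym[of "Y i" "pw (int i)"] by (simp add: Y_def k_def)
    moreover have "wd \<one> (Y i) \<le> wd \<one> (pw (int i)) + wd (Y i) (pw (int i))"
      using tri[of \<one> "pw (int i)" "Y i"] wd_sym[of "pw (int i)" "Y i"] by simp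
    moreover have "wd (Y i) (pw (int i)) \<le> wd \<one> (Y i) + wd \<one> (pw (int i))"
      using tri[of "Y i" \<one> "pw (int i)"] wd_sym[of \<one> "Y i"] by simp
    ultimately show ?thesis using F[OF that] by (simp add: s_def abs_le_iff)
  qed
  have double: "\<bar>s (2 * i) - 2 * s i\<bar> \<le> 2 * D" if "i \<le> B" for i
  proof -
    let ?z = "pw (- int i)"
    have iB: "i \<le> 2 * B" using that by simp
    have z1: "wd ?z q = wd \<one> (Y i)"
      using q wd_left[of "pw (int i)" ?z q] pw_add[of "int i" "- int i"] by (simp add: Y_def)
    have e1: "pw (int i) \<otimes> ?z = \<one>" by (simp add: pw_add[symmetric])
    have e2: "pw (int i) \<otimes> Y i = Y (2 * i)"
    proof -
      have "pw (int (2 * i)) = pw (int i) \<otimes> pw (int i)" unfolding pw_add[symmetric] by simp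
      then show ?thesis using q by (simp add: Y_def m_assoc)
    qed
    have "wd ?z (Y i) = wd (pw (int i) \<otimes> ?z) (pw (int i) \<otimes> Y i)"
      by (rule wd_left[symmetric]) auto
    then have z2: "wd ?z (Y i) = wd \<one> (Y (2 * i))" by (simp only: e1 e2)
    have z3: "wd \<one> ?z \<le> F" using F[OF iB] by simp
    \<comment> \<open>Among the pairings of \<open>\<one>\<close>, \<open>x^(-i)\<close>,
      \<open>q\<close>, \<open>Y i\<close>, the one joining \<open>\<one>\<close> with
      \<open>x^(-i)\<close> has too small a sum to be the maximum. The other two sums,
      \<open>2 * (s i + k)\<close> and \<open>s (2 * i) + 2 * k\<close>, therefore agree up to
      \<open>2 * D\<close>.\<close>
    have f1: "wd \<one> (Y i) + wd ?z q \<le> max (wd \<one> ?z + wd (Y i) q) (wd \<one> q + wd (Y i) ?z) + 2 * D"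
      unfolding D_def by (rule four_point) (use q in auto)
    have f2: "wd \<one> q + wd ?z (Y i) \<le> max (wd \<one> ?z + wd q (Y i)) (wd \<one> (Y i) + wd q ?z) + 2 * D"
      unfolding D_def by (rule four_point) (use q in auto)
    have sy: "wd (Y i) q = wd q (Y i)" "wd (Y i) ?z = wd ?z (Y i)" "wd q ?z = wd ?z q"
      using wd_sym q by auto
    have e: "wd \<one> (Y i) = s i + k" "wd \<one> (Y (2 * i)) = s (2 * i) + k" "wd \<one> q = k" by (auto simp: s_def k_def)
    have "\<bar>s i\<bar> \<le> F" "\<bar>s (2 * i)\<bar> \<le> F" "wd q (Y i) \<le> \<bar>s i\<bar> + 6 * D" using sF[of i] sF[of "2 * i"] close[of i] that by auto
    then show ?thesis using f1 f2 z3 kbig(1) D0 F0 unfolding sy z1 z2 e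
      by (simp add: max_def abs_le_iff split: if_splits)
  qed
  have small: "wd q (Y i) \<le> R" if "i \<le> B" for i
  proof -
    have "wd q (Y (2 * i)) \<le> wd q (Y i) + c" using no[OF q(1), of i] by (simp add: Y_def)
    moreover have "wd q (Y i) \<le> \<bar>s i\<bar> + 6 * D" using close[of i] that by simp
    ultimately show ?thesis using double[OF that] far[of "2 * i"] unfolding R_def by linarith
  qed
  have "(\<lambda>i. inv q \<otimes> Y i) ` {..B} \<subseteq> {g \<in> carrier G. wl g \<le> R}"
    using small q(1) by (auto simp: word_dist_def)
  moreover have "inj_on (\<lambda>i. inv q \<otimes> Y i) {..B}"
  proof (rule inj_onI)
    fix i j assume "inv q \<otimes> Y i = inv q \<otimes> Y j"
    then have "pw (int i) = pw (int j)" using q(1) by (simp add: Y_def)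
    then show "i = j" using pw_inj by simp
  qed
  ultimately have "card {..B} \<le> card {g \<in> carrier G. wl g \<le> R}"
    using finite_ball by (intro card_inj_on_le)
  then show False by (simp add: B_def[symmetric])
qed

text \<open>The gap \<open>4 * \<delta>\<close> is what \<open>doubling_imp_quasi_axis\<close> asks
  of the conjugate \<open>y\<close> of \<open>x^i\<close>. Every \<open>x^l\<close> is within a
  fixed \<open>E\<close> of \<open>q y^(l div i)\<close>, the remainder modulo \<open>i\<close>
  being bounded, so the estimate passes from \<open>y\<close> to \<open>x\<close>.\<close>

lemma ex_axis: "\<exists>C. \<forall>a b c. a \<le> b \<and> b \<le> c \<longrightarrow> gp (pw b) (pw a) (pw c) \<le> C"
proof -
  obtain q i where q: "q \<in> carrier G" and i: "wd q (pw (2 * int i) \<otimes> q) > wd q (pw (int i) \<otimes> q) + 4 * real \<delta>"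
    using ex_doubling by blast
  define y where "y = inv q \<otimes> pw (int i) \<otimes> q"
  have y: "y \<in> carrier G" using q by (simp add: y_def)
  have i0: "0 < i" by (rule ccontr) (use i q in auto)
  have ypow: "y [^] (j::nat) = inv q \<otimes> pw (int (i * j)) \<otimes> q" for j
  proof -
    have e: "pw (int i) [^] int j = pw (int (i * j))" by (simp only: int_pow_pow x_carrier of_nat_mult)
    have "y [^] int j = inv q \<otimes> pw (int i) [^] int j \<otimes> q"
      unfolding y_def by (rule conj_int_pow) (use q in auto)
    then have "y [^] int j = inv q \<otimes> pw (int (i * j)) \<otimes> q" by (simp only: e)
    then show ?thesis by (simp only: int_pow_int)
  qed
  have big: "wl (y [^] (2::nat)) > wl y + 4 * real \<delta>"
    using i q ypow[of 2] by (simp add: word_dist_def y_def m_assoc mult.commute)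
  define E where "E = wl q + real i * wl x"
  have E: "wd (pw (int l)) (q \<otimes> y [^] (l div i)) \<le> E" for l
  proof -
    have qy: "q \<otimes> y [^] (l div i) = pw (int (i * (l div i))) \<otimes> q"
      using q by (simp add: ypow m_assoc[symmetric] del: of_nat_mult)
    have "int l = int (i * (l div i)) + int (l mod i)"
      by (metis mult_div_mod_eq of_nat_add)
    then have "pw (int l) = pw (int (i * (l div i))) \<otimes> pw (int (l mod i))" by (simp only: pw_add)
    then have "wd (pw (int l)) (q \<otimes> y [^] (l div i)) = wd (pw (int (l mod i))) q"
      using qy q by (simp del: of_nat_mult)
    also have "\<dots> \<le> wl (pw (int (l mod i))) + wl q" using wd_tri[of "pw (int (l mod i))" \<one> q] q by simp
    also have "wl (pw (int (l mod i))) \<le> real (l mod i) * wl x" by (rule wl_pw_nat)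
    also have "real (l mod i) * wl x \<le> real i * wl x"
      using i0 by (intro mult_right_mono) (auto intro: less_imp_le)
    finally show ?thesis by (simp add: E_def)
  qed
  \<comment> \<open>One term for each replacement: the bound for \<open>y\<close>, then the base
    point, the start \<open>\<one>\<close> by \<open>q\<close>, and the far end.\<close>
  define C where "C = wl y + 2 * real \<delta> + E + wl q + E"
  have nat: "gp (pw (int l)) \<one> (pw (int m)) \<le> C" if "l \<le> m" for l m
  proof -
    let ?l = "q \<otimes> y [^] (l div i)" and ?m = "q \<otimes> y [^] (m div i)"
    have c: "?l \<in> carrier G" "?m \<in> carrier G" using q y by auto
    have "gp (y [^] (l div i)) \<one> (y [^] (m div i)) \<le> wl y + 2 * real \<delta>"
      by (rule doubling_imp_quasi_axis[OF y big]) (use that div_le_mono in auto)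
    then have g: "gp ?l q ?m \<le> wl y + 2 * real \<delta>"
      using gp_left[of q "y [^] (l div i)" \<one> "y [^] (m div i)"] q y by simp
    have "gp (pw (int l)) \<one> (pw (int m)) \<le> gp ?l \<one> (pw (int m)) + wd (pw (int l)) ?l"
      by (rule gp_base) (use c in auto)
    moreover have "gp ?l \<one> (pw (int m)) \<le> gp ?l q (pw (int m)) + wd \<one> q"
      by (rule gp_arg) (use c q in auto)
    moreover have "gp ?l q (pw (int m)) \<le> gp ?l q ?m + wd (pw (int m)) ?m"
      using gp_arg[of "pw (int m)" q ?l ?m] gp_sym[of q "pw (int m)" ?l] gp_sym[of q ?m ?l] c q by simp
    ultimately show ?thesis using g E[of l] E[of m] q unfolding C_def by simp
  qed
  show ?thesis
  proof (intro exI[of _ C] allI impI)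
    fix a b c :: int assume abc: "a \<le> b \<and> b \<le> c"
    define l m where "l = nat (b - a)" and "m = nat (c - a)"
    have "b = a + int l" "c = a + int m" "l \<le> m" using abc by (auto simp: l_def m_def)
    then show "gp (pw b) (pw a) (pw c) \<le> C"
      using nat[of l m] gp_left[of "pw a" "pw (int l)" \<one> "pw (int m)"] by (simp add: pw_add)
  qed
qed

definition axis_const :: real where
  "axis_const = (SOME C. \<forall>a b c. a \<le> b \<and> b \<le> c \<longrightarrow> gp (pw b) (pw a) (pw c) \<le> C)"

lemma axis: "\<lbrakk>a \<le> b; b \<le> c\<rbrakk> \<Longrightarrow> gp (pw b) (pw a) (pw c) \<le> axis_const"
  using someI_ex[OF ex_axis] unfolding axis_const_def by blast

lemma axis_const_nonneg: "0 \<le> axis_const"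
  using axis[of 0 0 0] by (simp add: gromov_product_def)

text \<open>The lengths of the powers of \<open>x^t\<close> grow by at most \<open>|x^t|\<close> per
  step, so one of them is within half of that of the level of \<open>z\<close>; nearness to the same
  geodesic does the rest.\<close>

lemma near_axis_aux:
  assumes z: "z \<in> carrier G" "gp z \<one> (pw (int t * int m)) \<le> \<epsilon>"
  shows "\<exists>k. wd z (pw (int t * k)) \<le> wl (pw (int t)) / 2 + 4 * \<epsilon> + 2 * axis_const + 2 * real \<delta>"
proof -
  let ?p = "\<lambda>k. pw (int t * int k)" and ?w = "wl (pw (int t))"
  define f where "f k = wl (?p k)" for k
  have e0: "0 \<le> \<epsilon>" using gp_nonneg[of \<one> "?p m" z] z by simp
  have zf: "wl z \<le> f m + 2 * \<epsilon>"
    using z gp_double[of z \<one> "?p m"] wd_nonneg[of "?p m" z] unfolding f_def wd_one_left[OF z(1)] wd_one_left[OF int_pow_closed[OF x_carrier]] by linarith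
  \<comment> \<open>The length of \<open>z\<close> may exceed that of the last power, by at most
    \<open>2 * \<epsilon>\<close>; cutting it off keeps the level within the range of
    \<open>real_step_crossing\<close>.\<close>
  define s where "s = min (wl z) (f m)"
  have s: "0 \<le> s" "s \<le> f m" "s \<le> wl z" "wl z \<le> s + 2 * \<epsilon>"
    using zf e0 by (auto simp: s_def f_def min_def)
  have step: "f (Suc k) \<le> f k + ?w" for k
    using wl_mult[of "?p k" "pw (int t)"] pw_add[of "int t * int k" "int t"]
    by (simp add: f_def algebra_simps)
  obtain j where j: "j \<le> m" "(j < m \<and> f j \<le> s \<and> s \<le> f (Suc j)) \<or> f j = s"
    using real_step_crossing[of f s m] s by (auto simp: f_def)
  obtain k where k: "k \<le> m" "\<bar>f k - s\<bar> \<le> ?w / 2"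
  proof (cases "\<bar>f j - s\<bar> \<le> ?w / 2")
    case True
    then show ?thesis using that j by blast
  next
    case False
    then have "j < m" "f j \<le> s" "s \<le> f (Suc j)" using j by auto
    then show ?thesis using that[of "Suc j"] False step[of j] by (auto simp: abs_le_iff)
  qed
  have "gp (?p k) \<one> (?p m) \<le> axis_const"
    using axis[of 0 "int t * int k" "int t * int m"] k(1) by (simp add: mult_left_mono)
  then have "wd z (?p k) \<le> \<bar>wd \<one> z - wd \<one> (?p k)\<bar> + 2 * (\<epsilon> + axis_const) + 2 * real \<delta>"
    by (intro near_points_close[of \<one> "?p m"]) (use z e0 axis_const_nonneg in auto)
  moreover have "\<bar>wd \<one> z - wd \<one> (?p k)\<bar> \<le> ?w / 2 + 2 * \<epsilon>"
    using k(2) s unfolding f_def wd_one_left[OF z(1)] wd_one_left[OF int_pow_closed[OF x_carrier]] by linarith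
  ultimately show ?thesis by (intro exI[of _ "int k"]) simp
qed

lemma near_axis:
  assumes z: "z \<in> carrier G" "gp z (pw (int t * a)) (pw (int t * b)) \<le> \<epsilon>"
  shows "\<exists>k. wd z (pw (int t * k)) \<le> wl (pw (int t)) / 2 + 4 * \<epsilon> + 2 * axis_const + 2 * real \<delta>"
proof -
  have main: ?thesis if ab: "a \<le> b" "gp z (pw (int t * a)) (pw (int t * b)) \<le> \<epsilon>" for a b
  proof -
    let ?a = "pw (int t * a)" and ?z = "inv (pw (int t * a)) \<otimes> z"
    define m where "m = nat (b - a)"
    have b: "b = a + int m" using ab by (simp add: m_def)
    have zz: "z = ?a \<otimes> ?z" using z by (simp add: m_assoc[symmetric])
    have "gp ?z \<one> (pw (int t * int m)) = gp z ?a (pw (int t * b))"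
      using gp_left[of ?a ?z \<one> "pw (int t * int m)"] z zz[symmetric] by (simp add: b pw_add[symmetric] distrib_left)
    then obtain k where k: "wd ?z (pw (int t * k)) \<le> wl (pw (int t)) / 2 + 4 * \<epsilon> + 2 * axis_const + 2 * real \<delta>"
      using near_axis_aux[of ?z t m \<epsilon>] ab z by auto
    have "wd z (pw (int t * (a + k))) = wd ?z (pw (int t * k))"
      using wd_left[of ?a ?z "pw (int t * k)"] z zz[symmetric] by (simp add: pw_add[symmetric] distrib_left)
    then show ?thesis using k by (intro exI[of _ "a + k"]) simp
  qed
  show ?thesis
  proof (cases "a \<le> b")
    case True
    then show ?thesis using main z by blast
  next
    case False
    then show ?thesis using main[of b a] z gp_sym[of "pw (int t * a)" "pw (int t * b)" z] by simp
  qed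
qed

end

section \<open>The maximal elementary subgroup\<close>

context group
begin

lemma subgroup_range_int_pow:
  assumes y: "y \<in> carrier G"
  shows "subgroup (range (\<lambda>n::int. y [^] n)) G"
proof -
  have "range (\<lambda>n::int. y [^] n) = generate G {y}" using generate_pow[OF y] by auto
  then show ?thesis using generate_is_subgroup[of "{y}"] y by simp
qed

lemma cyclic_range_int_pow:
  assumes y: "y \<in> carrier G"
  shows "cyclic_group (G\<lparr>carrier := range (\<lambda>n::int. y [^] n)\<rparr>)"
proof -
  let ?C = "range (\<lambda>n::int. y [^] n)"
  interpret C: group "G\<lparr>carrier := ?C\<rparr>"
    by (rule subgroup.subgroup_is_group[OF subgroup_range_int_pow[OF y] is_group])
  have yC: "y \<in> ?C" using int_pow_1[OF y] by (metis rangeI)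
  have "y [^]\<^bsub>G\<lparr>carrier := ?C\<rparr>\<^esub> n = y [^] n" for n :: int
    by (rule int_pow_consistent[OF subgroup_range_int_pow[OF y] yC, symmetric])
  then have "range (\<lambda>n::int. y [^]\<^bsub>G\<lparr>carrier := ?C\<rparr>\<^esub> n) = carrier (G\<lparr>carrier := ?C\<rparr>)"
    by simp
  then show ?thesis unfolding C.cyclic_group using yC by (intro bexI[of _ y]) auto
qed

text \<open>Two distinct exponents lead to the same coset, and the quotient of the two powers lies
  in \<open>C\<close>. It is the exponent that is nonzero; \<open>y\<close> may have finite
  order.\<close>

lemma finite_rcosets_imp_power_mem:
  assumes C: "subgroup C G" and fin: "finite ((\<lambda>i::int. C #> y [^] i) ` UNIV)" and y: "y \<in> carrier G"
  shows "\<exists>a::int. a \<noteq> 0 \<and> y [^] a \<in> C"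
proof -
  have "\<not> inj (\<lambda>i::int. C #> y [^] i)"
    using fin finite_imageD infinite_UNIV_int by blast
  then obtain i j :: int where ij: "i \<noteq> j" "C #> y [^] i = C #> y [^] j" by (auto simp: inj_def)
  have "y [^] i \<in> C #> y [^] i" using C y by (simp add: rcos_self)
  then obtain h where h: "h \<in> C" "y [^] i = h \<otimes> y [^] j" using ij by (auto simp: r_coset_def)
  have "h \<in> carrier G" by (rule subgroup.mem_carrier[OF C h(1)])
  then have "y [^] (i - j) = h" using y unfolding int_pow_diff[OF y] h(2) by (simp add: m_assoc)
  then show ?thesis using ij h by (intro exI[of _ "i - j"]) auto
qed

end

section \<open>The commensurator of \<open>\<langle>x\<rangle>\<close> is E(x)\<close>

context loxodromic
begin

text \<open>The commensurator of \<open>\<langle>x\<rangle>\<close> with explicit exponents, the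
  form in which coincidences found by the pigeonhole principle deliver membership.\<close>

definition comm where
  "comm = {g \<in> carrier G. \<exists>p q. p \<noteq> 0 \<and> q \<noteq> 0 \<and> inv g \<otimes> pw q \<otimes> g = pw p}"

lemma pw_mult: "pw a [^] (n::int) = pw (a * n)"
  by (simp add: int_pow_pow)

lemma conj_pw_mult:
  assumes "g \<in> carrier G" "inv g \<otimes> pw q \<otimes> g = pw p"
  shows "inv g \<otimes> pw (q * n) \<otimes> g = pw (p * n)"
  using conj_int_pow[of g "pw q" n] assms by (simp add: pw_mult)

lemma comm_subgroup: "subgroup comm G"
proof
  show "comm \<subseteq> carrier G" by (auto simp: comm_def)
  show "\<one> \<in> comm" unfolding comm_def by (auto intro!: exI[of _ 1])
next
  fix g h assume "g \<in> comm" "h \<in> comm"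
  then obtain p q p' q' where g: "g \<in> carrier G" "p \<noteq> 0" "q \<noteq> 0" "inv g \<otimes> pw q \<otimes> g = pw p"
    and h: "h \<in> carrier G" "p' \<noteq> 0" "q' \<noteq> 0" "inv h \<otimes> pw q' \<otimes> h = pw p'"
    unfolding comm_def by blast
  \<comment> \<open>The relation for \<open>g\<close> is raised to the power \<open>q'\<close> and
    the one for \<open>h\<close> to the power \<open>p\<close>, so that both meet in
    \<open>x^(q' p)\<close>.\<close>
  have "inv (g \<otimes> h) \<otimes> pw (q * q') \<otimes> (g \<otimes> h) = inv h \<otimes> (inv g \<otimes> pw (q * q') \<otimes> g) \<otimes> h"
    using g(1) h(1) by (simp add: inv_mult_group m_assoc)
  also have "\<dots> = inv h \<otimes> pw (q' * p) \<otimes> h" using conj_pw_mult[OF g(1,4)] by (simp add: mult.commute)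
  also have "\<dots> = pw (p' * p)" by (rule conj_pw_mult[OF h(1,4)])
  finally show "g \<otimes> h \<in> comm"
    unfolding comm_def using g(1-3) h(1-3) by (intro CollectI conjI exI[of _ "p' * p"] exI[of _ "q * q'"]) auto
next
  fix g assume "g \<in> comm"
  then obtain p q where g: "g \<in> carrier G" "p \<noteq> 0" "q \<noteq> 0" "inv g \<otimes> pw q \<otimes> g = pw p"
    unfolding comm_def by blast
  have "inv (inv g) \<otimes> pw p \<otimes> inv g = (g \<otimes> inv g) \<otimes> pw q \<otimes> (g \<otimes> inv g)"
    using g(1) unfolding g(4)[symmetric] by (simp add: m_assoc) (simp add: m_assoc[symmetric])
  then have "inv (inv g) \<otimes> pw p \<otimes> inv g = pw q" using g(1) by simp
  then show "inv g \<in> comm" unfolding comm_def using g(1-3) by blast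
qed

text \<open>The relation makes \<open>g\<langle>x\<rangle>\<close> pass at distance
  \<open>|g|\<close> from \<open>x^(q n)\<close> for all \<open>n\<close>. For large
  \<open>n\<close> this distance is negligible against the length of the segment, so
  \<open>g\<close> lies near a geodesic between powers of \<open>x\<close>, with a bound independent
  of \<open>g\<close>.\<close>

lemma comm_near_axis: "\<exists>D. \<forall>g\<in>comm. \<exists>m. wd g (pw m) \<le> D"
proof -
  let ?C = "axis_const" and ?d = "real \<delta>"
  have "\<exists>m. wd g (pw m) \<le> wl x / 2 + 4 * (?C + 2 * ?d) + 2 * ?C + 2 * ?d" if g: "g \<in> comm" for g
  proof -
    have gc: "g \<in> carrier G" using g by (simp add: comm_def)
    obtain p q where pq: "p \<noteq> 0" "q \<noteq> 0" "inv g \<otimes> pw q \<otimes> g = pw p" using g by (auto simp: comm_def)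
    have conj: "pw (q * n) \<otimes> g = g \<otimes> pw (p * n)" for n
      using conj_pw_mult[OF gc pq(3), of n] gc inv_solve_left[of "pw (p * n)" g "pw (q * n) \<otimes> g"]
      by (simp add: m_assoc)
    obtain N where N: "\<And>i. \<bar>i\<bar> \<ge> int N \<Longrightarrow> wl (pw i) > wl g + ?C + 2 * ?d"
      using pw_tends by blast
    \<comment> \<open>The sign of \<open>p\<close> gives
      \<open>p * (- M) \<le> 0 \<le> p * M\<close>, the order in which \<open>axis\<close> takes its
      exponents.\<close>
    define M where "M = sgn p * int N"
    have M: "p * M = \<bar>p\<bar> * int N" by (simp add: M_def abs_sgn mult.assoc mult.left_commute)
    have M0: "\<bar>p * M\<bar> \<ge> int N" "0 \<le> p * M" using pq(1) mult_right_mono[of 1 "\<bar>p\<bar>" "int N"] by (simp_all add: M)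
    let ?A = "pw (q * (- M))" and ?B = "pw (q * M)" and ?A' = "g \<otimes> pw (p * (- M))" and ?B' = "g \<otimes> pw (p * M)"
    have g1: "gp g ?A' ?B' \<le> ?C"
      using gp_left[of g \<one> "pw (p * (- M))" "pw (p * M)"] gc axis[of "p * (- M)" 0 "p * M"] M0 by simp
    have dA: "wd ?A ?A' = wl g" unfolding conj[symmetric] by (rule wd_mult_right) (use gc in auto)
    have dB: "wd ?B ?B' = wl g" unfolding conj[symmetric] by (rule wd_mult_right) (use gc in auto)
    have w: "wd g ?A' = wl (pw (p * M))" "wd g ?B' = wl (pw (p * M))" using gc by simp_all
    have gA: "wd g ?A' > wl g + ?C + 2 * ?d" "wd g ?B' > wl g + ?C + 2 * ?d"
      unfolding w using N[OF M0(1)] by blast+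
    have far: "gp g v' v > ?C + 2 * ?d"
      if "v \<in> carrier G" "v' \<in> carrier G" "wd v v' = wl g" "wd g v' > wl g + ?C + 2 * ?d" for v v'
      using gp_double[of g v' v] wd_tri[OF gc that(1,2)] wd_sym[OF that(1,2)] wd_sym[OF gc that(1)] wd_sym[OF gc that(2)]
        that(3,4) by linarith
    have g2: "gp g ?A' ?A > ?C + 2 * ?d" by (rule far[OF _ _ dA gA(1)]) (use gc in auto)
    have g3: "gp g ?B' ?B > ?C + 2 * ?d" by (rule far[OF _ _ dB gA(2)]) (use gc in auto)
    have h1: "gp g ?A' ?B' \<ge> min (gp g ?A' ?A) (gp g ?B' ?A) - ?d" by (rule hyp) (use gc in auto)
    have h2: "gp g ?A ?B' \<ge> min (gp g ?A ?B) (gp g ?B' ?B) - ?d" by (rule hyp) (use gc in auto)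
    have s: "gp g ?B' ?A = gp g ?A ?B'" by (rule gp_sym) (use gc in auto)
    have "gp g ?A ?B \<le> ?C + 2 * ?d"
      using g1 g2 g3 h1 h2 s delta_nonneg by (auto simp: min_def split: if_splits)
    then show ?thesis using near_axis[of g 1 "q * (- M)" "q * M" "?C + 2 * ?d"] gc by simp
  qed
  then show ?thesis by blast
qed

lemma x_in_comm: "x \<in> comm"
proof -
  have "inv x \<otimes> pw 1 \<otimes> x = pw 1" by simp
  then show ?thesis unfolding comm_def by (intro CollectI conjI exI[of _ 1]) auto
qed

lemma comm_elementary: "elementary_subgroup comm G"
proof -
  let ?C = "range pw"
  have sub: "?C \<subseteq> comm"
    using subgroup_int_pow_closed[OF comm_subgroup x_in_comm] by auto
  have cyc: "cyclic_group (G\<lparr>carrier := ?C\<rparr>)" by (rule cyclic_range_int_pow) simp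
  obtain D where D: "\<And>g. g \<in> comm \<Longrightarrow> \<exists>m. wd g (pw m) \<le> D" using comm_near_axis by blast
  have "rcosets\<^bsub>G\<lparr>carrier := comm\<rparr>\<^esub> ?C \<subseteq> (\<lambda>b. ?C #> b) ` {b \<in> carrier G. wl b \<le> D}"
  proof
    fix A assume "A \<in> rcosets\<^bsub>G\<lparr>carrier := comm\<rparr>\<^esub> ?C"
    then obtain g where g: "g \<in> comm" "A = ?C #> g" by (auto simp: RCOSETS_def r_coset_def)
    have gc: "g \<in> carrier G" using g by (simp add: comm_def)
    obtain m where m: "wd g (pw m) \<le> D" using D g by blast
    \<comment> \<open>Now \<open>g = x^m b\<close> with \<open>b\<close> in a fixed finite ball, so
      only finitely many cosets of \<open>\<langle>x\<rangle>\<close> occur.\<close>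
    define b where "b = inv (pw m) \<otimes> g"
    have b: "b \<in> carrier G" using gc by (simp add: b_def)
    have "wl b \<le> D" using m wd_sym[of g "pw m"] gc by (simp add: b_def word_dist_def)
    have "g = pw m \<otimes> b" using gc by (simp add: b_def m_assoc[symmetric])
    then have "g \<in> ?C #> b" by (auto simp: r_coset_def)
    then have "?C #> b = ?C #> g" using repr_independence[OF _ b subgroup_range_int_pow[OF x_carrier]] by blast
    then show "A \<in> (\<lambda>b. ?C #> b) ` {b \<in> carrier G. wl b \<le> D}" using g b \<open>wl b \<le> D\<close> by blast
  qed
  then have fin: "finite (rcosets\<^bsub>G\<lparr>carrier := comm\<rparr>\<^esub> ?C)"
    using finite_ball finite_surj by blast
  have "elementary_group (G\<lparr>carrier := comm\<rparr>)"
    unfolding elementary_group_def using subgroup_incl[OF subgroup_range_int_pow[OF x_carrier] comm_subgroup sub] cyc fin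
    by (intro exI[of _ ?C]) simp
  then show ?thesis by (simp add: elementary_subgroup_def comm_subgroup)
qed

text \<open>Let \<open>c\<close> generate a cyclic subgroup of finite index, and let
  \<open>y = g^-1 x g\<close>. Nonzero powers of both \<open>x\<close> and \<open>y\<close> lie in
  it, say \<open>x^a = c^m\<close> and \<open>y^b = c^k\<close>, so
  \<open>y^(b m) = x^(a k)\<close>. The exponents \<open>m\<close> and \<open>k\<close> are nonzero
  because \<open>x\<close> has infinite order.\<close>

lemma elementary_sub_comm:
  assumes E: "elementary_subgroup E G" and xE: "x \<in> E"
  shows "E \<subseteq> comm"
proof
  fix g assume g: "g \<in> E"
  have sE: "subgroup E G" using E by (simp add: elementary_subgroup_def)
  have Ec: "E \<subseteq> carrier G" using sE subgroup.subset by blast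
  obtain C where C: "subgroup C (G\<lparr>carrier := E\<rparr>)" "cyclic_group (G\<lparr>carrier := C\<rparr>)"
    "finite (rcosets\<^bsub>G\<lparr>carrier := E\<rparr>\<^esub> C)"
    using E unfolding elementary_subgroup_def elementary_group_def by auto
  have sC: "subgroup C G" using C(1) sE incl_subgroup by blast
  interpret C: group "G\<lparr>carrier := C\<rparr>" by (rule subgroup.subgroup_is_group[OF sC is_group])
  obtain c where c: "c \<in> C" "C = range (\<lambda>n::int. c [^]\<^bsub>G\<lparr>carrier := C\<rparr>\<^esub> n)"
  proof -
    have cC: "carrier (G\<lparr>carrier := C\<rparr>) = C" by simp
    show ?thesis using C(2) that unfolding C.cyclic_group cC by blast
  qed
  have cc: "c \<in> carrier G" by (rule subgroup.mem_carrier[OF sC c(1)])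
  have Cr: "\<exists>n::int. h = c [^] n" if "h \<in> C" for h
  proof -
    have "h \<in> range (\<lambda>n::int. c [^]\<^bsub>G\<lparr>carrier := C\<rparr>\<^esub> n)" by (rule subsetD[OF equalityD1[OF c(2)] that])
    then obtain n :: int where "h = c [^]\<^bsub>G\<lparr>carrier := C\<rparr>\<^esub> n" by (rule rangeE)
    then show ?thesis using int_pow_consistent[OF sC c(1), of n] by (intro exI[of _ n]) (simp only:)
  qed
  have fin: "finite ((\<lambda>i::int. C #> y [^] i) ` UNIV)" if "y \<in> E" for y
  proof (rule finite_subset[OF _ C(3)])
    have "y [^] i \<in> E" for i :: int by (rule subgroup_int_pow_closed[OF sE that])
    then show "(\<lambda>i::int. C #> y [^] i) ` UNIV \<subseteq> rcosets\<^bsub>G\<lparr>carrier := E\<rparr>\<^esub> C"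
      by (auto simp: RCOSETS_def r_coset_def)
  qed
  have gc: "g \<in> carrier G" using g Ec by blast
  obtain a :: int where a: "a \<noteq> 0" "pw a \<in> C"
    using finite_rcosets_imp_power_mem[OF sC fin[OF xE]] by auto
  then obtain m :: int where m: "pw a = c [^] m" using Cr by blast
  define y where "y = inv g \<otimes> x \<otimes> g"
  have yE: "y \<in> E" unfolding y_def using g xE sE by (simp add: subgroup.m_closed subgroup.m_inv_closed)
  have yp: "y [^] n = inv g \<otimes> pw n \<otimes> g" for n :: int
    unfolding y_def by (rule conj_int_pow) (use gc in auto)
  obtain b :: int where b: "b \<noteq> 0" "y [^] b \<in> C"
    using finite_rcosets_imp_power_mem[OF sC fin[OF yE]] yE Ec by blast
  then obtain k :: int where k: "y [^] b = c [^] k" using Cr by blast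
  have m0: "m \<noteq> 0"
  proof
    assume "m = 0" then have "pw a = pw 0" using m by simp
    then show False using a pw_inj by blast
  qed
  have k0: "k \<noteq> 0"
  proof
    assume "k = 0"
    then have "inv g \<otimes> pw b \<otimes> g = \<one>" using k yp by simp
    then have e: "\<one> = inv g \<otimes> (pw b \<otimes> g)" using gc by (simp add: m_assoc)
    have "pw b \<otimes> g = g \<otimes> \<one>" by (rule iffD1[OF inv_solve_left e]) (use gc in auto)
    then have "pw b = pw 0" using gc by simp
    then show False using b pw_inj by blast
  qed
  have yc: "y \<in> carrier G" using yE Ec by blast
  have "y [^] (b * m) = c [^] (k * m)" using k yc cc by (simp flip: int_pow_pow)
  also have "\<dots> = pw (a * k)" using m cc by (simp add: mult.commute[of k] flip: int_pow_pow)
  finally have "inv g \<otimes> pw (b * m) \<otimes> g = pw (a * k)" by (simp add: yp)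
  then show "g \<in> comm" unfolding comm_def using gc a b m0 k0
    by (intro CollectI conjI exI[of _ "a * k"] exI[of _ "b * m"]) auto
qed

text \<open>\<open>comm\<close> is the greatest elementary subgroup containing \<open>x\<close>,
  hence the only maximal one, which is what the description operator needs.\<close>

lemma max_elementary_eq: "max_elementary G x = comm"
  unfolding max_elementary_def
proof (rule the_equality)
  show "elementary_subgroup comm G \<and> x \<in> comm \<and>
    (\<forall>E'. elementary_subgroup E' G \<and> comm \<subseteq> E' \<longrightarrow> E' = comm)"
    using comm_elementary x_in_comm elementary_sub_comm by blast
  show "E = comm" if "elementary_subgroup E G \<and> x \<in> E \<and>
    (\<forall>E'. elementary_subgroup E' G \<and> E \<subseteq> E' \<longrightarrow> E' = E)" for E
    using that comm_elementary elementary_sub_comm by blast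
qed

section \<open>Bounded overlap of the axis with H and with its own translates\<close>

lemma pigeonhole_ball:
  "\<exists>N. \<forall>f :: nat \<Rightarrow> 'a. (\<forall>l\<le>N. f l \<in> carrier G \<and> wl (f l) \<le> R) \<longrightarrow> (\<exists>l l'. l < l' \<and> l' \<le> N \<and> f l = f l')"
proof (rule exI[of _ "card {g \<in> carrier G. wl g \<le> R}"], intro allI impI)
  let ?B = "{g \<in> carrier G. wl g \<le> R}"
  fix f :: "nat \<Rightarrow> 'a" assume f: "\<forall>l\<le>card ?B. f l \<in> carrier G \<and> wl (f l) \<le> R"
  then have sub: "f ` {..card ?B} \<subseteq> ?B" by auto
  have "\<not> inj_on f {..card ?B}"
  proof
    assume "inj_on f {..card ?B}"
    then have "card {..card ?B} \<le> card ?B" using card_inj_on_le[OF _ sub finite_ball] by blast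
    then show False by simp
  qed
  then obtain l l' where "f l = f l'" "l \<noteq> l'" "l \<le> card ?B" "l' \<le> card ?B" by (auto simp: inj_on_def)
  then show "\<exists>l l'. l < l' \<and> l' \<le> card ?B \<and> f l = f l'" by (metis nat_neq_iff)
qed

text \<open>The product is at most \<open>|x^s|\<close>, so a large one forces
  \<open>j < \<bar>s\<bar>\<close> and puts the power of exponent \<open>sgn s * j\<close> on the
  axis between \<open>\<one>\<close> and \<open>x^s\<close>. Seen from it, \<open>x^s\<close> and
  \<open>z\<close> still have a large product, and \<open>hyp\<close> transfers the axis bound from
  \<open>x^s\<close> to \<open>z\<close>.\<close>

lemma axis_tracking:
  assumes z: "z \<in> carrier G" and P: "gp \<one> (pw s) z > real N * wl x + axis_const + real \<delta>" and j: "j \<le> N"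
  shows "gp (pw (sgn s * int j)) \<one> z \<le> axis_const + real \<delta>"
proof -
  let ?l = "sgn s * int j"
  have "gp \<one> (pw s) z \<le> wl (pw s)" using gp_le[of "pw s" z \<one>] z by simp
  also have "wl (pw s) = wl (pw (int (nat \<bar>s\<bar>)))" by (cases "s \<ge> 0") auto
  also have "\<dots> \<le> real (nat \<bar>s\<bar>) * wl x" by (rule wl_pw_nat)
  finally have "real N * wl x < real (nat \<bar>s\<bar>) * wl x" using P axis_const_nonneg delta_nonneg by linarith
  then have "real N < real (nat \<bar>s\<bar>)" by (rule mult_right_less_imp_less) simp
  then have "N < nat \<bar>s\<bar>" by (simp only: of_nat_less_iff)
  then have js: "int j < \<bar>s\<bar>" using j by linarith
  have ax: "gp (pw ?l) \<one> (pw s) \<le> axis_const"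
  proof (cases "s > 0")
    case True
    then show ?thesis using axis[of 0 ?l s] js by simp
  next
    case False
    then show ?thesis using axis[of s ?l 0] js gp_sym[of "pw s" \<one> "pw ?l"] by (auto simp: sgn_if split: if_splits)
  qed
  have "wl (pw ?l) \<le> real j * wl x" using wl_pw_nat[of j] by (auto simp: sgn_if)
  also have "\<dots> \<le> real N * wl x" using j by (intro mult_right_mono) auto
  finally have "wl (pw ?l) \<le> real N * wl x" .
  moreover have "gp \<one> (pw s) z \<le> gp (pw ?l) (pw s) z + wl (pw ?l)" using gp_base[of "pw s" z \<one> "pw ?l"] z by simp
  ultimately have far: "gp (pw ?l) (pw s) z > axis_const + real \<delta>" using P by linarith
  have "gp (pw ?l) \<one> (pw s) \<ge> min (gp (pw ?l) \<one> z) (gp (pw ?l) (pw s) z) - real \<delta>"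
    by (rule hyp) (use z in auto)
  then show ?thesis using ax far by (auto simp: min_def split: if_splits)
qed

text \<open>A large product would keep \<open>N + 1\<close> consecutive powers of \<open>x\<close>
  within \<open>D\<close> of elements \<open>c l\<close> of \<open>H\<close>. If two of the
  differences \<open>f l\<close> agree, a quotient of two of these powers equals \<open>c l'\<close>
  times the inverse of \<open>c l\<close>, which is a nontrivial power of \<open>x\<close> in
  \<open>H\<close>.\<close>

lemma axis_subgroup_bounded:
  assumes H: "subgroup H G" "quasiconvex G S K H" and no: "\<And>n. n \<noteq> 0 \<Longrightarrow> pw n \<notin> H"
  shows "\<exists>R. \<forall>h\<in>H. \<forall>s. gp \<one> (pw s) h \<le> R"
proof -
  define D where "D = K + 1 + 4 * (axis_const + real \<delta>) + 2 * real \<delta>"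
  have Hc: "H \<subseteq> carrier G" using H subgroup.subset by blast
  obtain N where N: "\<And>f :: nat \<Rightarrow> 'a. (\<forall>l\<le>N. f l \<in> carrier G \<and> wl (f l) \<le> D) \<Longrightarrow> (\<exists>l l'. l < l' \<and> l' \<le> N \<and> f l = f l')"
    using pigeonhole_ball[of D] by blast
  have "gp \<one> (pw s) h \<le> real N * wl x + axis_const + real \<delta>" if h: "h \<in> H" for h s
  proof (rule ccontr)
    assume "\<not> ?thesis"
    then have P: "gp \<one> (pw s) h > real N * wl x + axis_const + real \<delta>" by simp
    have hc: "h \<in> carrier G" using h Hc by blast
    have s0: "s \<noteq> 0"
    proof
      assume "s = 0"
      then have "gp \<one> (pw s) h = 0" using hc by (simp add: gromov_product_def)
      moreover have "0 \<le> real N * wl x" by simp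
      ultimately show False using P axis_const_nonneg delta_nonneg by linarith
    qed
    have "\<exists>c\<in>H. wd (pw (sgn s * int l)) c \<le> D" if "l \<le> N" for l
      unfolding D_def by (rule quasiconvex_near[OF H(2) Hc _ h])
        (use axis_tracking[OF hc P that] H subgroup.one_closed in auto)
    then obtain c where c: "\<And>l. l \<le> N \<Longrightarrow> c l \<in> H \<and> wd (pw (sgn s * int l)) (c l) \<le> D" by metis
    define f where "f l = inv (c l) \<otimes> pw (sgn s * int l)" for l
    have "\<forall>l\<le>N. f l \<in> carrier G \<and> wl (f l) \<le> D"
    proof (intro allI impI)
      fix l assume "l \<le> N"
      from c[OF this] have "c l \<in> carrier G" "wd (pw (sgn s * int l)) (c l) \<le> D" using Hc by auto
      then show "f l \<in> carrier G \<and> wl (f l) \<le> D"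
        using wd_sym[of "pw (sgn s * int l)" "c l"] by (simp add: f_def word_dist_def)
    qed
    from N[OF this]
obtain l l' where l: "l < l'" "l' \<le> N" "f l = f l'" by blast
    have cl: "c l \<in> H" "c l' \<in> H" using c l by auto
    have cc: "c l \<in> carrier G" "c l' \<in> carrier G" using cl Hc by auto
    let ?a = "pw (sgn s * int l)" and ?b = "pw (sgn s * int l')"
    have "inv (c l) \<otimes> ?a = inv (c l') \<otimes> ?b" using l by (simp add: f_def)
    then have "?b = c l' \<otimes> (inv (c l) \<otimes> ?a)"
      using cc inv_solve_left[of "inv (c l) \<otimes> ?a" "c l'" ?b] by simp
    then have "?b \<otimes> inv ?a = c l' \<otimes> inv (c l)" using cc by (simp add: m_assoc)
    moreover have "?b \<otimes> inv ?a = pw (sgn s * int l' - sgn s * int l)" by (rule int_pow_diff[symmetric]) simp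
    ultimately have "pw (sgn s * int l' - sgn s * int l) \<in> H"
      using cl H(1) by (simp add: subgroup.m_closed subgroup.m_inv_closed)
    moreover have "sgn s * int l' - sgn s * int l \<noteq> 0" using s0 l by (auto simp: sgn_if split: if_splits)
    ultimately show False using no by blast
  qed
  then show ?thesis by blast
qed

text \<open>Here \<open>x^l\<close>, up to sign of the exponent, stays near
  \<open>h x^(k l)\<close>, and a coincidence of differences reads \<open>x^q h = h x^p\<close> with
  \<open>q \<noteq> 0\<close>; infinite order gives \<open>p \<noteq> 0\<close>, so \<open>h\<close>
  would lie in \<open>comm\<close>.\<close>

lemma axis_translate_bounded:
  assumes h: "h \<in> carrier G" "h \<notin> comm"
  shows "\<exists>R. \<forall>a b. gp \<one> (pw a) (h \<otimes> pw b) \<le> R"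
proof -
  \<comment> \<open>The term \<open>wl h\<close> pays for replacing the start \<open>h\<close> of
    the translated axis by \<open>\<one>\<close>; through it the bound depends on
    \<open>h\<close>.\<close>
  define \<epsilon> where "\<epsilon> = axis_const + real \<delta> + wl h"
  define D where "D = wl x / 2 + 4 * \<epsilon> + 2 * axis_const + 2 * real \<delta>"
  obtain N where N: "\<And>f :: nat \<Rightarrow> 'a. (\<forall>l\<le>N. f l \<in> carrier G \<and> wl (f l) \<le> D) \<Longrightarrow> (\<exists>l l'. l < l' \<and> l' \<le> N \<and> f l = f l')"
    using pigeonhole_ball[of D] by blast
  have "gp \<one> (pw s) (h \<otimes> pw b) \<le> real N * wl x + axis_const + real \<delta>" for b s
  proof (rule ccontr)
    assume "\<not> ?thesis"
    then have P: "gp \<one> (pw s) (h \<otimes> pw b) > real N * wl x + axis_const + real \<delta>" by simp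
    have hb: "h \<otimes> pw b \<in> carrier G" using h by simp
    have s0: "s \<noteq> 0"
    proof
      assume "s = 0"
      then have "gp \<one> (pw s) (h \<otimes> pw b) = 0" using hb by (simp add: gromov_product_def)
      moreover have "0 \<le> real N * wl x" by simp
      ultimately show False using P axis_const_nonneg delta_nonneg by linarith
    qed
    have "\<exists>k. wd (inv h \<otimes> pw (sgn s * int l)) (pw k) \<le> D" if "l \<le> N" for l
    proof -
      let ?l = "pw (sgn s * int l)" and ?z = "inv h \<otimes> pw (sgn s * int l)"
      have hz: "h \<otimes> ?z = ?l" using h by (simp add: m_assoc[symmetric])
      have "gp ?z \<one> (pw b) = gp ?l h (h \<otimes> pw b)"
        using gp_left[of h ?z \<one> "pw b"] h unfolding hz by simp
      also have "\<dots> \<le> gp ?l \<one> (h \<otimes> pw b) + wd h \<one>" by (rule gp_arg) (use h in auto)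
      also have "\<dots> \<le> \<epsilon>" using axis_tracking[OF hb P that] h by (simp add: \<epsilon>_def)
      finally show ?thesis using near_axis[of ?z 1 0 b \<epsilon>] h by (simp add: D_def)
    qed
    then obtain k where k: "\<And>l. l \<le> N \<Longrightarrow> wd (inv h \<otimes> pw (sgn s * int l)) (pw (k l)) \<le> D" by metis
    define f where "f l = inv (inv h \<otimes> pw (sgn s * int l)) \<otimes> pw (k l)" for l
    have "\<forall>l\<le>N. f l \<in> carrier G \<and> wl (f l) \<le> D"
      using k h by (auto simp: f_def word_dist_def)
    from N[OF this] obtain l l' where l: "l < l'" "l' \<le> N" "f l = f l'" by blast
    let ?a = "pw (sgn s * int l)" and ?b = "pw (sgn s * int l')"
    have "inv ?a \<otimes> (h \<otimes> pw (k l)) = inv ?b \<otimes> (h \<otimes> pw (k l'))"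
      using l(3) h by (simp add: f_def inv_mult_group m_assoc)
    then have "h \<otimes> pw (k l') = ?b \<otimes> (inv ?a \<otimes> (h \<otimes> pw (k l)))"
      using inv_solve_left[of "inv ?a \<otimes> (h \<otimes> pw (k l))" ?b "h \<otimes> pw (k l')"] h by simp
    also have "\<dots> = (?b \<otimes> inv ?a) \<otimes> h \<otimes> pw (k l)" using h by (simp add: m_assoc)
    also have "?b \<otimes> inv ?a = pw (sgn s * int l' - sgn s * int l)" by (rule int_pow_diff[symmetric]) simp
    finally have e: "h \<otimes> pw (k l') = pw (sgn s * int l' - sgn s * int l) \<otimes> h \<otimes> pw (k l)" .
    define q where "q = sgn s * int l' - sgn s * int l"
    have "h \<otimes> pw (k l' - k l) = h \<otimes> pw (k l') \<otimes> inv (pw (k l))" using h by (simp add: int_pow_diff m_assoc)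
    also have "\<dots> = pw q \<otimes> h" unfolding e q_def[symmetric] using h by (simp add: m_assoc)
    finally have e2: "inv h \<otimes> pw q \<otimes> h = pw (k l' - k l)"
      using inv_solve_left[of "pw (k l' - k l)" h "pw q \<otimes> h"] h by (simp add: m_assoc)
    have q0: "q \<noteq> 0" using s0 l by (auto simp: q_def sgn_if split: if_splits)
    have "k l' - k l \<noteq> 0"
    proof
      assume "k l' - k l = 0"
      then have "inv h \<otimes> (pw q \<otimes> h) = \<one>" using e2 h by (simp add: m_assoc)
      then have "pw q \<otimes> h = h" using inv_solve_left[of \<one> h "pw q \<otimes> h"] h by simp
      then have "pw q = pw 0" using h by simp
      then show False using q0 pw_inj by blast
    qed
    then have "h \<in> comm" unfolding comm_def using h q0 e2 by blast
    then show False using h by blast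
  qed
  then show ?thesis by blast
qed

text \<open>Merges both overlap bounds into a single constant. The length of the triple product is
  the distance between the ends of the path from \<open>x^(-a)\<close> through \<open>\<one>\<close>
  and \<open>h\<close> to \<open>h x^b\<close>, so only the corners at \<open>\<one>\<close> and
  \<open>h\<close> cause a loss.\<close>

lemma subgroup_axis_constant:
  assumes H: "subgroup H G" "quasiconvex G S K H" and cH: "comm \<inter> H = {\<one>}"
  obtains \<rho> where "0 \<le> \<rho>" "\<And>h s. h \<in> H \<Longrightarrow> gp \<one> (pw s) h \<le> \<rho>"
    "\<And>h a b. \<lbrakk>h \<in> H; h \<noteq> \<one>\<rbrakk> \<Longrightarrow>
      wl (pw a \<otimes> h \<otimes> pw b) \<ge> wl (pw a) + wl h + wl (pw b) - 2 * \<rho>"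
proof -
  have Hc: "H \<subseteq> carrier G" using H subgroup.subset by blast
  have no: "pw n \<notin> H" if "n \<noteq> 0" for n
  proof
    assume "pw n \<in> H"
    moreover have "pw n \<in> comm" using subgroup_int_pow_closed[OF comm_subgroup x_in_comm] .
    ultimately have "pw n = pw 0" using cH by auto
    then show False using that pw_inj by blast
  qed
  obtain R where R: "\<And>h s. h \<in> H \<Longrightarrow> gp \<one> (pw s) h \<le> R"
    using axis_subgroup_bounded[OF H no] by blast
  have "gp \<one> (pw 0) \<one> = 0" by (simp add: gromov_product_def)
  then have R0: "0 \<le> R" using R[of \<one> 0] H(1) subgroup.one_closed by fastforce
  \<comment> \<open>For \<open>h\<close> longer than \<open>L\<close>, the product of
    \<open>h\<close> and \<open>h x^b\<close> at \<open>\<one>\<close> is at least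
    \<open>|h| - R\<close>, which exceeds \<open>R + \<delta>\<close>; then \<open>hyp\<close> and
    the bound \<open>R\<close> for \<open>h\<close> settle the corner at
    \<open>\<one>\<close>.\<close>
  define L where "L = 2 * R + 2 * real \<delta> + 1"
  have L0: "0 \<le> L" using R0 by (simp add: L_def)
  define A where "A = {h \<in> H. h \<noteq> \<one> \<and> wl h \<le> L}"
  have "finite A" by (rule finite_subset[OF _ finite_ball[of L]]) (use Hc in \<open>auto simp: A_def\<close>)
  then have "\<exists>R'\<ge>0. \<forall>h\<in>A. \<forall>a b. gp \<one> (pw a) (h \<otimes> pw b) \<le> R'"
  proof -
    have "\<forall>h\<in>A. \<exists>R'. \<forall>a b. gp \<one> (pw a) (h \<otimes> pw b) \<le> R'"
      using axis_translate_bounded cH Hc by (auto simp: A_def)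
    then obtain f where f: "\<And>h a b. h \<in> A \<Longrightarrow> gp \<one> (pw a) (h \<otimes> pw b) \<le> f h" by metis
    have fin: "finite (insert 0 (f ` A))" using \<open>finite A\<close> by simp
    show ?thesis
    proof (intro exI[of _ "Max (insert 0 (f ` A))"] conjI ballI allI)
      show "0 \<le> Max (insert 0 (f ` A))" using fin by (intro Max_ge) auto
      fix h a b assume "h \<in> A"
      then have "f h \<le> Max (insert 0 (f ` A))" using fin by (intro Max_ge) auto
      then show "gp \<one> (pw a) (h \<otimes> pw b) \<le> Max (insert 0 (f ` A))" using f[OF \<open>h \<in> A\<close>, of a b] by linarith
    qed
  qed
  then obtain R' where R': "0 \<le> R'" "\<And>h a b. h \<in> A \<Longrightarrow> gp \<one> (pw a) (h \<otimes> pw b) \<le> R'" by blast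
  \<comment> \<open>The corner at \<open>h\<close> loses \<open>R\<close>, the one at
    \<open>\<one>\<close> at most \<open>R + \<delta> + R'\<close>.\<close>
  define \<rho> where "\<rho> = 2 * R + real \<delta> + R' + L"
  show ?thesis
  proof (rule that[of \<rho>])
    show "0 \<le> \<rho>" using R0 R'(1) L0 by (simp add: \<rho>_def)
    show "gp \<one> (pw s) h \<le> \<rho>" if "h \<in> H" for h s using R[OF that, of s] R0 R'(1) L0 by (simp add: \<rho>_def)
    show "wl (pw a \<otimes> h \<otimes> pw b) \<ge> wl (pw a) + wl h + wl (pw b) - 2 * \<rho>" if h: "h \<in> H" "h \<noteq> \<one>" for h a b
    proof -
      have hc: "h \<in> carrier G" using h Hc by blast
      have hi: "inv h \<in> H" using h H(1) by (simp add: subgroup.m_inv_closed)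
      let ?a = "pw (- a)" and ?b = "h \<otimes> pw b"
      have e1: "wl (pw a \<otimes> h \<otimes> pw b) = wd ?a ?b"
        using hc by (simp add: word_dist_def pw_minus m_assoc)
      have e2: "wl ?b = wd (inv h) (pw b)" using hc by (simp add: word_dist_def)
      have s1: "wd ?b \<one> = wl ?b" "wd ?a \<one> = wl (pw a)" "wd (inv h) \<one> = wl h" "wd (pw b) \<one> = wl (pw b)"
        using hc by simp_all
      have "gp \<one> (inv h) (pw b) \<le> R" using R[OF hi, of b] gp_sym[of "inv h" "pw b" \<one>] hc by simp
      then have b: "wl ?b \<ge> wl h + wl (pw b) - 2 * R"
        using gp_double[of \<one> "inv h" "pw b"] e2 s1 by linarith
      have g: "gp \<one> ?a ?b \<le> R + real \<delta> + R'"
      proof (cases "wl h \<le> L")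
        case True
        then have "h \<in> A" using h by (simp add: A_def)
        then show ?thesis using R'(2)[of h "- a" b] R0 delta_nonneg by linarith
      next
        case False
        have "gp h \<one> ?b = gp \<one> (inv h) (pw b)" using gp_left[of h \<one> "inv h" "pw b"] hc by simp
        then have "gp h \<one> ?b \<le> R" using \<open>gp \<one> (inv h) (pw b) \<le> R\<close> by simp
        moreover have "gp \<one> h ?b = wd \<one> h - gp h \<one> ?b" by (rule gp_swap) (use hc in auto)
        ultimately have far: "gp \<one> h ?b > R + real \<delta>" using False hc unfolding L_def wd_one_left[OF hc] by linarith
        have "gp \<one> ?a h \<ge> min (gp \<one> ?a ?b) (gp \<one> h ?b) - real \<delta>" by (rule hyp) (use hc in auto)
        then show ?thesis using far R[OF h(1), of "- a"] R'(1) by (auto simp: min_def split: if_splits)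
      qed
      show ?thesis
        using g b gp_double[of \<one> ?a ?b] L0 unfolding e1 s1 \<rho>_def by (simp add: algebra_simps)
    qed
  qed
qed

end

section \<open>A criterion for free products\<close>

fun pairs_prod :: "('a, 'b) monoid_scheme \<Rightarrow> ('a \<times> 'a) list \<Rightarrow> 'a" where
  "pairs_prod G [] = \<one>\<^bsub>G\<^esub>"
| "pairs_prod G (p # ws) = fst p \<otimes>\<^bsub>G\<^esub> snd p \<otimes>\<^bsub>G\<^esub> pairs_prod G ws"

text \<open>Only the first letter from \<open>H\<close> may be trivial. Nontriviality of the other
  letters is left to the choice of \<open>A\<close>, so that one notion serves both
  \<open>P - {\<one>}\<close> and the long powers of \<open>x\<close>.\<close>

definition reduced_pairs :: "'a \<Rightarrow> 'a set \<Rightarrow> 'a set \<Rightarrow> ('a \<times> 'a) list \<Rightarrow> bool" where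
  "reduced_pairs e A H ws \<longleftrightarrow> set ws \<subseteq> H \<times> A \<and> (\<forall>p\<in>set (tl ws). fst p \<noteq> e)"

lemma reduced_pairs_Nil [simp]: "reduced_pairs e A H []"
  by (simp add: reduced_pairs_def)

lemma reduced_pairs_tl: "reduced_pairs e A H (p # ws) \<Longrightarrow> reduced_pairs e A H ws"
  by (cases ws) (auto simp: reduced_pairs_def)

lemma reduced_pairs_Cons:
  assumes "reduced_pairs e A H ws" "h \<in> H" "a \<in> A" "ws = [] \<or> fst (hd ws) \<noteq> e"
  shows "reduced_pairs e A H ((h, a) # ws)"
  using assms by (cases ws) (auto simp: reduced_pairs_def)

lemma reduced_pairs_change_hd:
  assumes "reduced_pairs e A H ((h, a) # ws)" "h' \<in> H" "a' \<in> A"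
  shows "reduced_pairs e A H ((h', a') # ws)"
  using assms by (auto simp: reduced_pairs_def)

text \<open>The trailing letter \<open>h\<close>, possibly trivial, allows every word to be brought
  into this shape.\<close>

definition encode_pairs :: "('a \<times> 'a) list \<Rightarrow> 'a \<Rightarrow> ('a + 'a) list" where
  "encode_pairs ws h = concat (map (\<lambda>p. [Inr (fst p), Inl (snd p)]) ws) @ [Inr h]"

lemma encode_pairs_simps [simp]:
  "encode_pairs [] h = [Inr h]"
  "encode_pairs (p # ws) h = Inr (fst p) # Inl (snd p) # encode_pairs ws h"
  by (simp_all add: encode_pairs_def)

section \<open>Words over two subgroups and their normal forms\<close>

locale subgroup_pair = group +
  fixes P H
  assumes P: "subgroup P G" and H: "subgroup H G"
begin

definition words where "words = lists (Sum_Type.Plus P H)"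

abbreviation fp_rel where
  "fp_rel \<equiv> free_product_rel (G\<lparr>carrier := P\<rparr>) (G\<lparr>carrier := H\<rparr>)"
abbreviation ev where "ev \<equiv> eval_word G (\<lambda>a. a) (\<lambda>b. b)"

lemma words_simps [simp]: "[] \<in> words" "Inl a # w \<in> words \<longleftrightarrow> a \<in> P \<and> w \<in> words"
  "Inr b # w \<in> words \<longleftrightarrow> b \<in> H \<and> w \<in> words" "u @ v \<in> words \<longleftrightarrow> u \<in> words \<and> v \<in> words"
  by (auto simp: words_def)

lemma words_Cons: "l # w \<in> words \<longleftrightarrow> [l] \<in> words \<and> w \<in> words"
  by (cases l) auto

lemma P_carrier [simp]: "a \<in> P \<Longrightarrow> a \<in> carrier G" and H_carrier [simp]: "b \<in> H \<Longrightarrow> b \<in> carrier G"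
  using subgroup.mem_carrier[OF P] subgroup.mem_carrier[OF H] by auto

lemma P_closed [simp]: "\<one> \<in> P" "\<lbrakk>a \<in> P; a' \<in> P\<rbrakk> \<Longrightarrow> a \<otimes> a' \<in> P" "a \<in> P \<Longrightarrow> inv a \<in> P"
  using subgroup.one_closed[OF P] subgroup.m_closed[OF P] subgroup.m_inv_closed[OF P] by auto

lemma H_closed [simp]: "\<one> \<in> H" "\<lbrakk>a \<in> H; a' \<in> H\<rbrakk> \<Longrightarrow> a \<otimes> a' \<in> H" "a \<in> H \<Longrightarrow> inv a \<in> H"
  using subgroup.one_closed[OF H] subgroup.m_closed[OF H] subgroup.m_inv_closed[OF H] by auto

lemma rel_mult_left:
  "\<lbrakk>u \<in> words; v \<in> words; a \<in> P; a' \<in> P\<rbrakk> \<Longrightarrow> (u @ Inl a # Inl a' # v, u @ Inl (a \<otimes> a') # v) \<in> fp_rel"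
  using free_product_rel.mult_left[of u "G\<lparr>carrier := P\<rparr>" "G\<lparr>carrier := H\<rparr>" v a a'] by (simp add: words_def)

lemma rel_mult_right:
  "\<lbrakk>u \<in> words; v \<in> words; a \<in> H; a' \<in> H\<rbrakk> \<Longrightarrow> (u @ Inr a # Inr a' # v, u @ Inr (a \<otimes> a') # v) \<in> fp_rel"
  using free_product_rel.mult_right[of u "G\<lparr>carrier := P\<rparr>" "G\<lparr>carrier := H\<rparr>" v a a'] by (simp add: words_def)

lemma rel_one_left: "\<lbrakk>u \<in> words; v \<in> words\<rbrakk> \<Longrightarrow> (u @ Inl \<one> # v, u @ v) \<in> fp_rel"
  using free_product_rel.one_left[of u "G\<lparr>carrier := P\<rparr>" "G\<lparr>carrier := H\<rparr>" v] by (simp add: words_def)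

lemma rel_one_right: "\<lbrakk>u \<in> words; v \<in> words\<rbrakk> \<Longrightarrow> (u @ Inr \<one> # v, u @ v) \<in> fp_rel"
  using free_product_rel.one_right[of u "G\<lparr>carrier := P\<rparr>" "G\<lparr>carrier := H\<rparr>" v] by (simp add: words_def)

lemma rel_refl: "u \<in> words \<Longrightarrow> (u, u) \<in> fp_rel"
  using free_product_rel.refl[of u "G\<lparr>carrier := P\<rparr>" "G\<lparr>carrier := H\<rparr>"] by (simp add: words_def)

lemmas rel_sym = free_product_rel.sym[of _ _ "G\<lparr>carrier := P\<rparr>" "G\<lparr>carrier := H\<rparr>"]
lemmas rel_trans = free_product_rel.trans[of _ _ "G\<lparr>carrier := P\<rparr>" "G\<lparr>carrier := H\<rparr>"]

lemma ev_simps [simp]: "ev [] = \<one>" "ev (Inl a # w) = a \<otimes> ev w" "ev (Inr b # w) = b \<otimes> ev w"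
  by (simp_all add: eval_word_def)

lemma ev_closed [simp]: "w \<in> words \<Longrightarrow> ev w \<in> carrier G"
proof (induction w)
  case (Cons l w)
  then show ?case by (cases l) auto
qed simp

lemma ev_append: "\<lbrakk>u \<in> words; v \<in> words\<rbrakk> \<Longrightarrow> ev (u @ v) = ev u \<otimes> ev v"
proof (induction u)
  case (Cons l u)
  then show ?case by (cases l) (auto simp: m_assoc)
qed simp

lemma rel_words: "(u, v) \<in> fp_rel \<Longrightarrow> u \<in> words \<and> v \<in> words"
  by (induction rule: free_product_rel.induct) (auto simp: words_def)

lemma rel_ev: "(u, v) \<in> fp_rel \<Longrightarrow> ev u = ev v"
proof (induction rule: free_product_rel.induct)
  case (mult_left u v a a')
  then show ?case by (simp add: ev_append m_assoc flip: words_def)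
next
  case (mult_right u v a a')
  then show ?case by (simp add: ev_append m_assoc flip: words_def)
qed (auto simp: ev_append simp flip: words_def)

lemma rel_context: "(u, v) \<in> fp_rel \<Longrightarrow> x \<in> words \<Longrightarrow> y \<in> words \<Longrightarrow> (x @ u @ y, x @ v @ y) \<in> fp_rel"
proof (induction rule: free_product_rel.induct)
  case (mult_left u v a a')
  then show ?case using rel_mult_left[of "x @ u" "v @ y" a a'] by (simp flip: words_def)
next
  case (mult_right u v a a')
  then show ?case using rel_mult_right[of "x @ u" "v @ y" a a'] by (simp flip: words_def)
next
  case (one_left u v)
  then show ?case using rel_one_left[of "x @ u" "v @ y"] by (simp flip: words_def)
next
  case (one_right u v)
  then show ?case using rel_one_right[of "x @ u" "v @ y"] by (simp flip: words_def)
next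
  case (refl u)
  then show ?case using rel_refl[of "x @ u @ y"] by (simp flip: words_def)
next
  case (sym u v)
  then show ?case using rel_sym by blast
next
  case (trans u v w)
  then show ?case using rel_trans by blast
qed

lemma rel_append: "\<lbrakk>(u, u') \<in> fp_rel; (v, v') \<in> fp_rel\<rbrakk> \<Longrightarrow> (u @ v, u' @ v') \<in> fp_rel"
  using rel_context[of u u' "[]" v] rel_context[of v v' u' "[]"] rel_words rel_trans[of "u @ v" "u' @ v" "u' @ v'"]
  by simp

lemma encode_words:
  assumes "reduced_pairs \<one> (P - {\<one>}) H ws" "h \<in> H"
  shows "encode_pairs ws h \<in> words"
  using assms
proof (induction ws)
  case (Cons p ws)
  then have "encode_pairs ws h \<in> words" using reduced_pairs_tl[OF Cons.prems(1)] by simp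
  then show ?case using Cons.prems by (auto simp: reduced_pairs_def)
qed auto

text \<open>Letters are put in front one at a time. A letter of \<open>H\<close> merges with the
  head. A letter of \<open>P\<close> receives a trivial letter of \<open>H\<close> in front, unless
  the normal form already begins with one; then two letters of \<open>P\<close> meet, and if they
  cancel, the remaining pairs are reduced as they stand.\<close>

lemma normal_form:
  assumes "w \<in> words"
  shows "\<exists>ws h. reduced_pairs \<one> (P - {\<one>}) H ws \<and> h \<in> H \<and> (w, encode_pairs ws h) \<in> fp_rel"
  using assms
proof (induction w)
  case Nil
  have "([], [Inr \<one>]) \<in> fp_rel" using rel_sym[OF rel_one_right[of "[]" "[]"]] by simp
  then show ?case by (intro exI[of _ "[]"] exI[of _ \<one>]) simp
next
  case (Cons l w)
  then obtain ws h where ws: "reduced_pairs \<one> (P - {\<one>}) H ws" "h \<in> H" "(w, encode_pairs ws h) \<in> fp_rel"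
    using words_Cons[of l w] by auto
  have w: "encode_pairs ws h \<in> words" using encode_words ws by blast
  have l: "(l # w, l # encode_pairs ws h) \<in> fp_rel"
    using rel_context[OF ws(3), of "[l]" "[]"] Cons.prems words_Cons[of l w] by simp
  have "\<exists>ws' h'. reduced_pairs \<one> (P - {\<one>}) H ws' \<and> h' \<in> H \<and> (l # encode_pairs ws h, encode_pairs ws' h') \<in> fp_rel"
  proof (cases l)
    case (Inr b)
    then have b: "b \<in> H" using Cons.prems by auto
    show ?thesis
    proof (cases ws)
      case Nil
      have "(l # encode_pairs ws h, encode_pairs [] (b \<otimes> h)) \<in> fp_rel"
        using rel_mult_right[of "[]" "[]" b h] b ws(2) Inr Nil by simp
      then show ?thesis using b ws(2) by (intro exI[of _ "[]"] exI[of _ "b \<otimes> h"]) simp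
    next
      case (Cons p ws')
      obtain k a where p: "p = (k, a)" by (cases p)
      have ka: "k \<in> H" "a \<in> P - {\<one>}" using ws(1) Cons p by (auto simp: reduced_pairs_def)
      have "(l # encode_pairs ws h, encode_pairs ((b \<otimes> k, a) # ws') h) \<in> fp_rel"
        using rel_mult_right[of "[]" "Inl a # encode_pairs ws' h" b k] b w ka Inr Cons p by auto
      moreover have "reduced_pairs \<one> (P - {\<one>}) H ((b \<otimes> k, a) # ws')"
        by (rule reduced_pairs_change_hd[of _ _ _ k a]) (use ws(1) b ka in \<open>simp_all add: Cons p\<close>)
      ultimately show ?thesis using ws(2) by blast
    qed
  next
    case (Inl a)
    then have a: "a \<in> P" using Cons.prems by auto
    \<comment> \<open>Normal forms begin with a letter of \<open>H\<close>, so a leading letter of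
      \<open>P\<close> needs a trivial one before it.\<close>
    have push: "(Inl c # u, Inr \<one> # Inl c # u) \<in> fp_rel" if "c \<in> P" "u \<in> words" for c u
      using rel_sym[OF rel_one_right[of "[]" "Inl c # u"]] that by auto
    show ?thesis
    proof (cases "a = \<one>")
      case True
      have "(l # encode_pairs ws h, encode_pairs ws h) \<in> fp_rel"
        using rel_one_left[of "[]" "encode_pairs ws h"] w True Inl by simp
      then show ?thesis using ws by blast
    next
      case False
      show ?thesis
      proof (cases "ws = [] \<or> fst (hd ws) \<noteq> \<one>")
        case True
        have "reduced_pairs \<one> (P - {\<one>}) H ((\<one>, a) # ws)"
          using reduced_pairs_Cons[OF ws(1) _ _ True] a False by simp
        moreover have "(l # encode_pairs ws h, encode_pairs ((\<one>, a) # ws) h) \<in> fp_rel"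
          using push[OF a w] Inl by simp
        ultimately show ?thesis using ws(2) by blast
      next
        case hd1: False
        then obtain c ws' where wsc: "ws = (\<one>, c) # ws'" by (cases ws) auto
        have c: "c \<in> P" "c \<noteq> \<one>" using ws(1) wsc by (auto simp: reduced_pairs_def)
        have red: "reduced_pairs \<one> (P - {\<one>}) H ws'" using reduced_pairs_tl ws(1) unfolding wsc .
        have r: "encode_pairs ws' h \<in> words" using encode_words red ws(2) by blast
        have e1: "(l # encode_pairs ws h, Inl a # Inl c # encode_pairs ws' h) \<in> fp_rel"
          using rel_one_right[of "[Inl a]" "Inl c # encode_pairs ws' h"] a c r Inl wsc by auto
        have e2: "(Inl a # Inl c # encode_pairs ws' h, Inl (a \<otimes> c) # encode_pairs ws' h) \<in> fp_rel"
          using rel_mult_left[of "[]" "encode_pairs ws' h" a c] a c r by simp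
        have e12: "(l # encode_pairs ws h, Inl (a \<otimes> c) # encode_pairs ws' h) \<in> fp_rel"
          using rel_trans e1 e2 by blast
        show ?thesis
        proof (cases "a \<otimes> c = \<one>")
          case True
          have "(Inl (a \<otimes> c) # encode_pairs ws' h, encode_pairs ws' h) \<in> fp_rel"
            using rel_one_left[of "[]" "encode_pairs ws' h"] r True by simp
          then show ?thesis using rel_trans e12 red ws(2) by blast
        next
          case False
          have "reduced_pairs \<one> (P - {\<one>}) H ((\<one>, a \<otimes> c) # ws')"
            by (rule reduced_pairs_change_hd[of _ _ _ \<one> c]) (use ws(1) a c False in \<open>simp_all add: wsc\<close>)
          moreover have "(l # encode_pairs ws h, encode_pairs ((\<one>, a \<otimes> c) # ws') h) \<in> fp_rel"
            using rel_trans[OF e12 push[OF _ r]] a c by simp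
          ultimately show ?thesis using ws(2) by blast
        qed
      qed
    qed
  qed
  then show ?case using rel_trans l by blast
qed

lemma pairs_prod_closed: "set ws \<subseteq> H \<times> P \<Longrightarrow> pairs_prod G ws \<in> carrier G"
  by (induction ws) auto

lemma ev_encode:
  assumes "set ws \<subseteq> H \<times> P" "h \<in> H"
  shows "ev (encode_pairs ws h) = pairs_prod G ws \<otimes> h"
  using assms
proof (induction ws)
  case Nil
  then show ?case using H_carrier by simp
next
  case (Cons p ws)
  then show ?case using H_carrier[of "fst p"] P_carrier[of "snd p"] H_carrier[of h] pairs_prod_closed[of ws]
    by (auto simp: m_assoc)
qed

lemma ev_normal_form:
  assumes "w \<in> words"
  obtains ws h where "reduced_pairs \<one> (P - {\<one>}) H ws" "h \<in> H" "ev w = pairs_prod G ws \<otimes> h"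
proof -
  obtain ws h where ws: "reduced_pairs \<one> (P - {\<one>}) H ws" "h \<in> H" "(w, encode_pairs ws h) \<in> fp_rel"
    using normal_form[OF assms] by blast
  moreover have "set ws \<subseteq> H \<times> P" using ws(1) by (auto simp: reduced_pairs_def)
  ultimately show ?thesis using that rel_ev ev_encode by metis
qed

text \<open>The inverse in the free product at the level of words: the inverted letters in reverse
  order cancel from the inside outwards.\<close>

lemma left_inverse_word: "v \<in> words \<Longrightarrow> \<exists>v'\<in>words. (v' @ v, []) \<in> fp_rel"
proof (induction v)
  case Nil
  then show ?case using rel_refl[of "[]"] by (intro bexI[of _ "[]"]) auto
next
  case (Cons l v)
  then have v: "v \<in> words" using words_Cons[of l v] by auto
  then obtain v' where v': "v' \<in> words" "(v' @ v, []) \<in> fp_rel" using Cons.IH by auto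
  obtain l' where l': "[l'] \<in> words" "(v' @ l' # l # v, v' @ v) \<in> fp_rel"
  proof (cases l)
    case (Inl a)
    then have a: "a \<in> P" using Cons.prems by auto
    have m: "(v' @ Inl (inv a) # Inl a # v, v' @ Inl (inv a \<otimes> a) # v) \<in> fp_rel"
      by (rule rel_mult_left) (use a v v' in auto)
    have "(v' @ Inl (inv a \<otimes> a) # v, v' @ v) \<in> fp_rel"
      using rel_one_left v v' a P_carrier by simp
    from rel_trans[OF m this] show ?thesis using that[of "Inl (inv a)"] Inl a by simp
  next
    case (Inr a)
    then have a: "a \<in> H" using Cons.prems by auto
    have m: "(v' @ Inr (inv a) # Inr a # v, v' @ Inr (inv a \<otimes> a) # v) \<in> fp_rel"
      by (rule rel_mult_right) (use a v v' in auto)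
    have "(v' @ Inr (inv a \<otimes> a) # v, v' @ v) \<in> fp_rel"
      using rel_one_right v v' a H_carrier by simp
    from rel_trans[OF m this] show ?thesis using that[of "Inr (inv a)"] Inr a by simp
  qed
  have "((v' @ [l']) @ l # v, []) \<in> fp_rel" using rel_trans[OF l'(2) v'(2)] by simp
  then show ?case using v' l' by (intro bexI[of _ "v' @ [l']"]) auto
qed

text \<open>If \<open>v'\<close> is a left inverse word of \<open>v\<close>, then
  \<open>u @ v'\<close> evaluates to \<open>\<one>\<close>. A nonempty normal form of it would put a
  reduced product into \<open>H\<close>, so \<open>u @ v'\<close> is trivial modulo
  \<open>fp_rel\<close>, and \<open>u\<close> is equivalent to \<open>u @ v' @ v\<close>, hence to
  \<open>v\<close>.\<close>

lemma ev_eq_imp_rel: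
  assumes nontriv: "\<And>ws. \<lbrakk>reduced_pairs \<one> (P - {\<one>}) H ws; ws \<noteq> []\<rbrakk> \<Longrightarrow> pairs_prod G ws \<notin> H"
    and uv: "u \<in> words" "v \<in> words" "ev u = ev v"
  shows "(u, v) \<in> fp_rel"
proof -
  obtain v' where v': "v' \<in> words" "(v' @ v, []) \<in> fp_rel" using left_inverse_word uv by blast
  have "ev v' \<otimes> ev v = \<one>" using rel_ev[OF v'(2)] ev_append v'(1) uv by simp
  then have "ev v \<otimes> ev v' = \<one>" using inv_comm v'(1) uv by simp
  then have one: "ev (u @ v') = \<one>" using ev_append uv v'(1) by simp
  have uv': "u @ v' \<in> words" using uv v' by auto
  obtain ws h where ws: "reduced_pairs \<one> (P - {\<one>}) H ws" "h \<in> H" "(u @ v', encode_pairs ws h) \<in> fp_rel"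
    using normal_form[OF uv'] by blast
  have sub: "set ws \<subseteq> H \<times> P" using ws(1) by (auto simp: reduced_pairs_def)
  have e: "pairs_prod G ws \<otimes> h = \<one>" using rel_ev[OF ws(3)] one ev_encode[OF sub ws(2)] by simp
  then have "pairs_prod G ws = inv h" using pairs_prod_closed[OF sub] H_carrier[OF ws(2)] by (simp add: inv_equality inv_unique')
  then have "ws = []" using nontriv[OF ws(1)] ws(2) by fastforce
  then have "h = \<one>" using e H_carrier[OF ws(2)] by simp
  then have "(u @ v', []) \<in> fp_rel"
    using ws(3) \<open>ws = []\<close> rel_one_right[of "[]" "[]"] rel_trans by fastforce
  then have "((u @ v') @ v, [] @ v) \<in> fp_rel" using rel_append rel_refl uv by blast
  moreover have "(u @ [], u @ (v' @ v)) \<in> fp_rel"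
    using rel_append[OF rel_refl[OF uv(1)] rel_sym[OF v'(2)]] .
  ultimately show ?thesis using rel_trans[of u "u @ v' @ v" v] by simp
qed

text \<open>The criterion asks that reduced products avoid \<open>H\<close>, rather than only
  \<open>\<one>\<close>, because normal forms carry a trailing letter of \<open>H\<close>. As
  \<open>free_product_map\<close> uses \<open>the_elem\<close>, each class must also be seen to have
  a one-point image.\<close>

lemma canonically_free_productI:
  assumes nontriv: "\<And>ws. \<lbrakk>reduced_pairs \<one> (P - {\<one>}) H ws; ws \<noteq> []\<rbrakk> \<Longrightarrow> pairs_prod G ws \<notin> H"
    and C: "ev ` words = C"
  shows "canonically_free_product G P H C"
proof -
  let ?F = "free_product (G\<lparr>carrier := P\<rparr>) (G\<lparr>carrier := H\<rparr>)"
  let ?m = "free_product_map (G\<lparr>carrier := C\<rparr>) (\<lambda>a. a) (\<lambda>b. b)"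
  have carr: "carrier ?F = words // fp_rel" by (simp add: free_product_def words_def)
  have map: "?m (fp_rel `` {u}) = ev u" if u: "u \<in> words" for u
  proof -
    have "eval_word (G\<lparr>carrier := C\<rparr>) (\<lambda>a. a) (\<lambda>b. b) = ev" by (simp add: eval_word_def fun_eq_iff)
    moreover have "ev ` (fp_rel `` {u}) = {ev u}"
    proof (intro equalityI subsetI)
      fix y assume "y \<in> ev ` (fp_rel `` {u})"
      then obtain v where "(u, v) \<in> fp_rel" "y = ev v" by blast
      then show "y \<in> {ev u}" using rel_ev[of u v] by simp
    next
      fix y assume "y \<in> {ev u}"
      then show "y \<in> ev ` (fp_rel `` {u})" using rel_refl[OF u] by blast
    qed
    ultimately show ?thesis by (simp add: free_product_map_def)
  qed
  have cls: "fp_rel `` {u} = fp_rel `` {v}" if "(u, v) \<in> fp_rel" for u v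
  proof (rule Set.set_eqI)
    fix w show "w \<in> fp_rel `` {u} \<longleftrightarrow> w \<in> fp_rel `` {v}"
      using rel_trans[OF that, of w] rel_trans[OF rel_sym[OF that], of w] by auto
  qed
  have mult: "(fp_rel `` {u}) \<otimes>\<^bsub>?F\<^esub> (fp_rel `` {v}) = fp_rel `` {u @ v}" if "u \<in> words" "v \<in> words" for u v
  proof -
    have eq: "fp_rel `` {u' @ v'} = fp_rel `` {u @ v}" if "u' \<in> fp_rel `` {u}" "v' \<in> fp_rel `` {v}" for u' v'
      by (rule cls[OF rel_append, symmetric]) (use that in auto)
    have "u \<in> fp_rel `` {u}" "v \<in> fp_rel `` {v}" using rel_refl that by auto
    then have "(\<Union>u'\<in>fp_rel `` {u}. \<Union>v'\<in>fp_rel `` {v}. fp_rel `` {u @ v}) = fp_rel `` {u @ v}"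
      by auto
    moreover have "(\<Union>u'\<in>fp_rel `` {u}. \<Union>v'\<in>fp_rel `` {v}. fp_rel `` {u' @ v'})
        = (\<Union>u'\<in>fp_rel `` {u}. \<Union>v'\<in>fp_rel `` {v}. fp_rel `` {u @ v})"
      by (intro SUP_cong HOL.refl eq)
    ultimately have "(\<Union>u'\<in>fp_rel `` {u}. \<Union>v'\<in>fp_rel `` {v}. fp_rel `` {u' @ v'}) = fp_rel `` {u @ v}"
      by simp
    then show ?thesis by (simp add: free_product_def)
  qed
  have cases: "\<exists>u\<in>words. U = fp_rel `` {u}" if "U \<in> carrier ?F" for U
    by (rule quotientE[OF that[unfolded carr]]) blast
  have hom: "?m \<in> hom ?F (G\<lparr>carrier := C\<rparr>)"
  proof (rule homI)
    fix U assume "U \<in> carrier ?F"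
    then obtain u where "u \<in> words" "U = fp_rel `` {u}" using cases by blast
    then have "?m U \<in> C" using map C by blast
    then show "?m U \<in> carrier (G\<lparr>carrier := C\<rparr>)" by simp
  next
    fix U V assume "U \<in> carrier ?F" "V \<in> carrier ?F"
    then obtain u v where uv: "u \<in> words" "U = fp_rel `` {u}" "v \<in> words" "V = fp_rel `` {v}"
      using cases by meson
    have "u @ v \<in> words" using uv by auto
    then show "?m (U \<otimes>\<^bsub>?F\<^esub> V) = ?m U \<otimes>\<^bsub>G\<lparr>carrier := C\<rparr>\<^esub> ?m V"
      using uv mult map ev_append by simp
  qed
  have "bij_betw ?m (carrier ?F) (carrier (G\<lparr>carrier := C\<rparr>))"
  proof (rule bij_betw_imageI)
    show "inj_on ?m (carrier ?F)"
    proof (rule inj_onI)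
      fix U V assume UV: "U \<in> carrier ?F" "V \<in> carrier ?F" "?m U = ?m V"
      then obtain u v where uv: "u \<in> words" "U = fp_rel `` {u}" "v \<in> words" "V = fp_rel `` {v}"
        using cases by meson
      then have "ev u = ev v" using UV(3) map by simp
      then show "U = V" using uv cls ev_eq_imp_rel[OF nontriv] by simp
    qed
    have "?m ` carrier ?F = ev ` words"
    proof
      show "?m ` carrier ?F \<subseteq> ev ` words"
      proof (rule image_subsetI)
        fix U assume "U \<in> carrier ?F"
        then obtain u where "u \<in> words" "U = fp_rel `` {u}" using cases by blast
        then show "?m U \<in> ev ` words" using map by blast
      qed
      have "fp_rel `` {u} \<in> carrier ?F" if "u \<in> words" for u unfolding carr using that by (rule quotientI)
      then show "ev ` words \<subseteq> ?m ` carrier ?F" using map by (intro image_subsetI) (metis image_eqI)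
    qed
    then show "?m ` carrier ?F = carrier (G\<lparr>carrier := C\<rparr>)" using C by simp
  qed
  then show ?thesis using hom by (simp add: canonically_free_product_def iso_def)
qed

end

section \<open>Products alternating between a subgroup and long powers\<close>

text \<open>\<open>\<rho>\<close> is the constant of \<open>subgroup_axis_constant\<close>, and
  \<open>t0\<close> comes from \<open>pw_tends\<close>. The factor 20 lets a single \<open>r\<close>
  dominate the sums of error terms in all later estimates.\<close>

locale axis_pair = loxodromic +
  fixes H \<rho> r and t0 :: nat
  assumes H_sub: "subgroup H G" and rho_nonneg: "0 \<le> \<rho>"
    and rho_axis: "\<And>h s. h \<in> H \<Longrightarrow> gp \<one> (pw s) h \<le> \<rho>"
    and rho_triple: "\<And>h a b. \<lbrakk>h \<in> H; h \<noteq> \<one>\<rbrakk> \<Longrightarrow>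
      wl (pw a \<otimes> h \<otimes> pw b) \<ge> wl (pw a) + wl h + wl (pw b) - 2 * \<rho>"
    and r_big: "20 * (\<rho> + axis_const + real \<delta> + 1) \<le> r"
    and t0_pos: "0 < t0" and t0_long: "\<And>i. int t0 \<le> \<bar>i\<bar> \<Longrightarrow> wl (pw i) > 15 * r"
begin

definition long_powers where "long_powers = {pw i |i. int t0 \<le> \<bar>i\<bar>}"

lemma H_carrier [simp]: "h \<in> H \<Longrightarrow> h \<in> carrier G"
  by (rule subgroup.mem_carrier[OF H_sub])

lemma H_inv [simp]: "h \<in> H \<Longrightarrow> inv h \<in> H" and H_mult [simp]: "\<lbrakk>h \<in> H; k \<in> H\<rbrakk> \<Longrightarrow> h \<otimes> k \<in> H"
  and H_one [simp]: "\<one> \<in> H"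
  using subgroup.m_inv_closed[OF H_sub] subgroup.m_closed[OF H_sub] subgroup.one_closed[OF H_sub] by auto

lemma long_carrier [simp]: "g \<in> long_powers \<Longrightarrow> g \<in> carrier G"
  by (auto simp: long_powers_def)

lemma long_wl: "g \<in> long_powers \<Longrightarrow> wl g > 15 * r"
  using t0_long by (auto simp: long_powers_def)

lemma long_pw: "g \<in> long_powers \<Longrightarrow> \<exists>a. g = pw a"
  by (auto simp: long_powers_def)

lemma r_pos: "20 \<le> r" "20 * \<rho> \<le> r" "20 * real \<delta> \<le> r" "20 * axis_const \<le> r"
  using r_big rho_nonneg delta_nonneg axis_const_nonneg by auto

lemma wl_H_pw:
  assumes "h \<in> H"
  shows "wl (h \<otimes> pw a) \<ge> wl h + wl (pw a) - 2 * \<rho>"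
proof -
  have "wl (h \<otimes> pw a) = wd (inv h) (pw a)" using assms by (simp add: word_dist_def)
  moreover have "gp \<one> (pw a) (inv h) \<le> \<rho>" using rho_axis assms by simp
  moreover have "gp \<one> (pw a) (inv h) = gp \<one> (inv h) (pw a)" using assms by (intro gp_sym) auto
  moreover have "wd (inv h) \<one> = wl h" "wd (pw a) \<one> = wl (pw a)" using assms by simp_all
  ultimately show ?thesis using gp_double[of \<one> "inv h" "pw a"] by linarith
qed

text \<open>\<open>rho_triple\<close>, or \<open>rho_axis\<close> if \<open>g' = \<one>\<close>,
  bounds the product of \<open>inv g\<close> and \<open>k g'\<close>. As \<open>g\<close> is long,
  \<open>inv g\<close> and \<open>inv (h g)\<close> have a large product at \<open>\<one>\<close>,
  and \<open>hyp\<close> exchanges them. The case \<open>g' = \<one>\<close> is the corner before a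
  final factor from \<open>H\<close>, which may be trivial.\<close>

lemma corner:
  assumes h: "h \<in> H" "g \<in> long_powers" and k: "k \<in> H" and g': "k \<noteq> \<one> \<and> g' = pw b \<or> g' = \<one>"
  shows "gp \<one> (inv (h \<otimes> g)) (k \<otimes> g') \<le> \<rho> + real \<delta>"
proof -
  obtain a where a: "g = pw a" using long_pw h(2) by blast
  have ca: "g \<in> carrier G" "h \<in> carrier G" "k \<in> carrier G" "g' \<in> carrier G" using h k g' by auto
  have g1: "gp \<one> (inv g) (k \<otimes> g') \<le> \<rho>"
  proof (cases "g' = \<one>")
    case True
    then show ?thesis using rho_axis[OF k, of "- a"] ca by (simp add: a pw_minus)
  next
    case False
    then have k1: "k \<noteq> \<one>" "g' = pw b" using g' by auto
    have "wd (inv g) (k \<otimes> g') = wl (g \<otimes> k \<otimes> g')" using ca by (simp add: word_dist_def m_assoc)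
    moreover have "wl (g \<otimes> k \<otimes> g') \<ge> wl g + wl k + wl g' - 2 * \<rho>"
      using rho_triple[OF k k1(1)] by (simp add: a k1)
    moreover have "wl (k \<otimes> g') \<le> wl k + wl g'" using wl_mult ca by simp
    moreover have "wd (inv g) \<one> = wl g" "wd (k \<otimes> g') \<one> = wl (k \<otimes> g')" using ca by simp_all
    ultimately show ?thesis using gp_double[of \<one> "inv g" "k \<otimes> g'"] by linarith
  qed
  have "gp (inv g) \<one> (inv (h \<otimes> g)) = gp \<one> g (inv h)"
    using gp_left[of "inv g" \<one> g "inv h"] ca by (simp add: inv_mult_group)
  also have "\<dots> \<le> \<rho>" using rho_axis[of "inv h" a] h by (simp add: a)
  finally have "gp (inv g) \<one> (inv (h \<otimes> g)) \<le> \<rho>" .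
  moreover have "gp \<one> (inv g) (inv (h \<otimes> g)) = wd \<one> (inv g) - gp (inv g) \<one> (inv (h \<otimes> g))"
    by (rule gp_swap) (use ca in auto)
  moreover have "wd \<one> (inv g) = wl g" using ca by simp
  ultimately have far: "gp \<one> (inv g) (inv (h \<otimes> g)) > \<rho> + real \<delta>" using long_wl[OF h(2)] r_pos by linarith
  have "gp \<one> (inv g) (k \<otimes> g') \<ge> min (gp \<one> (inv g) (inv (h \<otimes> g))) (gp \<one> (k \<otimes> g') (inv (h \<otimes> g))) - real \<delta>"
    by (rule hyp) (use ca in auto)
  moreover have "gp \<one> (k \<otimes> g') (inv (h \<otimes> g)) = gp \<one> (inv (h \<otimes> g)) (k \<otimes> g')"
    by (rule gp_sym) (use ca in auto)
  ultimately show ?thesis using far g1 by (auto simp: min_def split: if_splits)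
qed

section \<open>Alternating products as broken geodesics\<close>

definition alt :: "nat \<Rightarrow> (nat \<Rightarrow> 'a) \<Rightarrow> (nat \<Rightarrow> 'a) \<Rightarrow> bool" where
  "alt n hs gs \<longleftrightarrow> (\<forall>i\<in>{1..n}. hs i \<in> H \<and> gs i \<in> long_powers) \<and> (\<forall>i. 1 < i \<and> i \<le> n \<longrightarrow> hs i \<noteq> \<one>)"

abbreviation ap where "ap \<equiv> alternating_product G"

lemma ap_closed: "alt n hs gs \<Longrightarrow> j \<le> n \<Longrightarrow> ap hs gs j \<in> carrier G"
  by (induction j) (auto simp: alt_def)

declare alternating_product.simps(2) [simp del]

lemma ap_Suc: "\<lbrakk>alt n hs gs; Suc j \<le> n\<rbrakk> \<Longrightarrow> ap hs gs (Suc j) = ap hs gs j \<otimes> (hs (Suc j) \<otimes> gs (Suc j))"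
  using ap_closed[of n hs gs j] by (auto simp: alt_def m_assoc alternating_product.simps(2))

lemma alt_edge:
  assumes alt: "alt n hs gs" "Suc j \<le> n"
  shows "wd (ap hs gs j) (ap hs gs (Suc j)) \<ge> wl (hs (Suc j)) + wl (gs (Suc j)) - 2 * \<rho>"
proof -
  have c: "hs (Suc j) \<in> H" "gs (Suc j) \<in> long_powers" using alt by (auto simp: alt_def)
  obtain a where a: "gs (Suc j) = pw a" using long_pw c by blast
  have "wd (ap hs gs j) (ap hs gs (Suc j)) = wl (hs (Suc j) \<otimes> gs (Suc j))"
    using ap_closed[OF alt(1), of j] alt(2) c unfolding ap_Suc[OF alt] by simp
  then show ?thesis using wl_H_pw[OF c(1), of a] a by simp
qed

lemma alt_corner:
  assumes alt: "alt n hs gs" and j: "0 < j" "j \<le> n" and k: "k \<in> H" and g': "k \<noteq> \<one> \<and> g' = pw b \<or> g' = \<one>"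
  shows "gp (ap hs gs j) (ap hs gs (j - 1)) (ap hs gs j \<otimes> (k \<otimes> g')) \<le> \<rho> + real \<delta>"
proof -
  obtain i where i: "j = Suc i" using j by (cases j) auto
  let ?s = "hs (Suc i) \<otimes> gs (Suc i)"
  have c: "hs (Suc i) \<in> H" "gs (Suc i) \<in> long_powers" using alt j i by (auto simp: alt_def)
  have ac: "ap hs gs i \<in> carrier G" "ap hs gs (Suc i) \<in> carrier G" "?s \<in> carrier G"
    using ap_closed[OF alt] j i c by auto
  have kc: "k \<otimes> g' \<in> carrier G" using k g' by auto
  have S: "ap hs gs (Suc i) = ap hs gs i \<otimes> ?s" using ap_Suc[OF alt] j i by simp
  have prev: "ap hs gs i = ap hs gs (Suc i) \<otimes> inv ?s"
    unfolding S using ac by (simp only: m_assoc r_inv inv_closed r_one)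
  have "gp (ap hs gs (Suc i)) (ap hs gs i) (ap hs gs (Suc i) \<otimes> (k \<otimes> g'))
      = gp (ap hs gs (Suc i) \<otimes> \<one>) (ap hs gs (Suc i) \<otimes> inv ?s) (ap hs gs (Suc i) \<otimes> (k \<otimes> g'))"
    using prev ac by simp
  also have "\<dots> = gp \<one> (inv ?s) (k \<otimes> g')" using ac kc by (intro gp_left) auto
  also have "\<dots> \<le> \<rho> + real \<delta>" by (rule corner[OF c k g'])
  finally show ?thesis by (simp only: i diff_Suc_1)
qed

lemma alt_corner_inner:
  assumes alt: "alt n hs gs" and j: "0 < j" "j < n"
  shows "gp (ap hs gs j) (ap hs gs (j - 1)) (ap hs gs (j + 1)) \<le> \<rho> + real \<delta>"
proof -
  have k: "hs (Suc j) \<in> H" "hs (Suc j) \<noteq> \<one>" "gs (Suc j) \<in> long_powers" using alt j by (auto simp: alt_def)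
  obtain b where b: "gs (Suc j) = pw b" using long_pw k(3) by blast
  have S: "ap hs gs (j + 1) = ap hs gs j \<otimes> (hs (Suc j) \<otimes> gs (Suc j))" using ap_Suc[OF alt] j by simp
  have "hs (Suc j) \<noteq> \<one> \<and> gs (Suc j) = pw b \<or> gs (Suc j) = \<one>" using k b by simp
  from alt_corner[OF alt j(1) _ k(1) this] j show ?thesis unfolding S by simp
qed

lemma alt_edge_long:
  assumes alt: "alt n hs gs" and j: "0 < j" "j \<le> n"
  shows "wd (ap hs gs (j - 1)) (ap hs gs j) > 2 * (\<rho> + real \<delta>) + 3 * real \<delta>"
proof -
  obtain i where i: "j = Suc i" using j by (cases j) auto
  have "gs (Suc i) \<in> long_powers" using alt j i by (auto simp: alt_def)
  from long_wl[OF this] have "wd (ap hs gs i) (ap hs gs (Suc i)) > 2 * \<rho> + 5 * real \<delta>"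
    using alt_edge[OF alt j(2)[unfolded i]] r_pos wl_nonneg[of "hs (Suc i)"] by linarith
  then show ?thesis by (simp add: i)
qed

text \<open>By \<open>chain\<close> the product at the last vertex but one is at most
  \<open>\<rho> + 3 * \<delta>\<close>, and the last edge loses \<open>2 * \<rho>\<close>. The total
  loss \<open>4 * \<rho> + 6 * \<delta>\<close> is below \<open>5 * r\<close>.\<close>

lemma alt_growth:
  assumes alt: "alt n hs gs" and n: "1 \<le> n"
  shows "wl (ap hs gs n) \<ge> wl (ap hs gs (n - 1)) + wl (hs n) + wl (gs n) - 5 * r"
proof -
  obtain m where m: "n = Suc m" using n by (cases n) auto
  have c: "ap hs gs m \<in> carrier G" "ap hs gs n \<in> carrier G" using ap_closed[OF alt] m by auto
  have "gp (ap hs gs m) \<one> (ap hs gs n) \<le> \<rho> + 3 * real \<delta>"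
  proof (cases "m = 0")
    case True
    then show ?thesis using rho_nonneg delta_nonneg c by (simp add: gromov_product_def)
  next
    case False
    have "gp (ap hs gs m) (ap hs gs 0) (ap hs gs n) \<le> (\<rho> + real \<delta>) + 2 * real \<delta>"
      by (rule chain) (use ap_closed[OF alt] alt_corner_inner[OF alt] alt_edge_long[OF alt] m False in auto)
    then show ?thesis by simp
  qed
  moreover have "wd (ap hs gs m) (ap hs gs n) \<ge> wl (hs n) + wl (gs n) - 2 * \<rho>"
    using alt_edge[OF alt, of m] m by simp
  moreover have "wd \<one> (ap hs gs m) = wl (ap hs gs m)" "wd (ap hs gs n) (ap hs gs m) = wd (ap hs gs m) (ap hs gs n)"
    "wd \<one> (ap hs gs n) = wl (ap hs gs n)"
    using c wd_sym[OF c(2,1)] by simp_all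
  ultimately have "wl (ap hs gs n) \<ge> wl (ap hs gs m) + wl (hs n) + wl (gs n) - 5 * r"
    using gp_double[of "ap hs gs m" \<one> "ap hs gs n"] r_pos by linarith
  then show ?thesis by (simp add: m)
qed

text \<open>The final factor \<open>h\<close> is appended as one more vertex. It may be trivial,
  since \<open>chain\<close> asks nothing of the last edge.\<close>

lemma alt_chain:
  assumes alt: "alt n hs gs" and h: "h \<in> H" and j: "0 < j" "j \<le> n"
  shows "gp (ap hs gs j) \<one> (ap hs gs n \<otimes> h) \<le> \<rho> + 3 * real \<delta>"
proof -
  define v where "v i = (if i \<le> n then ap hs gs i else ap hs gs n \<otimes> h)" for i
  have "gp (v j) (v 0) (v (Suc n)) \<le> (\<rho> + real \<delta>) + 2 * real \<delta>"
  proof (rule chain)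
    show "v i \<in> carrier G" for i using ap_closed[OF alt] h by (simp add: v_def)
    show "gp (v i) (v (i - 1)) (v (i + 1)) \<le> \<rho> + real \<delta>" if i: "0 < i" "i < Suc n" for i
    proof (cases "i = n")
      case True
      then show ?thesis using alt_corner[OF alt, of n h \<one>] i h by (simp add: v_def)
    next
      case False
      then have "i < n" "i - 1 \<le> n" "i + 1 \<le> n" "i \<le> n" using i by auto
      then show ?thesis using alt_corner_inner[OF alt, of i] i unfolding v_def by (simp only: if_True)
    qed
    show "wd (v (i - 1)) (v i) > 2 * (\<rho> + real \<delta>) + 3 * real \<delta>" if "1 < i" "i < Suc n" for i
    proof -
      have "i - 1 \<le> n" "i \<le> n" "0 < i" using that by auto
      then show ?thesis using alt_edge_long[OF alt, of i] unfolding v_def by (simp only: if_True)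
    qed
  qed (use j in auto)
  then show ?thesis using j by (simp add: v_def)
qed

lemma pairs_prod_closed: "set ws \<subseteq> H \<times> long_powers \<Longrightarrow> pairs_prod G ws \<in> carrier G"
  by (induction ws) auto

lemma pairs_prod_append:
  assumes "set us \<subseteq> H \<times> long_powers" "set ws \<subseteq> H \<times> long_powers"
  shows "pairs_prod G (us @ ws) = pairs_prod G us \<otimes> pairs_prod G ws"
  using assms
proof (induction us)
  case (Cons p us)
  then show ?case using pairs_prod_closed[of us] pairs_prod_closed[of ws]
    by (auto simp: m_assoc)
qed (simp add: pairs_prod_closed)

text \<open>Lists are indexed from 0 and alternating products from 1, hence the shift by
  one.\<close>

lemma ap_pairs:
  assumes "set ws \<subseteq> H \<times> long_powers" "j \<le> length ws"
  shows "ap (\<lambda>i. fst (ws ! (i - 1))) (\<lambda>i. snd (ws ! (i - 1))) j = pairs_prod G (take j ws)"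
  using assms(2)
proof (induction j)
  case (Suc j)
  have t: "take (Suc j) ws = take j ws @ [ws ! j]" using Suc.prems by (simp add: take_Suc_conv_app_nth)
  have "ws ! j \<in> set ws" using Suc.prems by simp
  then have sub: "set (take j ws) \<subseteq> H \<times> long_powers" "set [ws ! j] \<subseteq> H \<times> long_powers"
    using assms(1) set_take_subset[of j ws] by auto
  have c: "fst (ws ! j) \<in> carrier G" "snd (ws ! j) \<in> carrier G" using sub(2) by auto
  show ?case using Suc pairs_prod_append[OF sub] pairs_prod_closed[OF sub(1)] c by (simp add: t m_assoc alternating_product.simps(2))
qed simp

lemma alt_pairs:
  assumes "reduced_pairs \<one> long_powers H ws"
  shows "alt (length ws) (\<lambda>i. fst (ws ! (i - 1))) (\<lambda>i. snd (ws ! (i - 1)))"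
  unfolding alt_def
proof (intro conjI ballI allI impI)
  fix i assume "i \<in> {1..length ws}"
  then have "ws ! (i - 1) \<in> set ws" by auto
  then have "ws ! (i - 1) \<in> H \<times> long_powers" using assms by (auto simp: reduced_pairs_def)
  then show "fst (ws ! (i - 1)) \<in> H" "snd (ws ! (i - 1)) \<in> long_powers" by auto
next
  fix i assume i: "1 < i \<and> i \<le> length ws"
  then have "ws ! (i - 1) = tl ws ! (i - 2)" "i - 2 < length (tl ws)" by (auto simp: nth_tl numeral_2_eq_2 Suc_diff_Suc)
  then have "ws ! (i - 1) \<in> set (tl ws)" by simp
  then show "fst (ws ! (i - 1)) \<noteq> \<one>" using assms by (auto simp: reduced_pairs_def)
qed

text \<open>Absorbing an element of \<open>H\<close> into the first letter reduces the claim to \<open>pairs_prod G ws \<noteq> \<one>\<close>.\<close>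

lemma reduced_nontrivial:
  assumes red: "reduced_pairs \<one> long_powers H ws" and ne: "ws \<noteq> []"
  shows "pairs_prod G ws \<notin> H"
proof
  assume k: "pairs_prod G ws \<in> H"
  obtain h a us where ws: "ws = (h, a) # us" using ne by (cases ws) auto
  define vs where "vs = (inv (pairs_prod G ws) \<otimes> h, a) # us"
  have ha: "h \<in> H" "a \<in> long_powers" "set us \<subseteq> H \<times> long_powers" using red ws by (auto simp: reduced_pairs_def)
  have redv: "reduced_pairs \<one> long_powers H vs"
    unfolding vs_def by (rule reduced_pairs_change_hd[of _ _ _ h a]) (use red ws ha k in auto)
  have sub: "set vs \<subseteq> H \<times> long_powers" using redv by (auto simp: reduced_pairs_def)
  have "pairs_prod G vs = inv (pairs_prod G ws) \<otimes> pairs_prod G ws"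
    using k ha pairs_prod_closed[OF ha(3)] unfolding vs_def by (simp add: ws m_assoc)
  then have one: "pairs_prod G vs = \<one>" using k by simp
  let ?hs = "\<lambda>i. fst (vs ! (i - 1))" and ?gs = "\<lambda>i. snd (vs ! (i - 1))"
  let ?n = "length vs"
  have n1: "1 \<le> ?n" by (simp add: vs_def)
  have alt: "alt ?n ?hs ?gs" by (rule alt_pairs[OF redv])
  then have "?gs ?n \<in> long_powers" using n1 unfolding alt_def by auto
  from long_wl[OF this] have "wl (?gs ?n) > 15 * r" .
  \<comment> \<open>The last factor alone is longer than \<open>15 * r\<close>, of which at most
    \<open>5 * r\<close> is lost.\<close>
  then have "wl (ap ?hs ?gs ?n) > 0"
    using alt_growth[OF alt n1] r_pos wl_nonneg[of "?hs ?n"] wl_nonneg[of "ap ?hs ?gs (?n - 1)"] by linarith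
  moreover have "ap ?hs ?gs ?n = \<one>" using ap_pairs[OF sub order_refl] one by simp
  ultimately show False by simp
qed

section \<open>The subgroup generated by a long power of x and H\<close>

lemma generate_pw: "generate G {pw (int t)} = {pw (int t * k) |k. True}"
  using generate_pow[of "pw (int t)"] by (auto simp: pw_mult)

lemma generate_pw_long:
  assumes "t0 \<le> t" "g \<in> generate G {pw (int t)} - {\<one>}"
  shows "g \<in> long_powers"
proof -
  obtain k where k: "g = pw (int t * k)" using assms(2) generate_pw by auto
  have "k \<noteq> 0" using k assms(2) by (auto intro: ccontr)
  then have "int t * 1 \<le> int t * \<bar>k\<bar>" by (intro mult_left_mono) auto
  then have "int t0 \<le> \<bar>int t * k\<bar>" using assms(1) by (simp add: abs_mult)
  then show ?thesis using k by (auto simp: long_powers_def)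
qed

lemma reduced_generate_long:
  assumes "t0 \<le> t" "reduced_pairs \<one> (generate G {pw (int t)} - {\<one>}) H ws"
  shows "reduced_pairs \<one> long_powers H ws"
  using assms generate_pw_long[OF assms(1)] unfolding reduced_pairs_def by blast

lemma generate_words:
  assumes "subgroup_pair G P H" and P: "P = generate G {pw (int t)}"
  shows "eval_word G (\<lambda>a. a) (\<lambda>b. b) ` subgroup_pair.words P H = generate G (insert (pw (int t)) H)"
proof -
  interpret sp: subgroup_pair G P H by fact
  let ?C = "generate G (insert (pw (int t)) H)"
  have sub: "subgroup ?C G" by (rule generate_is_subgroup) auto
  have HC: "H \<subseteq> ?C" by (auto intro: generate.incl)
  have PC: "P \<subseteq> ?C" unfolding P by (rule mono_generate) auto
  have "sp.ev w \<in> ?C" if "w \<in> sp.words" for w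
    using that
  proof (induction w)
    case Nil
    then show ?case using subgroup.one_closed[OF sub] by simp
  next
    case (Cons l w)
    then show ?case using HC PC subgroup.m_closed[OF sub] by (cases l) auto
  qed
  moreover have "y \<in> sp.ev ` sp.words" if "y \<in> ?C" for y
    using that
  proof induction
    case one
    then show ?case by (intro image_eqI[of _ _ "[]"]) auto
  next
    case (incl h)
    show ?case
    proof (cases "h \<in> H")
      case True
      then show ?thesis by (intro image_eqI[of _ _ "[Inr h]"]) auto
    next
      case False
      then have "h \<in> P" using incl unfolding P by (auto intro: generate.incl)
      then show ?thesis by (intro image_eqI[of _ _ "[Inl h]"]) auto
    qed
  next
    case (inv h)
    show ?case
    proof (cases "h \<in> H")
      case True
      then show ?thesis by (intro image_eqI[of _ _ "[Inr (inv h)]"]) auto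
    next
      case False
      then have "h \<in> P" using inv unfolding P by (auto intro: generate.incl)
      then show ?thesis by (intro image_eqI[of _ _ "[Inl (inv h)]"]) auto
    qed
  next
    case (eng a b)
    then obtain u v where "u \<in> sp.words" "a = sp.ev u" "v \<in> sp.words" "b = sp.ev v" by blast
    then show ?case by (intro image_eqI[of _ _ "u @ v"]) (auto simp: sp.ev_append)
  qed
  ultimately show ?thesis by blast
qed

lemma subgroup_pair: "subgroup_pair G (generate G {pw (int t)}) H"
  by (intro subgroup_pair.intro subgroup_pair_axioms.intro is_group H_sub generate_is_subgroup) simp

lemma free_product:
  assumes t: "t0 \<le> t"
  shows "canonically_free_product G (generate G {pw (int t)}) H (generate G (insert (pw (int t)) H))"
proof -
  interpret sp: subgroup_pair G "generate G {pw (int t)}" H by (rule subgroup_pair)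
  show ?thesis
  proof (rule sp.canonically_free_productI)
    show "pairs_prod G ws \<notin> H"
      if "reduced_pairs \<one> (generate G {pw (int t)} - {\<one>}) H ws" "ws \<noteq> []" for ws
      by (rule reduced_nontrivial[OF reduced_generate_long[OF t that(1)] that(2)])
    show "sp.ev ` sp.words = generate G (insert (pw (int t)) H)"
      by (rule generate_words[OF subgroup_pair]) simp
  qed
qed

lemma generated_normal_form:
  assumes "w \<in> generate G (insert (pw (int t)) H)"
  obtains ws h where "reduced_pairs \<one> (generate G {pw (int t)} - {\<one>}) H ws" "h \<in> H"
    "w = pairs_prod G ws \<otimes> h"
proof -
  interpret sp: subgroup_pair G "generate G {pw (int t)}" H by (rule subgroup_pair)
  obtain u where "u \<in> sp.words" "w = sp.ev u" using generate_words[OF subgroup_pair, of _ t] assms by blast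
  then show ?thesis using that sp.ev_normal_form[of u] by metis
qed

text \<open>Finite index would put some \<open>e^a\<close> with \<open>a \<noteq> 0\<close> into the
  subgroup. Multiplying its normal form by the opposite power of \<open>e\<close> gives a product in
  \<open>H\<close> that is reduced up to a merging at the junction, against
  \<open>reduced_nontrivial\<close>. For trivial \<open>H\<close> there is no \<open>k\<close> to
  build \<open>e\<close> from; then the subgroup is cyclic and \<open>G\<close> would be
  elementary.\<close>

lemma infinite_index:
  assumes t: "3 * t0 \<le> t" and ne: "\<not> elementary_group G"
  shows "infinite (rcosets (generate G (insert (pw (int t)) H)))"
proof
  let ?g = "pw (int t)"
  let ?C = "generate G (insert ?g H)" and ?P = "generate G {?g}"
  assume fin: "finite (rcosets ?C)"
  have subC: "subgroup ?C G" by (rule generate_is_subgroup) auto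
  show False
  proof (cases "H = {\<one>}")
    case True
    have "?C \<subseteq> ?P"
    proof (rule generate_subgroup_incl)
      show "subgroup ?P G" by (rule generate_is_subgroup) auto
      then show "insert ?g H \<subseteq> ?P" using True subgroup.one_closed generate.incl by fastforce
    qed
    moreover have "?P \<subseteq> ?C" by (rule mono_generate) auto
    ultimately have "?C = ?P" by blast
    also have "\<dots> = range (\<lambda>n::int. ?g [^] n)" using generate_pow[of ?g] by auto
    finally have e: "?C = range (\<lambda>n::int. ?g [^] n)" .
    have "cyclic_group (G\<lparr>carrier := ?C\<rparr>)" unfolding e by (rule cyclic_range_int_pow) simp
    then show False using ne subC fin unfolding elementary_group_def by blast
  next
    case False
    then obtain k where k: "k \<in> H" "k \<noteq> \<one>" using H_one by blast
    define s where "s = - int t0"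
    define e where "e = k \<otimes> pw s"
    have ec: "e \<in> carrier G" using k by (simp add: e_def)
    have "(\<lambda>i::int. ?C #> e [^] i) ` UNIV \<subseteq> rcosets ?C"
      using ec by (auto simp: RCOSETS_def)
    then have "finite ((\<lambda>i::int. ?C #> e [^] i) ` UNIV)" using fin finite_subset by blast
    then obtain a :: int where a: "a \<noteq> 0" "e [^] a \<in> ?C"
      using finite_rcosets_imp_power_mem[OF subC _ ec] by blast
    define m where "m = nat \<bar>a\<bar>"
    have m0: "0 < m" using a by (simp add: m_def)
    have eq: "e [^] m \<otimes> inv (e [^] m) = \<one>" using ec by simp
    \<comment> \<open>Fixes the sign: a positive power \<open>e^m\<close> is spelled by
      \<open>m\<close> copies of \<open>(k, pw s)\<close>, and the normal form is taken of its
      inverse.\<close>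
    have "inv (e [^] m) \<in> ?C"
    proof (cases "a > 0")
      case True
      then have "a = int m" by (simp add: m_def)
      then have "e [^] a = e [^] m" by (simp only: int_pow_int)
      then show ?thesis using a subgroup.m_inv_closed[OF subC] by simp
    next
      case False
      then have "a = - int m" using a(1) by (simp add: m_def)
      then have "e [^] a = inv (e [^] m)" by (simp only: int_pow_neg_int[OF ec])
      then show ?thesis using a by simp
    qed
    then obtain ws h where ws: "reduced_pairs \<one> (?P - {\<one>}) H ws" "h \<in> H"
      "inv (e [^] m) = pairs_prod G ws \<otimes> h" by (rule generated_normal_form)
    have tt: "t0 \<le> t" using t by simp
    have redw: "reduced_pairs \<one> long_powers H ws" by (rule reduced_generate_long[OF tt ws(1)])
    have subw: "set ws \<subseteq> H \<times> long_powers" using redw by (auto simp: reduced_pairs_def)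
    have ks: "k \<in> H" "pw s \<in> long_powers" using k by (auto simp: long_powers_def s_def)
    have sube: "set (replicate n (k, pw s)) \<subseteq> H \<times> long_powers" for n using ks by (cases n) auto
    have rep: "pairs_prod G (replicate n (k, pw s)) = e [^] n" for n
    proof (induction n)
      case (Suc n)
      have "e [^] Suc n = e \<otimes> e [^] n" using nat_pow_Suc2[OF ec] .
      then show ?case using Suc by (simp add: e_def)
    qed simp
    have ew: "e [^] m \<otimes> pairs_prod G ws \<in> H"
    proof -
      have "e [^] m \<otimes> (pairs_prod G ws \<otimes> h) = \<one>" using eq ws(3) by simp
      then have "e [^] m \<otimes> pairs_prod G ws \<otimes> h = \<one>"
        using ec pairs_prod_closed[OF subw] ws(2) by (simp add: m_assoc)
      then have "e [^] m \<otimes> pairs_prod G ws = inv h"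
        using ec pairs_prod_closed[OF subw] ws(2) by (intro inv_equality[symmetric]) auto
      then show ?thesis using ws(2) by simp
    qed
    have tl_rep: "fst p \<noteq> \<one>" if "p \<in> set (replicate n (k, pw s) @ us)" "\<forall>p\<in>set us. fst p \<noteq> \<one>" for n us p
      using that k by (cases n) auto
    have red_app: "reduced_pairs \<one> long_powers H (replicate n (k, pw s) @ us)"
      if "set us \<subseteq> H \<times> long_powers" "\<forall>p\<in>set us. fst p \<noteq> \<one>" for n us
      using that sube[of n] tl_rep[OF _ that(2), of _ n] list.set_sel(2)[of "replicate n (k, pw s) @ us"]
      unfolding reduced_pairs_def by (cases "replicate n (k, pw s) @ us = []") auto
    show False
    proof (cases "ws = [] \<or> fst (hd ws) \<noteq> \<one>")
      case True
      then have "\<forall>p\<in>set ws. fst p \<noteq> \<one>" using redw by (cases ws) (auto simp: reduced_pairs_def)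
      then have "pairs_prod G (replicate m (k, pw s) @ ws) \<notin> H"
        using m0 by (intro reduced_nontrivial red_app subw) auto
      then show False using ew pairs_prod_append[OF sube subw] rep by simp
    next
      case False
      then obtain c us where wsc: "ws = (\<one>, c) # us" by (cases ws) auto
      have c: "c \<in> ?P - {\<one>}" using ws(1) wsc by (auto simp: reduced_pairs_def)
      then obtain j where j: "c = pw (int t * j)" using generate_pw by auto
      have "j \<noteq> 0" using j c by (auto intro: ccontr)
      then have "int t * 1 \<le> int t * \<bar>j\<bar>" by (intro mult_left_mono) auto
      then have "int t \<le> \<bar>int t * j\<bar>" by (simp add: abs_mult)
      \<comment> \<open>At the junction \<open>x^s\<close> merges with a nontrivial power of
        \<open>x^t\<close>; as \<open>t\<close> is at least \<open>3 * t0\<close>, the combined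
        exponent is still long.\<close>
      then have "int t0 \<le> \<bar>s + int t * j\<bar>" using t unfolding s_def by linarith
      then have long: "pw (s + int t * j) \<in> long_powers" by (auto simp: long_powers_def)
      have us: "set us \<subseteq> H \<times> long_powers" "\<forall>p\<in>set us. fst p \<noteq> \<one>" using redw wsc by (auto simp: reduced_pairs_def)
      obtain n where n: "m = Suc n" using m0 by (cases m) auto
      let ?vs = "replicate n (k, pw s) @ (k, pw (s + int t * j)) # us"
      have "pairs_prod G ?vs = e [^] n \<otimes> (k \<otimes> pw (s + int t * j) \<otimes> pairs_prod G us)"
        using pairs_prod_append[OF sube, of "(k, pw (s + int t * j)) # us" n] us long k rep by simp
      also have "\<dots> = e [^] n \<otimes> (e \<otimes> pairs_prod G ws)"
        using k ec pairs_prod_closed[OF us(1)] by (simp add: wsc j pw_add e_def m_assoc)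
      also have "\<dots> = e [^] m \<otimes> pairs_prod G ws"
        using ec pairs_prod_closed[OF subw] by (simp add: n m_assoc)
      finally have "pairs_prod G ?vs \<in> H" using ew by simp
      moreover have "pairs_prod G ?vs \<notin> H"
        using us long k by (intro reduced_nontrivial red_app) auto
      ultimately show False by blast
    qed
  qed
qed

text \<open>The broken path through the \<open>p i\<close> is followed to an edge on which the word
  length crosses the level of \<open>z\<close>. By \<open>gp_between\<close>, \<open>z\<close> is
  near that edge, which consists of a translated segment with ends in a coset of \<open>H\<close>,
  contributing \<open>K\<close>, and one along the axis, contributing \<open>|g|/2\<close>. The
  final \<open>- 1\<close> is what \<open>quasiconvexI\<close> consumes.\<close>

lemma near_generated_subgroup:
  assumes Q: "quasiconvex G S K H" and t: "t0 \<le> t"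
    and ws: "reduced_pairs \<one> (generate G {pw (int t)} - {\<one>}) H ws" and h: "h \<in> H"
    and z: "z \<in> carrier G" "gp z \<one> (pairs_prod G ws \<otimes> h) \<le> 1"
  shows "\<exists>c\<in>generate G (insert (pw (int t)) H).
    wd z c \<le> max K (wl (pw (int t)) / 2) + 4 * r + 4 * real \<delta> - 1"
proof -
  let ?g = "pw (int t)"
  let ?C = "generate G (insert ?g H)" and ?P = "generate G {?g}"
  let ?hs = "\<lambda>i. fst (ws ! (i - 1))" and ?gs = "\<lambda>i. snd (ws ! (i - 1))"
  let ?n = "length ws"
  have subC: "subgroup ?C G" by (rule generate_is_subgroup) auto
  have C_mult: "a \<otimes> b \<in> ?C" if "a \<in> ?C" "b \<in> ?C" for a b by (rule subgroup.m_closed[OF subC that])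
  have HC: "k \<in> ?C" if "k \<in> H" for k using that by (auto intro: generate.incl)
  have PC: "k \<in> ?C" if "k \<in> ?P" for k using that mono_generate[of "{?g}" "insert ?g H"] by auto
  have red: "reduced_pairs \<one> long_powers H ws" by (rule reduced_generate_long[OF t ws])
  have sub: "set ws \<subseteq> H \<times> long_powers" using red by (auto simp: reduced_pairs_def)
  have subP: "set ws \<subseteq> H \<times> ?P" using ws by (auto simp: reduced_pairs_def)
  have alt: "alt ?n ?hs ?gs" by (rule alt_pairs[OF red])
  define w where "w = pairs_prod G ws \<otimes> h"
  have apn: "ap ?hs ?gs ?n = pairs_prod G ws" using ap_pairs[OF sub order_refl] by simp
  define p where "p i = (if i \<le> ?n then ap ?hs ?gs i else w)" for i
  have wc: "w \<in> carrier G" using pairs_prod_closed[OF sub] h by (simp add: w_def)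
  have pc: "p i \<in> carrier G" for i using ap_closed[OF alt] wc by (simp add: p_def)
  have letter: "?hs (Suc i) \<in> H" "?gs (Suc i) \<in> ?P" if "i < ?n" for i
    using subP nth_mem[OF that] by (auto simp: mem_Times_iff)
  have apC: "i \<le> ?n \<Longrightarrow> ap ?hs ?gs i \<in> ?C" for i
  proof (induction i)
    case 0
    then show ?case using generate.one by simp
  next
    case (Suc i)
    then show ?case using letter[of i] C_mult HC PC by (simp add: alternating_product.simps(2))
  qed
  have wC: "w \<in> ?C" unfolding w_def using apC[OF order_refl] HC[OF h] C_mult by (simp only: apn)
  have pC: "p i \<in> ?C" for i using apC wC by (simp add: p_def)
  have p0: "p 0 = \<one>" by (simp add: p_def)
  have pw': "p (Suc ?n) = w" by (simp add: p_def)
  \<comment> \<open>\<open>alt_chain\<close> gives \<open>\<rho> + 3 * \<delta>\<close> at the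
    vertices; the additional 1 makes room for \<open>z\<close>, whose product is at most 1.\<close>
  define \<epsilon> where "\<epsilon> = \<rho> + 3 * real \<delta> + 1"
  have e0: "1 \<le> \<epsilon>" using rho_nonneg delta_nonneg by (simp add: \<epsilon>_def)
  have pg: "gp (p i) \<one> w \<le> \<epsilon>" if "i \<le> Suc ?n" for i
  proof -
    consider "i = 0" | "i = Suc ?n" | "0 < i" "i \<le> ?n" using \<open>i \<le> Suc ?n\<close> by linarith
    then show ?thesis
    proof cases
      case 1
      then show ?thesis using e0 wc by (simp add: p0 gromov_product_def)
    next
      case 2
      then show ?thesis using e0 wc by (simp add: pw' gromov_product_def)
    next
      case 3
      then have "gp (ap ?hs ?gs i) \<one> (ap ?hs ?gs ?n \<otimes> h) \<le> \<rho> + 3 * real \<delta>"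
        using alt_chain[OF alt h] by blast
      then have "gp (p i) \<one> w \<le> \<rho> + 3 * real \<delta>" using 3 unfolding apn w_def[symmetric] p_def by simp
      then show ?thesis by (simp add: \<epsilon>_def)
    qed
  qed
  have zg: "gp z \<one> w \<le> \<epsilon>" using z(2) e0 by (simp add: w_def)
  define B where "B = max K (wl ?g / 2) + 4 * r + 4 * real \<delta> - 1"
  have mx: "K \<le> max K (wl ?g / 2)" "wl ?g / 2 \<le> max K (wl ?g / 2)" "0 \<le> max K (wl ?g / 2)"
    by (simp_all add: max.coboundedI2)
  have r20: "20 * \<rho> + 20 * axis_const + 20 * real \<delta> + 20 \<le> r" using r_big by (simp add: algebra_simps)
  have nn: "0 \<le> \<rho>" "0 \<le> axis_const" "0 \<le> real \<delta>" using rho_nonneg axis_const_nonneg delta_nonneg by auto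
  \<comment> \<open>\<open>gp_between\<close> yields \<open>2 * \<epsilon> + 2 * \<delta>\<close>,
    and splitting an edge by \<open>hyp\<close> adds another \<open>\<delta>\<close>.\<close>
  define \<epsilon>' where "\<epsilon>' = 2 * \<epsilon> + 3 * real \<delta>"
  have eps: "2 * \<epsilon> = 2 * \<rho> + 6 * real \<delta> + 2" by (simp add: \<epsilon>_def)
  have eps': "4 * \<epsilon>' = 8 * \<rho> + 36 * real \<delta> + 8" by (simp add: \<epsilon>'_def \<epsilon>_def)
  have segH: "\<exists>c\<in>?C. wd z c \<le> B" if ak: "a \<in> ?C" "k \<in> H" "gp z a (a \<otimes> k) \<le> \<epsilon>'" for a k
  proof -
    have ac: "a \<in> carrier G" using ak(1) subgroup.mem_carrier[OF subC] by blast
    have az: "a \<otimes> (inv a \<otimes> z) = z" using ac z by (simp add: m_assoc[symmetric])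
    have "gp (inv a \<otimes> z) \<one> k = gp z a (a \<otimes> k)"
      using gp_left[of a "inv a \<otimes> z" \<one> k] ac z ak(2) unfolding az by simp
    then obtain c where c: "c \<in> H" "wd (inv a \<otimes> z) c \<le> K + 1 + 4 * \<epsilon>' + 2 * real \<delta>"
      using quasiconvex_near[OF Q subgroup.subset[OF H_sub] H_one ak(2), of "inv a \<otimes> z" \<epsilon>'] ak(3) ac z(1) by auto
    have "wd z (a \<otimes> c) = wd (inv a \<otimes> z) c" using wd_left[of a "inv a \<otimes> z" c] ac z c unfolding az by simp
    then have "wd z (a \<otimes> c) \<le> B" using c(2) mx nn r20 eps' unfolding B_def by linarith
    then show ?thesis using C_mult[OF ak(1) HC[OF c(1)]] by blast
  qed
  have segP: "\<exists>c\<in>?C. wd z c \<le> B" if ak: "a \<in> ?C" "k \<in> ?P" "gp z a (a \<otimes> k) \<le> \<epsilon>'" for a k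
  proof -
    have ac: "a \<in> carrier G" using ak(1) subgroup.mem_carrier[OF subC] by blast
    obtain b where b: "k = pw (int t * b)" using ak(2) generate_pw by auto
    have az: "a \<otimes> (inv a \<otimes> z) = z" using ac z by (simp add: m_assoc[symmetric])
    have "gp (inv a \<otimes> z) \<one> k = gp z a (a \<otimes> k)"
      using gp_left[of a "inv a \<otimes> z" \<one> k] ac z b unfolding az by simp
    then obtain i where i: "wd (inv a \<otimes> z) (pw (int t * i)) \<le> wl ?g / 2 + 4 * \<epsilon>' + 2 * axis_const + 2 * real \<delta>"
      using near_axis[of "inv a \<otimes> z" t 0 b \<epsilon>'] ak(3) ac z b by auto
    have "wd z (a \<otimes> pw (int t * i)) = wd (inv a \<otimes> z) (pw (int t * i))"
      using wd_left[of a "inv a \<otimes> z" "pw (int t * i)"] ac z unfolding az by simp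
    then have "wd z (a \<otimes> pw (int t * i)) \<le> B" using i mx nn r20 eps' unfolding B_def by linarith
    moreover have "pw (int t * i) \<in> ?P" using generate_pw by blast
    ultimately show ?thesis using C_mult[OF ak(1) PC] by blast
  qed
  have point: "\<exists>c\<in>?C. wd z c \<le> B" if "i \<le> Suc ?n" "\<bar>wl z - wl (p i)\<bar> \<le> 2" for i
  proof -
    have "wd z (p i) \<le> \<bar>wd \<one> z - wd \<one> (p i)\<bar> + 2 * \<epsilon> + 2 * real \<delta>"
      by (rule near_points_close[OF _ wc z(1) pc zg pg[OF that(1)]]) simp
    then have "wd z (p i) \<le> B"
      using that(2) mx nn r20 eps unfolding B_def wd_one_left[OF z(1)] wd_one_left[OF pc] by linarith
    then show ?thesis using pC by blast
  qed
  have "\<exists>c\<in>?C. wd z c \<le> B"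
  proof (cases "wl w \<le> wl z")
    case True
    have "2 * gp z \<one> w = wl z + wd w z - wl w" using gp_double[of z \<one> w] z wc by simp
    \<comment> \<open>A point beyond the level of \<open>w\<close> exceeds it by at most twice its
      Gromov product, hence by at most 2.\<close>
    then have "\<bar>wl z - wl (p (Suc ?n))\<bar> \<le> 2" using z(2) True wd_nonneg[of w z] unfolding pw' w_def[symmetric] by linarith
    then show ?thesis using point by blast
  next
    case False
    have "\<exists>j\<le>Suc ?n. (j < Suc ?n \<and> wl (p j) \<le> wl z \<and> wl z \<le> wl (p (Suc j))) \<or> wl (p j) = wl z"
      by (rule real_step_crossing) (use False in \<open>simp_all add: p0 pw'\<close>)
    then obtain j where j: "j \<le> Suc ?n" "(j < Suc ?n \<and> wl (p j) \<le> wl z \<and> wl z \<le> wl (p (Suc j))) \<or> wl (p j) = wl z"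
      by blast
    show ?thesis
    proof (cases "wl (p j) = wl z")
      case True
      then show ?thesis using point[OF j(1)] by simp
    next
      case neq: False
      then have jn: "j \<le> ?n" "wl (p j) \<le> wl z" "wl z \<le> wl (p (Suc j))" using j(2) by auto
      have g2: "gp z (p j) (p (Suc j)) \<le> 2 * \<epsilon> + 2 * real \<delta>"
        by (rule gp_between[OF _ wc pc pc z(1) pg pg zg]) (use jn z(1) pc in auto)
      show ?thesis
      proof (cases "j = ?n")
        case True
        have "p ?n = pairs_prod G ws" unfolding p_def apn[symmetric] by simp
        then have "p (Suc j) = p j \<otimes> h" by (simp only: True pw' w_def)
        then show ?thesis using segH[OF pC h, of j] g2 nn by (simp add: \<epsilon>'_def)
      next
        case False
        then have jl: "j < ?n" using jn by simp
        let ?h = "?hs (Suc j)" and ?k = "?gs (Suc j)"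
        have lc: "?h \<in> carrier G" "?k \<in> carrier G"
          using letter[OF jl] PC subgroup.mem_carrier[OF subC] H_carrier by blast+
        have S: "p (Suc j) = p j \<otimes> ?h \<otimes> ?k" using jl by (simp add: p_def alternating_product.simps(2))
        \<comment> \<open>The intermediate vertex \<open>p j h\<close> splits the edge into its part
          from \<open>H\<close> and its part along the axis, and \<open>z\<close> is near one of the
          two.\<close>
        have "gp z (p j) (p (Suc j)) \<ge> min (gp z (p j) (p j \<otimes> ?h)) (gp z (p (Suc j)) (p j \<otimes> ?h)) - real \<delta>"
          by (rule hyp) (use pc z lc in auto)
        then consider "gp z (p j) (p j \<otimes> ?h) \<le> \<epsilon>'" | "gp z (p (Suc j)) (p j \<otimes> ?h) \<le> \<epsilon>'"
          using g2 unfolding \<epsilon>'_def by (auto simp: min_def split: if_splits)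
        then show ?thesis
        proof cases
          case 1
          then show ?thesis using segH[OF pC letter(1)[OF jl]] by blast
        next
          case 2
          have "gp z (p j \<otimes> ?h) (p j \<otimes> ?h \<otimes> ?k) = gp z (p (Suc j)) (p j \<otimes> ?h)"
            unfolding S by (rule gp_sym) (use pc lc in auto)
          then show ?thesis using 2 segP[OF C_mult[OF pC[of j] HC[OF letter(1)[OF jl]]] letter(2)[OF jl]] by simp
        qed
      qed
    qed
  qed
  then show ?thesis by (simp add: B_def)
qed

lemma generated_quasiconvex:
  assumes Q: "quasiconvex G S K H" and t: "t0 \<le> t"
  shows "quasiconvex G S (4 * real \<delta> + 4 * r + max K (wl (pw (int t)) / 2)) (generate G (insert (pw (int t)) H))"
proof (rule quasiconvexI)
  let ?C = "generate G (insert (pw (int t)) H)"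
  have subC: "subgroup ?C G" by (rule generate_is_subgroup) auto
  show "?C \<subseteq> carrier G" by (rule subgroup.subset[OF subC])
  fix a b z assume ab: "a \<in> ?C" "b \<in> ?C" and z: "z \<in> carrier G" "gp z a b \<le> 1"
  have c: "a \<in> carrier G" "b \<in> carrier G" using ab subgroup.mem_carrier[OF subC] by auto
  have "inv a \<otimes> b \<in> ?C" using ab subgroup.m_closed[OF subC] subgroup.m_inv_closed[OF subC] by blast
  then obtain ws h where ws: "reduced_pairs \<one> (generate G {pw (int t)} - {\<one>}) H ws" "h \<in> H"
    "inv a \<otimes> b = pairs_prod G ws \<otimes> h" by (rule generated_normal_form)
  have az: "a \<otimes> (inv a \<otimes> z) = z" "a \<otimes> (inv a \<otimes> b) = b" using c z by (simp_all add: m_assoc[symmetric])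
  have "gp (inv a \<otimes> z) \<one> (inv a \<otimes> b) = gp z a b"
    using gp_left[of a "inv a \<otimes> z" \<one> "inv a \<otimes> b"] c z unfolding az by simp
  then obtain v where v: "v \<in> ?C" "wd (inv a \<otimes> z) v \<le> max K (wl (pw (int t)) / 2) + 4 * r + 4 * real \<delta> - 1"
    using near_generated_subgroup[OF Q t ws(1,2), of "inv a \<otimes> z"] z c unfolding ws(3) by auto
  have vc: "v \<in> carrier G" using v(1) subgroup.mem_carrier[OF subC] by blast
  have "wd z (a \<otimes> v) = wd (inv a \<otimes> z) v" using wd_left[of a "inv a \<otimes> z" v] c z vc unfolding az by simp
  moreover have "a \<otimes> v \<in> ?C" by (rule subgroup.m_closed[OF subC ab(1) v(1)])
  ultimately show "\<exists>c\<in>?C. wd z c \<le> 4 * real \<delta> + 4 * r + max K (wl (pw (int t)) / 2) - 1"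
    using v(2) by (intro bexI[of _ "a \<otimes> v"]) auto
qed

lemma product_inequalities:
  assumes t: "t0 \<le> t" and n: "1 \<le> n"
    and gs: "\<forall>i\<in>{1..n}. gs i \<in> generate G {pw (int t)} - {\<one>}"
    and hs: "\<forall>i\<in>{1..n}. hs i \<in> H" "\<forall>i. 1 < i \<and> i \<le> n \<longrightarrow> hs i \<noteq> \<one>"
  shows "\<forall>i\<in>{1..n}. wl (gs i) > 15 * r"
    and "wl (hs 1 \<otimes> gs 1) \<ge> wl (hs 1) + wl (gs 1) - 2 * r"
    and "\<forall>i. 1 < i \<and> i \<le> n \<longrightarrow>
      wl (gs (i - 1) \<otimes> hs i \<otimes> gs i) \<ge> wl (gs (i - 1)) + wl (hs i) + wl (gs i) - 2 * r"
    and "wl (ap hs gs n) \<ge> wl (ap hs gs (n - 1)) + wl (hs n) + wl (gs n) - 5 * r"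
proof -
  have long: "gs i \<in> long_powers" if "i \<in> {1..n}" for i
    using generate_pw_long[OF t] gs that by blast
  have rr: "\<rho> \<le> r" using r_pos by linarith
  show "\<forall>i\<in>{1..n}. wl (gs i) > 15 * r" using long long_wl by blast
  obtain a where "gs 1 = pw a" using long_pw long[of 1] n by auto
  then show "wl (hs 1 \<otimes> gs 1) \<ge> wl (hs 1) + wl (gs 1) - 2 * r"
    using wl_H_pw[of "hs 1" a] hs(1) n rr by simp
  show "\<forall>i. 1 < i \<and> i \<le> n \<longrightarrow>
      wl (gs (i - 1) \<otimes> hs i \<otimes> gs i) \<ge> wl (gs (i - 1)) + wl (hs i) + wl (gs i) - 2 * r"
  proof (intro allI impI)
    fix i assume i: "1 < i \<and> i \<le> n"
    then have "i - 1 \<in> {1..n}" "i \<in> {1..n}" by auto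
    then obtain a b where ab: "gs (i - 1) = pw a" "gs i = pw b" using long_pw long by meson
    have "hs i \<in> H" "hs i \<noteq> \<one>" using hs i by auto
    from rho_triple[OF this, of a b] show
      "wl (gs (i - 1) \<otimes> hs i \<otimes> gs i) \<ge> wl (gs (i - 1)) + wl (hs i) + wl (gs i) - 2 * r"
      using rr unfolding ab by linarith
  qed
  have "alt n hs gs" using long hs by (auto simp: alt_def)
  then show "wl (ap hs gs n) \<ge> wl (ap hs gs (n - 1)) + wl (hs n) + wl (gs n) - 5 * r"
    using alt_growth n by blast
qed

end

theorem theorem4p6:
  fixes G :: "('a, 'b) monoid_scheme" (structure)
    and S H :: "'a set" and \<delta> :: nat and x :: 'a
  assumes "group G"
    and "finite S" and "S \<subseteq> carrier G" and "generate G S = carrier G"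
    and "hyperbolic_group G S \<delta>"
    and "\<not> elementary_group G"
    and "subgroup H G" and "\<exists>K. quasiconvex G S K H"
    and "x \<in> carrier G" and "group.ord G x = 0"
    and "max_elementary G x \<inter> H = {\<one>}"
  shows "\<exists>r\<^sub>0::real.
    (\<forall>h\<in>H. \<forall>s::int. gromov_product (word_dist G S) \<one> (x [^] s) h < r\<^sub>0 / 2) \<and>
    (\<forall>K::real. quasiconvex G S K H \<longrightarrow>
      (\<forall>r\<ge>r\<^sub>0. \<exists>t'::nat. t' > 0 \<and> (\<forall>t\<ge>t'. \<forall>g H\<^sub>1. g = x [^] t \<and> H\<^sub>1 = generate G (insert g H) \<longrightarrow>
        quasiconvex G S (4 * real \<delta> + 4 * r + max K (word_length G S g / 2)) H\<^sub>1 \<and>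
        infinite (rcosets H\<^sub>1) \<and>
        canonically_free_product G (generate G {g}) H H\<^sub>1 \<and>
        r \<ge> 48 * real \<delta> \<and>
        (\<forall>n\<ge>1. \<forall>gs hs :: nat \<Rightarrow> 'a.
          (\<forall>i\<in>{1..n}. gs i \<in> generate G {g} - {\<one>}) \<and>
          (\<forall>i\<in>{1..n}. hs i \<in> H) \<and>
          (\<forall>i. 1 < i \<and> i \<le> n \<longrightarrow> hs i \<noteq> \<one>) \<longrightarrow>
          (\<forall>i\<in>{1..n}. word_length G S (gs i) > 15 * r) \<and>
          word_length G S (hs 1 \<otimes> gs 1)
            \<ge> word_length G S (hs 1) + word_length G S (gs 1) - 2 * r \<and>
          (\<forall>i. 1 < i \<and> i \<le> n \<longrightarrow>
            word_length G S (gs (i - 1) \<otimes> hs i \<otimes> gs i)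
              \<ge> word_length G S (gs (i - 1)) + word_length G S (hs i)
                 + word_length G S (gs i) - 2 * r) \<and>
          word_length G S (alternating_product G hs gs n)
            \<ge> word_length G S (alternating_product G hs gs (n - 1))
               + word_length G S (hs n) + word_length G S (gs n) - 5 * r))))"
proof -
  interpret hyp_group G S \<delta>
    by (intro hyp_group.intro fg_group.intro fg_group_axioms.intro hyp_group_axioms.intro assms(1-5))
  interpret loxodromic G S \<delta> x
    by (intro loxodromic.intro loxodromic_axioms.intro hyp_group_axioms) (use assms in auto)
  \<comment> \<open>Any single constant serves to fix \<open>\<rho>\<close>, and with it
    \<open>r\<^sub>0\<close>, before the \<open>K\<close> of the second claim is introduced.\<close>
  obtain K\<^sub>0 where K0: "quasiconvex G S K\<^sub>0 H" using assms(8) by blast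
  obtain \<rho> where rho: "0 \<le> \<rho>" "\<And>h s. h \<in> H \<Longrightarrow> gp \<one> (pw s) h \<le> \<rho>"
    "\<And>h a b. \<lbrakk>h \<in> H; h \<noteq> \<one>\<rbrakk> \<Longrightarrow>
      wl (pw a \<otimes> h \<otimes> pw b) \<ge> wl (pw a) + wl h + wl (pw b) - 2 * \<rho>"
    using subgroup_axis_constant[OF assms(7) K0] assms(11) unfolding max_elementary_eq by blast
  \<comment> \<open>The first summand is the lower bound demanded by \<open>axis_pair\<close>, and
    its \<open>+ 1\<close> makes the first claim strict; the second summand yields
    \<open>r \<ge> 48 * \<delta>\<close>.\<close>
  define r\<^sub>0 where "r\<^sub>0 = 20 * (\<rho> + axis_const + real \<delta> + 1) + 48 * real \<delta>"
  have pos: "0 \<le> axis_const" "0 \<le> real \<delta>" using axis_const_nonneg delta_nonneg by auto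
  have i: "\<forall>h\<in>H. \<forall>s. gp \<one> (pw s) h < r\<^sub>0 / 2"
  proof (intro ballI allI)
    fix h s assume "h \<in> H"
    then have "gp \<one> (pw s) h \<le> \<rho>" by (rule rho(2))
    then show "gp \<one> (pw s) h < r\<^sub>0 / 2" using rho(1) pos by (simp add: r\<^sub>0_def)
  qed
  have ii: "\<exists>t'>0. \<forall>t\<ge>t'. \<exists>t0. axis_pair G S \<delta> x H \<rho> r t0 \<and> 3 * t0 \<le> t" if r: "r\<^sub>0 \<le> r" for r
  proof -
    obtain t0 where t0: "0 < t0" "\<And>i. int t0 \<le> \<bar>i\<bar> \<Longrightarrow> wl (pw i) > 15 * r"
      using pw_tends[of "15 * r"] by blast
    have "axis_pair G S \<delta> x H \<rho> r t0"
      by (intro axis_pair.intro axis_pair_axioms.intro loxodromic_axioms)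
        (use assms(7) rho t0 r pos in \<open>auto simp: r\<^sub>0_def\<close>)
    \<comment> \<open>The factor 3 leaves room for the merged exponents in
      \<open>infinite_index\<close>.\<close>
    then show ?thesis using t0(1) by (intro exI[of _ "3 * t0"]) auto
  qed
  show ?thesis
  proof (rule exI[of _ r\<^sub>0], rule conjI[OF i], intro allI impI, goal_cases)
    case K: (1 K r)
    have r48: "r \<ge> 48 * real \<delta>" using K(2) rho(1) pos by (simp add: r\<^sub>0_def)
    obtain t' where t': "0 < t'" "\<And>t. t' \<le> t \<Longrightarrow> \<exists>t0. axis_pair G S \<delta> x H \<rho> r t0 \<and> 3 * t0 \<le> t"
      using ii[OF K(2)] by blast
    show ?case
    proof (rule exI[of _ t'], rule conjI[OF t'(1)], intro allI impI, elim conjE, goal_cases)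
      case t: (1 t g H\<^sub>1)
      then have g: "g = pw (int t)" by (simp only: int_pow_int)
      obtain t0 where t0: "axis_pair G S \<delta> x H \<rho> r t0" "3 * t0 \<le> t" using t'(2)[OF t(1)] by blast
      interpret axis_pair G S \<delta> x H \<rho> r t0 by (rule t0(1))
      have tt: "t0 \<le> t" using t0(2) by simp
      show ?case
        unfolding t(3) g
      proof (intro conjI generated_quasiconvex[OF K(1) tt] infinite_index[OF t0(2) assms(6)] free_product[OF tt] r48,
          intro allI impI, elim conjE, goal_cases)
        case (1 n gs hs)
        show ?case by (intro conjI product_inequalities[OF tt 1])
      qed
    qed
  qed
qed

end
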